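(* Let $G$ be a locally Wasserstein Polish group and let $X$ be a standard Borel $G$-space, i.e. a standard Borel space with a jointly Borel action $G\times X\to X$, $(g,x)\mapsto g.x$. Let $\mu$ be a $\sigma$-finite Borel measure on $X$ which is $G$-quasi-invariant, i.e. for every $g\in G$ the measures $g_{\ast}\mu$ and $\mu$ are mutually absolutely continuous. Then $\mu$ is supported on the set of fixed points: $$\mu\big(X\setminus\operatorname{Fix}(G\curvearrowright X)\big)=0,\qquad \operatorname{Fix}(G\curvearrowright X):=\{x\in X: g.x=x\ \text{for all } g\in G\}.$$
   Context: The set $\operatorname{Fix}(G\curvearrowright X)$ is Borel for every standard Borel $G$-space of a Polish group $G$. **Measure metric groups and the Wasserstein modulus.** A measure metric group $(K,d,m)$ consists of a compact metrizable group $K$, a compatible right-invariant metric $d$ on $K$ (so $d(xg,yg)=d(x,y)$), and the Haar probability measure $m$ of $K$. Write $e_K$ for the identity and $B_d(r):=\{h\in K: d(e_K,h)\le r\}$. Let $\mathcal{D}(K,m):=\{\phi\in L^1(K,m):\phi\ge 0,\ \int_K\phi\,dm=1\}$; for $\phi\in\mathcal{D}(K,m)$ let $\phi m$ be the probability measure with density $\phi$ with respect to $m$, and for $h\in K$ put $(h.\phi)(g):=\phi(h^{-1}g)$. Put $\mathbf{V}_m(\phi,\phi'):=\frac12\int_K|\phi-\phi'|\,dm$, and for Borel probability measures $\alpha,\beta$ on $K$ put $\mathbf{W}_d(\alpha,\beta):=\sup_f\left|\int f\,d\alpha-\int f\,d\beta\right|$, the supremum over all real functions $f$ on $K$ that are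 $1$-Lipschitz with respect to $d$. A $\mathcal{D}(K,m)$-valued measurable kernel is a family $\Phi=\{\phi_z:z\in Z\}\subset\mathcal{D}(K,m)$ indexed by a probability space $(Z,\zeta)$ and measurable (i.e. $(z,g)\mapsto\phi_z(g)$ is measurable). Put $$\mathbf{v}_m(\Phi,r):=\sup_{h\in B_d(r)}\int_Z\mathbf{V}_m(h.\phi_z,\phi_z)\,d\zeta(z),\qquad \mathbf{w}_d(\Phi):=\int_Z\mathbf{W}_d(\phi_z m,m)\,d\zeta(z),$$ and, for $r,\epsilon>0$, $\Omega_{(K,d,m)}(r,\epsilon):=\sup\{\mathbf{w}_d(\Phi):\mathbf{v}_m(\Phi,r)\le\epsilon\}$, the supremum over all $\mathcal{D}(K,m)$-valued measurable kernels $\Phi$ (over all probability spaces). **Wasserstein families.** A sequence $(K_n,d_n,m_n)_{n\ge1}$ of measure metric groups is a Wasserstein family if there is a sequence of positive numbers $r_n\to0$ such that $\Omega_{(K_n,d_n,m_n)}(r_n,\epsilon_n)\to0$ for every sequence of positive numbers $\epsilon_n\to0$. **Wasserstein and locally Wasserstein groups.** A Polish group $G$ is a Wasserstein group if it admits a compatible right-invariant metric $d$ and an increasing sequence of compact subgroups $K_1\le K_2\le\cdots$ of $G$ with dense union such that $(K_n,d|_{K_n},m_n)_{n\ge1}$ is a Wasserstein family, where $m_n$ is the Haar probability measure of $K_n$. A Polish group $G$ is locally Wasserstein if there are Wasserstein groups $H_1,H_2,\dots$ and continuous homomorphisms $\iota_n:H_n\to G$ such that $\bigcup_{n\ge1}\iota_n(H_n)$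 generates a dense subgroup of $G$. *)

theory Defs
  imports "HOL-Probability.Probability" "HOL-Algebra.Group_Action" "HOL-Algebra.Generated_Groups"
begin

section \<open>Topological groups and Borel spaces\<close>

definition borel_of :: "'a topology \<Rightarrow> 'a measure" where
  "borel_of T = sigma (topspace T) {U. openin T U}"

definition polish_space_top :: "'a topology \<Rightarrow> bool" where
  "polish_space_top T \<longleftrightarrow> completely_metrizable_space T \<and> separable_space T"

text \<open>Only the \<sigma>-algebra of \<open>M\<close> matters here; \<open>M\<close> may carry any measure.\<close>

definition standard_borel :: "'a measure \<Rightarrow> bool" where
  "standard_borel M \<longleftrightarrow> (\<exists>T. polish_space_top T \<and> sets M = sets (borel_of T))"

definition topological_group :: "'a monoid \<Rightarrow> 'a topology \<Rightarrow> bool" where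
  "topological_group G T \<longleftrightarrow> group G \<and> topspace T = carrier G \<and>
     continuous_map (prod_topology T T) T (\<lambda>(x, y). x \<otimes>\<^bsub>G\<^esub> y) \<and>
     continuous_map T T (\<lambda>x. inv\<^bsub>G\<^esub> x)"

definition polish_group :: "'a monoid \<Rightarrow> 'a topology \<Rightarrow> bool" where
  "polish_group G T \<longleftrightarrow> topological_group G T \<and> polish_space_top T"

definition right_invariant :: "'a monoid \<Rightarrow> ('a \<Rightarrow> 'a \<Rightarrow> real) \<Rightarrow> bool" where
  "right_invariant G d \<longleftrightarrow>
     (\<forall>x\<in>carrier G. \<forall>y\<in>carrier G. \<forall>g\<in>carrier G. d (x \<otimes>\<^bsub>G\<^esub> g) (y \<otimes>\<^bsub>G\<^esub> g) = d x y)"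

text \<open>
  On a compact metrizable group there is exactly one left-invariant Borel probability measure;
  regularity and right-invariance are then automatic.
\<close>

definition haar_probability :: "'a monoid \<Rightarrow> 'a topology \<Rightarrow> 'a measure \<Rightarrow> bool" where
  "haar_probability K T m \<longleftrightarrow> prob_space m \<and> sets m = sets (borel_of T) \<and>
     (\<forall>g\<in>carrier K. distr m m (\<lambda>x. g \<otimes>\<^bsub>K\<^esub> x) = m)"


section \<open>Measure metric groups and the Wasserstein modulus\<close>

text \<open>
  The topology of \<open>K\<close> is not a separate datum: compatibility of \<open>d\<close> means that it is
  the metric topology of \<open>d\<close>.
\<close>

definition measure_metric_group ::
    "'a monoid \<Rightarrow> ('a \<Rightarrow> 'a \<Rightarrow> real) \<Rightarrow> 'a measure \<Rightarrow> bool" where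
  "measure_metric_group K d m \<longleftrightarrow>
     Metric_space (carrier K) d \<and>
     topological_group K (Metric_space.mtopology (carrier K) d) \<and>
     compact_space (Metric_space.mtopology (carrier K) d) \<and>
     right_invariant K d \<and>
     haar_probability K (Metric_space.mtopology (carrier K) d) m"

definition group_ball :: "'a monoid \<Rightarrow> ('a \<Rightarrow> 'a \<Rightarrow> real) \<Rightarrow> real \<Rightarrow> 'a set" where
  "group_ball K d r = {h \<in> carrier K. d \<one>\<^bsub>K\<^esub> h \<le> r}"

text \<open>Representatives of elements of \<open>L\<^sup>1\<close>, hence nonnegativity only almost everywhere.\<close>

definition densities :: "'a measure \<Rightarrow> ('a \<Rightarrow> real) set" where
  "densities m = {\<phi>. integrable m \<phi> \<and> (AE x in m. 0 \<le> \<phi> x) \<and> (LINT x|m. \<phi> x) = 1}"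

definition translate :: "'a monoid \<Rightarrow> 'a \<Rightarrow> ('a \<Rightarrow> real) \<Rightarrow> 'a \<Rightarrow> real" where
  "translate K h \<phi> = (\<lambda>g. \<phi> (inv\<^bsub>K\<^esub> h \<otimes>\<^bsub>K\<^esub> g))"

text \<open>
  The quantities below are bounded and nonnegative; they take values in \<^typ>\<open>ennreal\<close> so that
  suprema and integrals need no side conditions.
\<close>

definition variation_dist :: "'a measure \<Rightarrow> ('a \<Rightarrow> real) \<Rightarrow> ('a \<Rightarrow> real) \<Rightarrow> ennreal" where
  "variation_dist m \<phi> \<phi>' = (\<integral>\<^sup>+x. ennreal \<bar>\<phi> x - \<phi>' x\<bar> \<partial>m) / 2"

definition wasserstein_dist ::
    "'a set \<Rightarrow> ('a \<Rightarrow> 'a \<Rightarrow> real) \<Rightarrow> 'a measure \<Rightarrow> 'a measure \<Rightarrow> ennreal" where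
  "wasserstein_dist A d \<alpha> \<beta> =
     (SUP f\<in>{f :: 'a \<Rightarrow> real. \<forall>x\<in>A. \<forall>y\<in>A. \<bar>f x - f y\<bar> \<le> d x y}.
        ennreal \<bar>(LINT x|\<alpha>. f x) - (LINT x|\<beta>. f x)\<bar>)"

definition density_kernel :: "'a measure \<Rightarrow> 'z measure \<Rightarrow> ('z \<Rightarrow> 'a \<Rightarrow> real) \<Rightarrow> bool" where
  "density_kernel m \<zeta> \<Phi> \<longleftrightarrow> prob_space \<zeta> \<and>
     (\<lambda>(z, g). \<Phi> z g) \<in> borel_measurable (\<zeta> \<Otimes>\<^sub>M m) \<and> (\<forall>z\<in>space \<zeta>. \<Phi> z \<in> densities m)"

definition kernel_variation ::
    "'a monoid \<Rightarrow> ('a \<Rightarrow> 'a \<Rightarrow> real) \<Rightarrow> 'a measure \<Rightarrow> 'z measure \<Rightarrow> ('z \<Rightarrow> 'a \<Rightarrow> real) \<Rightarrow> real \<Rightarrow> ennreal"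
  where
  "kernel_variation K d m \<zeta> \<Phi> r =
     (SUP h\<in>group_ball K d r. \<integral>\<^sup>+z. variation_dist m (translate K h (\<Phi> z)) (\<Phi> z) \<partial>\<zeta>)"

definition kernel_wasserstein ::
    "'a monoid \<Rightarrow> ('a \<Rightarrow> 'a \<Rightarrow> real) \<Rightarrow> 'a measure \<Rightarrow> 'z measure \<Rightarrow> ('z \<Rightarrow> 'a \<Rightarrow> real) \<Rightarrow> ennreal"
  where
  "kernel_wasserstein K d m \<zeta> \<Phi> =
     (\<integral>\<^sup>+z. wasserstein_dist (carrier K) d (density m (\<lambda>x. ennreal (\<Phi> z x))) m \<partial>\<zeta>)"

text \<open>
  The supremum ranges over all probability spaces whose points are real numbers, with arbitrary
  \<sigma>-algebra and measure. This covers arbitrary probability spaces: both functionals depend only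
  on the law of \<open>z \<mapsto> \<Phi> z\<close>, a Borel probability measure on the set of densities, which is a
  closed subset of the separable Banach space \<open>L\<^sup>1(K,m)\<close> and so Borel isomorphic to a
  Borel subset of the real line.
\<close>

definition wasserstein_modulus ::
    "'a monoid \<Rightarrow> ('a \<Rightarrow> 'a \<Rightarrow> real) \<Rightarrow> 'a measure \<Rightarrow> real \<Rightarrow> real \<Rightarrow> ennreal" where
  "wasserstein_modulus K d m r \<epsilon> =
     (SUP (\<zeta>, \<Phi>) \<in> {(\<zeta> :: real measure, \<Phi>).
          density_kernel m \<zeta> \<Phi> \<and> kernel_variation K d m \<zeta> \<Phi> r \<le> ennreal \<epsilon>}.
        kernel_wasserstein K d m \<zeta> \<Phi>)"


section \<open>Wasserstein and locally Wasserstein groups\<close>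

definition wasserstein_family ::
    "(nat \<Rightarrow> 'a monoid) \<Rightarrow> (nat \<Rightarrow> 'a \<Rightarrow> 'a \<Rightarrow> real) \<Rightarrow> (nat \<Rightarrow> 'a measure) \<Rightarrow> bool" where
  "wasserstein_family K d m \<longleftrightarrow>
     (\<forall>n. measure_metric_group (K n) (d n) (m n)) \<and>
     (\<exists>r :: nat \<Rightarrow> real. (\<forall>n. 0 < r n) \<and> r \<longlonglongrightarrow> 0 \<and>
        (\<forall>\<epsilon> :: nat \<Rightarrow> real. (\<forall>n. 0 < \<epsilon> n) \<longrightarrow> \<epsilon> \<longlonglongrightarrow> 0 \<longrightarrow>
           (\<lambda>n. wasserstein_modulus (K n) (d n) (m n) (r n) (\<epsilon> n)) \<longlonglongrightarrow> 0))"

definition wasserstein_group :: "'a monoid \<Rightarrow> 'a topology \<Rightarrow> bool" where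
  "wasserstein_group G T \<longleftrightarrow> polish_group G T \<and>
     (\<exists>d K m.
        Metric_space (carrier G) d \<and> Metric_space.mtopology (carrier G) d = T \<and>
        right_invariant G d \<and>
        (\<forall>n. subgroup (K n) G \<and> compactin T (K n)) \<and> incseq K \<and>
        T closure_of (\<Union>n. K n) = carrier G \<and>
        wasserstein_family (\<lambda>n. G\<lparr>carrier := K n\<rparr>) (\<lambda>n. d) m)"

text \<open>
  HOL cannot quantify existentially over the types of the groups \<open>H n\<close>, so their common type is
  an explicit parameter. A theorem that assumes \<open>locally_wasserstein TYPE('h) G T\<close> with \<open>'h\<close> a
  free type variable applies to all choices of the groups \<open>H n\<close>.
\<close>

definition locally_wasserstein :: "'h itself \<Rightarrow> 'g monoid \<Rightarrow> 'g topology \<Rightarrow> bool" where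
  "locally_wasserstein TYPE('h) G T \<longleftrightarrow> polish_group G T \<and>
     (\<exists>(H :: nat \<Rightarrow> 'h monoid) S \<iota>.
        (\<forall>n. wasserstein_group (H n) (S n) \<and>
             \<iota> n \<in> hom (H n) G \<and> continuous_map (S n) T (\<iota> n)) \<and>
        T closure_of (generate G (\<Union>n. \<iota> n ` carrier (H n))) = carrier G)"


section \<open>Borel actions\<close>

definition standard_borel_G_space ::
    "'g monoid \<Rightarrow> 'g topology \<Rightarrow> 'x measure \<Rightarrow> ('g \<Rightarrow> 'x \<Rightarrow> 'x) \<Rightarrow> bool" where
  "standard_borel_G_space G T X act \<longleftrightarrow> standard_borel X \<and>
     group_action G (space X) act \<and>
     (\<lambda>(g, x). act g x) \<in> borel_of T \<Otimes>\<^sub>M X \<rightarrow>\<^sub>M X"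

definition quasi_invariant :: "'g monoid \<Rightarrow> ('g \<Rightarrow> 'x \<Rightarrow> 'x) \<Rightarrow> 'x measure \<Rightarrow> bool" where
  "quasi_invariant G act \<mu> \<longleftrightarrow>
     (\<forall>g\<in>carrier G. absolutely_continuous (distr \<mu> \<mu> (act g)) \<mu> \<and>
                     absolutely_continuous \<mu> (distr \<mu> \<mu> (act g)))"

definition fixed_points :: "'g monoid \<Rightarrow> ('g \<Rightarrow> 'x \<Rightarrow> 'x) \<Rightarrow> 'x set \<Rightarrow> 'x set" where
  "fixed_points G act A = {x \<in> A. \<forall>g\<in>carrier G. act g x = x}"

end

theory Submission
  imports Defs
begin

no_notation eq_closure_of ("closure'_of\<index>")

text \<open>
  Let \<open>K\<close> be one of the compact subgroups \<open>K n\<close> of a Wasserstein group acting on \<open>(X, \<mu>)\<close>, with Haar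
  measure \<open>m\<close>, let \<open>\<mu>'\<close> be the average of the \<open>K\<close>-translates of \<open>\<mu>\<close> and let \<open>f\<close> be the density of \<open>\<mu>\<close>
  with respect to \<open>\<mu>'\<close>. The functions \<open>k \<mapsto> f (k.x)\<close> form a kernel of densities over \<open>(X, \<mu>')\<close>
  whose variation under \<open>h\<close> is the total variation distance of \<open>\<mu>\<close> and its \<open>h\<close>-translate. By a Pettis
  argument this is small for \<open>h\<close> near the identity, so the kernel is close to Haar measure in the
  Wasserstein distance. Hence \<open>\<integral> u d\<mu> - \<integral> u d\<mu>'\<close> tends to 0 along \<open>K n\<close> for every bounded Borel
  function \<open>u\<close> that is Lipschitz along orbits. As \<open>\<mu>'\<close> is the same for \<open>\<mu>\<close> and for its translate by
  \<open>h \<in> K n\<close>, such a \<open>u\<close> has equal integrals against both; applied to measures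
  equivalent to \<open>\<mu>\<close>, this yields that \<open>u\<close> is invariant almost everywhere.

  Functions Lipschitz along orbits come from Baire category: the essential distance from the identity to
  \<open>{g. g.x \<in> A}\<close>. If all of them are invariant at \<open>x\<close>, each set \<open>{g. g.x \<in> A}\<close> is meager or
  comeager, so \<open>g.x\<close> is constant for comeagerly many \<open>g\<close>, and then \<open>x\<close> is fixed. The same zero-one argument
  shows that a dense stabilizer is everything, which passes from the images of the Wasserstein groups to
  \<open>G\<close> and shows that the set of fixed points is Borel.
\<close>


section \<open>Baire category\<close>

text \<open>The action is only Borel and \<open>G\<close> need not be locally compact, so meager
  sets of \<open>G\<close> take the role that Haar null sets could play otherwise. Continuity of
  translation in total variation has no a priori reason; it comes from countably many Borel sets
  covering \<open>G\<close>, each consisting of elements under which the translates of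
  \<open>\<mu>\<close> have almost the same density. The plain distance from the identity to
  \<open>{g. g.x \<in> A}\<close> would also be Lipschitz along orbits, but its sublevel sets are
  mere projections of Borel sets; the essential distance is Borel in \<open>x\<close>, and its small
  values yield nonmeager sets, to which Baire arguments apply. In a Wasserstein family the radii
  come before the numbers \<open>\<epsilon> n\<close>, so these may be adapted to
  \<open>\<mu>\<close>: it is enough that the variation over the balls of radius \<open>r n\<close>
  tends to 0, at any rate. Equal integrals become invariance almost everywhere by reweighting: the
  integral of \<open>u (h.x) - u x\<close> vanishes against \<open>\<mu>\<close> and against an
  equivalent measure that gives double weight to the set where this difference is positive.\<close>

definition meager :: "'a topology \<Rightarrow> 'a set \<Rightarrow> bool" where
  "meager T S \<longleftrightarrow>
     (\<exists>\<C>. countable \<C> \<and> (\<forall>C\<in>\<C>. closedin T C \<and> T interior_of C = {}) \<and> S \<subseteq> \<Union>\<C>)"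

definition baire_property :: "'a topology \<Rightarrow> 'a set \<Rightarrow> bool" where
  "baire_property T B \<longleftrightarrow> (\<exists>U. openin T U \<and> meager T (B - U) \<and> meager T (U - B))"

lemma baire_propertyE:
  assumes "baire_property T B"
  obtains U where "openin T U" "meager T (B - U)" "meager T (U - B)"
  using assms unfolding baire_property_def by (elim exE conjE) (rule that)

lemma meager_subset: "meager T S \<Longrightarrow> R \<subseteq> S \<Longrightarrow> meager T R"
  unfolding meager_def by (meson order_trans)

lemma not_meager_mono: "\<not> meager T R \<Longrightarrow> R \<subseteq> S \<Longrightarrow> \<not> meager T S"
  using meager_subset by metis

lemma meager_empty [simp]: "meager T {}"
  unfolding meager_def by (rule exI[of _ "{}"]) auto

lemma meager_UN:
  assumes "countable I" "\<And>i. i \<in> I \<Longrightarrow> meager T (S i)"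
  shows "meager T (\<Union>i\<in>I. S i)"
proof -
  have "\<forall>i\<in>I. \<exists>\<C>. countable \<C> \<and> (\<forall>C\<in>\<C>. closedin T C \<and> T interior_of C = {}) \<and> S i \<subseteq> \<Union>\<C>"
    using assms(2) unfolding meager_def by blast
  from bchoice[OF this] obtain \<C> where \<C>: "\<forall>i\<in>I. countable (\<C> i) \<and>
      (\<forall>C\<in>\<C> i. closedin T C \<and> T interior_of C = {}) \<and> S i \<subseteq> \<Union>(\<C> i)"
    by (elim exE) (rule that)
  then have \<C>': "\<And>i. i \<in> I \<Longrightarrow> countable (\<C> i)" "\<And>i. i \<in> I \<Longrightarrow> S i \<subseteq> \<Union>(\<C> i)"
    "\<And>i C. i \<in> I \<Longrightarrow> C \<in> \<C> i \<Longrightarrow> closedin T C \<and> T interior_of C = {}"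
    by simp_all
  have "countable (\<Union>i\<in>I. \<C> i)"
    using assms(1) \<C>'(1) by (rule countable_UN)
  moreover have "(\<Union>i\<in>I. S i) \<subseteq> \<Union>(\<Union>i\<in>I. \<C> i)"
  proof (rule UN_least)
    fix i assume "i \<in> I"
    then show "S i \<subseteq> \<Union>(\<Union>i\<in>I. \<C> i)"
      using \<C>'(2)[of i] by (meson Sup_subset_mono UN_upper order_trans)
  qed
  moreover have "\<forall>C\<in>(\<Union>i\<in>I. \<C> i). closedin T C \<and> T interior_of C = {}"
    using \<C>'(3) by simp
  ultimately show ?thesis
    unfolding meager_def by (intro exI conjI)
qed

lemma not_meager_UNE:
  assumes "\<not> meager T (\<Union>i\<in>I. S i)" "countable I"
  obtains i where "i \<in> I" "\<not> meager T (S i)"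
  using meager_UN[OF assms(2), of T S] assms(1) by metis

lemma meager_Un: "meager T R \<Longrightarrow> meager T S \<Longrightarrow> meager T (R \<union> S)"
  using meager_UN[of "{R, S}" T id] by auto

text \<open>An open set that misses \<open>U\<close> misses its closure, so the boundary of an open
  set is closed with empty interior. This is the error made in passing to complements of sets with
  the Baire property.\<close>

lemma meager_closure_diff:
  assumes "openin T U" shows "meager T (T closure_of U - U)"
proof -
  let ?I = "T interior_of (T closure_of U - U)"
  have sub: "?I \<subseteq> T closure_of U - U" by (rule interior_of_subset)
  then have "?I \<inter> U = {}" by blast
  then have "?I \<inter> T closure_of U = {}"
    by (simp add: openin_Int_closure_of_eq_empty)
  with sub have "?I = {}" by blast
  moreover have "closedin T (T closure_of U - U)"
    using assms by (simp add: closedin_diff)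
  ultimately show ?thesis
    unfolding meager_def by (intro exI[of _ "{T closure_of U - U}"]) auto
qed

lemma meager_homeomorphic_image:
  assumes "homeomorphic_map T T' f" "meager T S"
  shows "meager T' (f ` S)"
proof -
  obtain \<C> where \<C>: "countable \<C>" "\<And>C. C \<in> \<C> \<Longrightarrow> closedin T C \<and> T interior_of C = {}" "S \<subseteq> \<Union>\<C>"
    using assms(2) unfolding meager_def by blast
  have "closedin T' (f ` C) \<and> T' interior_of (f ` C) = {}" if "C \<in> \<C>" for C
  proof -
    have "closedin T C" "T interior_of C = {}" using \<C>(2)[OF that] by auto
    then have "C \<subseteq> topspace T" by (simp add: closedin_subset)
    then show ?thesis
      using \<open>closedin T C\<close> \<open>T interior_of C = {}\<close> homeomorphic_map_closedness_eq[OF assms(1)]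
        homeomorphic_map_interior_of[OF assms(1), of C] by simp
  qed
  then show ?thesis
    unfolding meager_def using \<C>(1,3) by (intro exI[of _ "(`) f ` \<C>"]) (auto; blast)
qed

lemma not_meager_open:
  assumes "completely_metrizable_space T" "openin T U" "U \<noteq> {}"
  shows "\<not> meager T U"
proof
  assume "meager T U"
  then obtain \<C> where \<C>: "countable \<C>" "\<And>C. C \<in> \<C> \<Longrightarrow> closedin T C \<and> T interior_of C = {}" "U \<subseteq> \<Union>\<C>"
    unfolding meager_def by blast
  have "T interior_of \<Union>\<C> = {}"
    using Baire_category_alt[of T \<C>] \<C> assms(1) by blast
  then show False
    using \<C>(3) assms(2,3) interior_of_maximal by blast
qed

lemma baire_property_open: "openin T U \<Longrightarrow> baire_property T U"
  unfolding baire_property_def by (intro exI[of _ U]) auto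

text \<open>The complement of the closure of \<open>U\<close> serves as the new open set; besides
  the old error only the boundary of \<open>U\<close> is added.\<close>

lemma baire_property_compl:
  assumes "B \<subseteq> topspace T" "baire_property T B"
  shows "baire_property T (topspace T - B)"
proof -
  obtain U where U: "openin T U" "meager T (B - U)" "meager T (U - B)"
    using assms(2) unfolding baire_property_def by blast
  let ?V = "topspace T - T closure_of U"
  have "meager T ((topspace T - B) - ?V)"
    by (rule meager_subset[OF meager_Un[OF U(3) meager_closure_diff[OF U(1)]]]) auto
  moreover have "meager T (?V - (topspace T - B))"
    by (rule meager_subset[OF U(2)]) (use closure_of_subset[OF openin_subset[OF U(1)]] in auto)
  ultimately show ?thesis
    unfolding baire_property_def by (intro exI[of _ ?V]) auto
qed

lemma baire_property_UN:
  fixes B :: "nat \<Rightarrow> 'a set"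
  assumes "\<And>n. baire_property T (B n)"
  shows "baire_property T (\<Union>n. B n)"
proof -
  obtain U where U: "\<And>n. openin T (U n) \<and> meager T (B n - U n) \<and> meager T (U n - B n)"
    using assms unfolding baire_property_def by metis
  have "meager T (\<Union>n. B n - U n)" "meager T (\<Union>n. U n - B n)"
    using U by (intro meager_UN; simp)+
  moreover have "(\<Union>n. B n) - (\<Union>n. U n) \<subseteq> (\<Union>n. B n - U n)" "(\<Union>n. U n) - (\<Union>n. B n) \<subseteq> (\<Union>n. U n - B n)"
    by blast+
  ultimately have "meager T ((\<Union>n. B n) - (\<Union>n. U n))" "meager T ((\<Union>n. U n) - (\<Union>n. B n))"
    by (meson meager_subset)+
  then show ?thesis
    unfolding baire_property_def using U by (intro exI[of _ "\<Union>n. U n"]) auto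
qed

section \<open>Borel sets, second countability and products\<close>

lemma space_borel_of [simp]: "space (borel_of T) = topspace T"
  unfolding borel_of_def by (rule space_measure_of) (auto dest: openin_subset)

lemma sets_borel_of: "sets (borel_of T) = sigma_sets (topspace T) {U. openin T U}"
  unfolding borel_of_def by (rule sets_measure_of) (auto dest: openin_subset)

lemma borel_of_open: "openin T U \<Longrightarrow> U \<in> sets (borel_of T)"
  by (simp add: sets_borel_of)

lemma baire_property_borel:
  assumes "B \<in> sets (borel_of T)" shows "baire_property T B"
  using assms unfolding sets_borel_of
proof (induction rule: sigma_sets.induct)
  case (Compl B)
  have "B \<subseteq> topspace T"
    by (rule sigma_sets_into_sp[OF _ Compl.hyps]) (auto dest: openin_subset)
  then show ?case
    using Compl.IH by (rule baire_property_compl)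
next
  case (Union B)
  show ?case
    by (rule baire_property_UN) (rule Union.IH)
next
  case (Basic U)
  then show ?case by (simp add: baire_property_open)
next
  case Empty
  show ?case by (rule baire_property_open) simp
qed

lemma measurable_borel_of_continuous:
  assumes "continuous_map T T' f"
  shows "f \<in> borel_of T \<rightarrow>\<^sub>M borel_of T'"
proof (rule measurable_sigma_sets[OF sets_borel_of])
  show "f \<in> space (borel_of T) \<rightarrow> topspace T'"
    using assms continuous_map_funspace by auto
  show "f -` U \<inter> space (borel_of T) \<in> sets (borel_of T)" if "U \<in> {U. openin T' U}" for U
    using that openin_continuous_map_preimage[OF assms, of U]
    by (auto intro!: borel_of_open simp: vimage_def Int_def conj_commute)
qed (auto dest: openin_subset)

lemma polish_second_countable:
  assumes "polish_space_top T" shows "second_countable T"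
proof -
  obtain M d where M: "Metric_space M d" "T = Metric_space.mtopology M d"
    using assms unfolding polish_space_top_def completely_metrizable_space_def by blast
  interpret Metric_space M d by (rule M(1))
  obtain C where C: "countable C" "C \<subseteq> M" "T closure_of C = M"
    using assms M(2) unfolding polish_space_top_def separable_space_def by auto
  show ?thesis
    unfolding second_countable_def
  proof (intro exI conjI allI impI ballI)
    let ?B = "(\<lambda>(c, n). mball c (1 / real (Suc n))) ` (C \<times> (UNIV :: nat set))"
    show "countable ?B" using C(1) by simp
    show "openin T V" if "V \<in> ?B" for V using that M(2) by auto
    fix U x assume Ux: "openin T U \<and> x \<in> U"
    then obtain r where r: "r > 0" "mball x r \<subseteq> U" and x: "x \<in> M"
      using M(2) openin_mtopology by (metis subsetD)
    \<comment> \<open>Half of \<open>r\<close>: a ball of this radius about a point \<open>c\<close>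
      that contains \<open>x\<close> lies within distance \<open>r\<close> of
      \<open>x\<close>.\<close>
    obtain n where n: "1 / real (Suc n) < r / 2"
      using r(1) nat_approx_posE[of "r/2"] by auto
    have "x \<in> T closure_of C" using C x by simp
    then obtain c where c: "c \<in> C" "c \<in> mball x (1 / real (Suc n))"
      unfolding in_closure_of M(2)
      by (metis centre_in_mball_iff of_nat_0_less_iff openin_mball x zero_less_Suc zero_less_divide_1_iff)
    have "x \<in> mball c (1 / real (Suc n))" using c by (simp add: commute)
    moreover have "mball c (1 / real (Suc n)) \<subseteq> U"
    proof -
      have "mball c (1 / real (Suc n)) \<subseteq> mball x r"
        using c n x by (intro mball_subset) (auto simp: commute)
      then show ?thesis using r(2) by blast
    qed
    ultimately show "\<exists>V\<in>?B. x \<in> V \<and> V \<subseteq> U" using c(1) by force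
  qed
qed

lemma second_countableE:
  assumes "second_countable T"
  obtains \<B> where "countable \<B>" "\<And>V. V \<in> \<B> \<Longrightarrow> openin T V"
    "\<And>U x. openin T U \<Longrightarrow> x \<in> U \<Longrightarrow> \<exists>V\<in>\<B>. x \<in> V \<and> V \<subseteq> U"
proof -
  from assms obtain \<B> where "countable \<B>" "\<forall>V\<in>\<B>. openin T V"
    "\<forall>U x. openin T U \<and> x \<in> U \<longrightarrow> (\<exists>V\<in>\<B>. x \<in> V \<and> V \<subseteq> U)"
    unfolding second_countable_def by (elim exE conjE)
  then show ?thesis using that[of \<B>] by simp
qed

text \<open>Every open set of the product is a union of rectangles from the two countable bases,
  hence a countable one. Through this inclusion continuity of the group operations gives
  measurability for the product \<sigma>-algebra.\<close>

lemma sets_borel_of_pair: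
  assumes "second_countable T" "second_countable T'"
  shows "sets (borel_of (prod_topology T T')) \<subseteq> sets (borel_of T \<Otimes>\<^sub>M borel_of T')"
proof -
  obtain \<B> where \<B>: "countable \<B>" "\<And>V. V \<in> \<B> \<Longrightarrow> openin T V"
     "\<And>U x. openin T U \<Longrightarrow> x \<in> U \<Longrightarrow> \<exists>V\<in>\<B>. x \<in> V \<and> V \<subseteq> U"
    by (rule second_countableE[OF assms(1)]) (rule that)
  obtain \<B>' where \<B>': "countable \<B>'" "\<And>V. V \<in> \<B>' \<Longrightarrow> openin T' V"
     "\<And>U x. openin T' U \<Longrightarrow> x \<in> U \<Longrightarrow> \<exists>V\<in>\<B>'. x \<in> V \<and> V \<subseteq> U"
    by (rule second_countableE[OF assms(2)]) (rule that)
  have "W \<in> sets (borel_of T \<Otimes>\<^sub>M borel_of T')" if W: "openin (prod_topology T T') W" for W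
  proof -
    define J where "J = {p \<in> \<B> \<times> \<B>'. fst p \<times> snd p \<subseteq> W}"
    have sup: "z \<in> (\<Union>p\<in>J. fst p \<times> snd p)" if z: "z \<in> W" for z
    proof -
      obtain x y where xy: "z = (x, y)" by (cases z)
      obtain U U' where U: "openin T U" "openin T' U'" "x \<in> U" "y \<in> U'" "U \<times> U' \<subseteq> W"
        using W[unfolded openin_prod_topology_alt, rule_format, OF z[unfolded xy]]
        by (elim exE conjE) (rule that)
      obtain V where V: "V \<in> \<B>" "x \<in> V" "V \<subseteq> U" using \<B>(3)[OF U(1,3)] by blast
      obtain V' where V': "V' \<in> \<B>'" "y \<in> V'" "V' \<subseteq> U'" using \<B>'(3)[OF U(2,4)] by blast
      have "V \<times> V' \<subseteq> W"
        using Sigma_mono[OF V(3) V'(3)] U(5) by (rule subset_trans)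
      then have "(V, V') \<in> J"
        using V(1) V'(1) unfolding J_def by (simp only: mem_Collect_eq mem_Sigma_iff fst_conv snd_conv)
      then show ?thesis
        unfolding xy by (rule UN_I) (simp only: fst_conv snd_conv mem_Sigma_iff V V' simp_thms)
    qed
    have sub: "fst p \<times> snd p \<subseteq> W" if "p \<in> J" for p
      using that by (simp add: J_def)
    have "W = (\<Union>p\<in>J. fst p \<times> snd p)"
    proof
      show "W \<subseteq> (\<Union>p\<in>J. fst p \<times> snd p)" by (rule subsetI) (rule sup)
      show "(\<Union>p\<in>J. fst p \<times> snd p) \<subseteq> W" by (rule UN_least) (rule sub)
    qed
    moreover have "countable J"
      unfolding J_def by (rule countable_subset[of _ "\<B> \<times> \<B>'"]) (use \<B>(1) \<B>'(1) in auto)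
    moreover have "fst p \<times> snd p \<in> sets (borel_of T \<Otimes>\<^sub>M borel_of T')" if "p \<in> J" for p
      using that \<B>(2) \<B>'(2) unfolding J_def by (auto intro!: pair_measureI borel_of_open)
    ultimately show ?thesis
      using sets.countable_UN''[of J "\<lambda>p. fst p \<times> snd p" "borel_of T \<Otimes>\<^sub>M borel_of T'"] by simp
  qed
  then have "sigma_sets (space (borel_of T \<Otimes>\<^sub>M borel_of T')) {W. openin (prod_topology T T') W}
      \<subseteq> sets (borel_of T \<Otimes>\<^sub>M borel_of T')"
    by (intro sets.sigma_sets_subset) auto
  then show ?thesis
    by (simp add: sets_borel_of space_pair_measure)
qed


section \<open>Separating families and category quantifiers\<close>

lemma homeomorphic_map_right_translation:
  fixes G (structure)
  assumes "topological_group G T" "h \<in> carrier G"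
  shows "homeomorphic_map T T (\<lambda>g. g \<otimes> h)"
proof -
  interpret group G using assms(1) by (simp add: topological_group_def)
  have top: "topspace T = carrier G" using assms(1) by (simp add: topological_group_def)
  have cont: "continuous_map T T (\<lambda>g. g \<otimes> k)" if "k \<in> carrier G" for k
  proof -
    have "continuous_map T (prod_topology T T) (\<lambda>g. (g, k))"
      using that top by (simp add: continuous_map_pairwise comp_def)
    then show ?thesis
      using assms(1) continuous_map_compose[of T "prod_topology T T" "\<lambda>g. (g, k)" T "\<lambda>(x, y). x \<otimes> y"]
      by (simp add: topological_group_def comp_def)
  qed
  have "homeomorphic_maps T T (\<lambda>g. g \<otimes> h) (\<lambda>g. g \<otimes> inv h)"
    unfolding homeomorphic_maps_def using cont assms(2) top by (simp add: m_assoc)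
  then show ?thesis using homeomorphic_maps_map by blast
qed

lemma closure_of_meetsE:
  assumes "x \<in> T closure_of S" "openin T U" "x \<in> U"
  obtains y where "y \<in> S" "y \<in> U"
  using assms unfolding in_closure_of by metis

text \<open>One point is picked from each basic open set that meets \<open>S\<close>. Countability
  of \<open>D\<close> allows exceptional sets, null or meager, to be united over its
  elements.\<close>

lemma dense_countable_subset:
  assumes "second_countable T" "S \<subseteq> topspace T"
  obtains D where "countable D" "D \<subseteq> S" "S \<subseteq> T closure_of D"
proof -
  obtain \<B> where \<B>: "countable \<B>" "\<And>V. V \<in> \<B> \<Longrightarrow> openin T V"
    "\<And>U x. openin T U \<Longrightarrow> x \<in> U \<Longrightarrow> \<exists>V\<in>\<B>. x \<in> V \<and> V \<subseteq> U"
    by (rule second_countableE[OF assms(1)]) (rule that)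
  define c where "c V = (SOME x. x \<in> V \<inter> S)" for V
  have c: "c V \<in> V \<inter> S" if "V \<inter> S \<noteq> {}" for V
    unfolding c_def some_in_eq by (rule that)
  let ?D = "c ` {V \<in> \<B>. V \<inter> S \<noteq> {}}"
  have "x \<in> T closure_of ?D" if x: "x \<in> S" for x
    unfolding in_closure_of
  proof (intro conjI allI impI)
    show "x \<in> topspace T" using assms(2) x by blast
    fix U assume "x \<in> U \<and> openin T U"
    then obtain V where V: "V \<in> \<B>" "x \<in> V" "V \<subseteq> U" using \<B>(3)[of U x] by blast
    then have "V \<inter> S \<noteq> {}" using x by blast
    then show "\<exists>y. y \<in> ?D \<and> y \<in> U" using c[of V] V by blast
  qed
  moreover have "countable ?D" using \<B>(1) by simp
  moreover have "?D \<subseteq> S" using c by blast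
  ultimately show thesis using that[of ?D] by blast
qed

definition separates_points :: "'a set set \<Rightarrow> 'a set \<Rightarrow> bool" where
  "separates_points \<B> X \<longleftrightarrow> (\<forall>x\<in>X. \<forall>y\<in>X. (\<forall>A\<in>\<B>. x \<in> A \<longleftrightarrow> y \<in> A) \<longrightarrow> x = y)"

text \<open>A countable base of a Polish topology does it: open sets are countable unions of basic
  ones, and the Hausdorff property separates points. Equality of two points thus becomes countably
  many Borel conditions.\<close>

lemma standard_borel_separating:
  assumes "standard_borel M"
  obtains \<B> where "countable \<B>" "\<B> \<subseteq> sets M" "sets M = sigma_sets (space M) \<B>"
    "separates_points \<B> (space M)"
proof -
  obtain T where T: "polish_space_top T" "sets M = sets (borel_of T)"
    using assms unfolding standard_borel_def by blast
  have sp: "space M = topspace T" using sets_eq_imp_space_eq[OF T(2)] by simp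
  obtain \<B> where \<B>: "countable \<B>" "\<And>V. V \<in> \<B> \<Longrightarrow> openin T V"
    "\<And>U x. openin T U \<Longrightarrow> x \<in> U \<Longrightarrow> \<exists>V\<in>\<B>. x \<in> V \<and> V \<subseteq> U"
    by (rule second_countableE[OF polish_second_countable[OF T(1)]]) (rule that)
  have sub: "\<B> \<subseteq> sets M" using \<B>(2) T(2) borel_of_open by blast
  have open_gen: "U \<in> sigma_sets (topspace T) \<B>" if "openin T U" for U
  proof -
    have "\<Union>{V \<in> \<B>. V \<subseteq> U} \<in> sigma_sets (topspace T) \<B>"
      by (rule sigma_sets_UNION) (use \<B>(1) in \<open>auto intro: countable_subset[of _ \<B>]\<close>)
    moreover have "U \<subseteq> \<Union>{V \<in> \<B>. V \<subseteq> U}"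
    proof
      fix x assume "x \<in> U"
      from \<B>(3)[OF that this] obtain V where "V \<in> \<B>" "x \<in> V" "V \<subseteq> U" by blast
      then show "x \<in> \<Union>{V \<in> \<B>. V \<subseteq> U}" by (intro UnionI[of V]) simp_all
    qed
    moreover have "\<Union>{V \<in> \<B>. V \<subseteq> U} \<subseteq> U" by (intro Union_least) simp
    ultimately show ?thesis by (simp add: subset_antisym)
  qed
  have "sets M = sigma_sets (space M) \<B>"
  proof
    show "sigma_sets (space M) \<B> \<subseteq> sets M" using sub by (rule sets.sigma_sets_subset)
    show "sets M \<subseteq> sigma_sets (space M) \<B>"
      unfolding T(2) sets_borel_of sp by (rule sigma_sets_mono) (use open_gen in auto)
  qed
  moreover have "x = y"
    if xy: "x \<in> space M" "y \<in> space M" "\<And>A. A \<in> \<B> \<Longrightarrow> x \<in> A \<longleftrightarrow> y \<in> A" for x y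
  proof (rule ccontr)
    assume "x \<noteq> y"
    have "Hausdorff_space T"
      using T(1) unfolding polish_space_top_def
      by (elim conjE) (intro metrizable_imp_Hausdorff_space completely_metrizable_imp_metrizable_space)
    then obtain U V where UV: "openin T U" "openin T V" "x \<in> U" "y \<in> V" "disjnt U V"
      using \<open>x \<noteq> y\<close> xy(1,2) unfolding Hausdorff_space_def sp by meson
    obtain W where "W \<in> \<B>" "x \<in> W" "W \<subseteq> U" using \<B>(3)[OF UV(1,3)] by blast
    then show False using xy(3)[of W] UV(4,5) unfolding disjnt_def by blast
  qed
  then have "separates_points \<B> (space M)" unfolding separates_points_def by blast
  ultimately show thesis by (rule that[OF \<B>(1) sub])
qed

text \<open>The Montgomery-Novikov theorem that category quantifiers preserve Borel sets. The
  induction must treat all open \<open>U\<close> at once, since a complement is nonmeager in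
  \<open>U\<close> exactly if the set itself is meager in some nonempty basic \<open>W\<close>
  inside \<open>U\<close>; this turns the negation into a countable union.\<close>

lemma nonmeager_section_measurable:
  assumes T: "completely_metrizable_space T" "second_countable T"
    and B: "B \<in> sets (borel_of T \<Otimes>\<^sub>M M)" and U: "openin T U"
  shows "{x \<in> space M. \<not> meager T {g \<in> U. (g, x) \<in> B}} \<in> sets M"
  using B U unfolding sets_pair_measure
proof (induction B arbitrary: U rule: sigma_sets.induct)
  case (Basic B)
  then obtain a b where ab: "B = a \<times> b" "a \<in> sets (borel_of T)" "b \<in> sets M" by blast
  have "{g \<in> U. (g, x) \<in> B} = (if x \<in> b then U \<inter> a else {})" for x
    unfolding ab(1) by auto
  then have "{x \<in> space M. \<not> meager T {g \<in> U. (g, x) \<in> B}} = (if meager T (U \<inter> a) then {} else b)"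
    using sets.sets_into_space[OF ab(3)] by auto
  then show ?case using ab(3) by simp
next
  case (Compl B)
  obtain \<B> where \<B>: "countable \<B>" "\<And>V. V \<in> \<B> \<Longrightarrow> openin T V"
    "\<And>U x. openin T U \<Longrightarrow> x \<in> U \<Longrightarrow> \<exists>V\<in>\<B>. x \<in> V \<and> V \<subseteq> U"
    by (rule second_countableE[OF T(2)]) (rule that)
  have B: "B \<in> sets (borel_of T \<Otimes>\<^sub>M M)" using Compl.hyps unfolding sets_pair_measure .
  let ?C = "{W \<in> \<B>. W \<subseteq> U \<and> W \<noteq> {}}"
  let ?B' = "space (borel_of T) \<times> space M - B"
  \<comment> \<open>From left to right the Baire property of the section provides an open set on
    which the complement is comeager; from right to left \<open>W\<close> would be meager otherwise,
    against the Baire category theorem.\<close>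
  have "(\<not> meager T {g \<in> U. (g, x) \<in> ?B'}) \<longleftrightarrow> (\<exists>W\<in>?C. meager T {g \<in> W. (g, x) \<in> B})"
    if x: "x \<in> space M" for x
  proof
    assume nm: "\<not> meager T {g \<in> U. (g, x) \<in> ?B'}"
    let ?S = "{g \<in> topspace T. (g, x) \<in> B}"
    have "?S = (\<lambda>g. (g, x)) -` B \<inter> space (borel_of T)" by auto
    moreover have "(\<lambda>g. (g, x)) -` B \<inter> space (borel_of T) \<in> sets (borel_of T)"
      by (rule measurable_sets[OF measurable_Pair2'[OF x] B])
    ultimately have "baire_property T ?S"
      using baire_property_borel by simp
    then have "baire_property T (topspace T - ?S)"
      by (rule baire_property_compl[rotated]) auto
    then obtain V where V: "openin T V" "meager T ((topspace T - ?S) - V)" "meager T (V - (topspace T - ?S))"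
      by (rule baire_propertyE)
    have "V \<inter> U \<noteq> {}"
    proof
      assume "V \<inter> U = {}"
      then have "{g \<in> U. (g, x) \<in> ?B'} \<subseteq> (topspace T - ?S) - V"
        using openin_subset[OF Compl.prems] by auto
      then show False using nm V(2) meager_subset by blast
    qed
    then obtain y where "y \<in> V \<inter> U" by blast
    then obtain W where W: "W \<in> \<B>" "y \<in> W" "W \<subseteq> V \<inter> U"
      using \<B>(3)[OF openin_Int[OF V(1) Compl.prems]] by blast
    have "{g \<in> W. (g, x) \<in> B} \<subseteq> V - (topspace T - ?S)"
      using W(3) openin_subset[OF V(1)] by auto
    then have "meager T {g \<in> W. (g, x) \<in> B}" using V(3) meager_subset by blast
    then show "\<exists>W\<in>?C. meager T {g \<in> W. (g, x) \<in> B}" using W by blast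
  next
    assume "\<exists>W\<in>?C. meager T {g \<in> W. (g, x) \<in> B}"
    then obtain W where W: "W \<in> \<B>" "W \<subseteq> U" "W \<noteq> {}" "meager T {g \<in> W. (g, x) \<in> B}" by blast
    show "\<not> meager T {g \<in> U. (g, x) \<in> ?B'}"
    proof
      assume "meager T {g \<in> U. (g, x) \<in> ?B'}"
      then have "meager T ({g \<in> U. (g, x) \<in> ?B'} \<union> {g \<in> W. (g, x) \<in> B})"
        using W(4) by (rule meager_Un)
      moreover have "W \<subseteq> {g \<in> U. (g, x) \<in> ?B'} \<union> {g \<in> W. (g, x) \<in> B}"
        using W(2) openin_subset[OF \<B>(2)[OF W(1)]] x by auto
      ultimately have "meager T W" by (rule meager_subset)
      then show False using not_meager_open[OF T(1) \<B>(2)[OF W(1)] W(3)] by blast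
    qed
  qed
  then have "{x \<in> space M. \<not> meager T {g \<in> U. (g, x) \<in> ?B'}}
      = (\<Union>W\<in>?C. space M - {x \<in> space M. \<not> meager T {g \<in> W. (g, x) \<in> B}})" by blast
  also have "\<dots> \<in> sets M"
    using \<B>(1) by (intro sets.countable_UN'' sets.compl_sets Compl.IH) (auto intro: \<B>(2) countable_subset[of _ \<B>])
  finally show ?case .
next
  case (Union B)
  have eq: "{g \<in> U. (g, x) \<in> (\<Union>i. B i)} = (\<Union>i. {g \<in> U. (g, x) \<in> B i})" for x by blast
  have "(\<not> meager T {g \<in> U. (g, x) \<in> (\<Union>i. B i)}) \<longleftrightarrow> (\<exists>i. \<not> meager T {g \<in> U. (g, x) \<in> B i})" for x
    unfolding eq using meager_UN[of UNIV T "\<lambda>i. {g \<in> U. (g, x) \<in> B i}"]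
      meager_subset[of T "\<Union>i. {g \<in> U. (g, x) \<in> B i}"] by blast
  then have "{x \<in> space M. \<not> meager T {g \<in> U. (g, x) \<in> (\<Union>i. B i)}}
      = (\<Union>i. {x \<in> space M. \<not> meager T {g \<in> U. (g, x) \<in> B i}})" by blast
  also have "\<dots> \<in> sets M" using Union.IH[OF Union.prems] by blast
  finally show ?case .
qed simp


section \<open>Borel actions of Polish groups\<close>

text \<open>Serves both for \<open>G\<close> itself and for each group \<open>H n\<close> acting
  through \<open>\<iota> n\<close>.\<close>

locale polish_action =
  fixes G :: "'g monoid" (structure) and T :: "'g topology" and M :: "'x measure" and a :: "'g \<Rightarrow> 'x \<Rightarrow> 'x"
  assumes polish: "polish_group G T" and std: "standard_borel M"
    and act_measurable: "(\<lambda>(g, x). a g x) \<in> borel_of T \<Otimes>\<^sub>M M \<rightarrow>\<^sub>M M"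
    and act_one: "x \<in> space M \<Longrightarrow> a \<one> x = x"
    and act_mult: "g \<in> carrier G \<Longrightarrow> h \<in> carrier G \<Longrightarrow> x \<in> space M \<Longrightarrow> a (g \<otimes> h) x = a g (a h x)"
begin

lemma top_group: "topological_group G T"
  using polish unfolding polish_group_def by simp

lemma topspace_carrier [simp]: "topspace T = carrier G"
  using top_group unfolding topological_group_def by simp

lemma completely_metrizable: "completely_metrizable_space T"
  and second_countable: "second_countable T"
  using polish polish_second_countable unfolding polish_group_def polish_space_top_def by auto

sublocale group G
  using top_group unfolding topological_group_def by simp

lemma act_space: "g \<in> carrier G \<Longrightarrow> x \<in> space M \<Longrightarrow> a g x \<in> space M"
  using measurable_space[OF act_measurable, of "(g, x)"] by (simp add: space_pair_measure)

lemma act_measurable': "g \<in> carrier G \<Longrightarrow> a g \<in> M \<rightarrow>\<^sub>M M"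
  using measurable_Pair2[OF act_measurable, of g] by simp

lemma act_inv: "g \<in> carrier G \<Longrightarrow> x \<in> space M \<Longrightarrow> a (inv g) (a g x) = x"
  using act_mult[of "inv g" g x] act_one by simp

definition visits :: "'x set \<Rightarrow> 'x \<Rightarrow> 'g set" where
  "visits A x = {g \<in> carrier G. a g x \<in> A}"

lemma visits_subset: "visits A x \<subseteq> carrier G"
  unfolding visits_def by blast

lemma visits_baire_property:
  assumes "A \<in> sets M" "x \<in> space M"
  shows "baire_property T (visits A x)"
proof (rule baire_property_borel)
  have "(\<lambda>g. a g x) \<in> borel_of T \<rightarrow>\<^sub>M M"
    using measurable_Pair1[OF act_measurable assms(2)] by simp
  then have "(\<lambda>g. a g x) -` A \<inter> space (borel_of T) \<in> sets (borel_of T)"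
    using assms(1) by (rule measurable_sets)
  moreover have "(\<lambda>g. a g x) -` A \<inter> space (borel_of T) = visits A x"
    unfolding visits_def by auto
  ultimately show "visits A x \<in> sets (borel_of T)" by simp
qed

lemma visits_Compl: "x \<in> space M \<Longrightarrow> visits (space M - A) x = carrier G - visits A x"
  unfolding visits_def using act_space by auto

lemma meager_translate:
  "h \<in> carrier G \<Longrightarrow> meager T S \<Longrightarrow> meager T ((\<lambda>g. g \<otimes> h) ` S)"
  using homeomorphic_map_right_translation[OF top_group] meager_homeomorphic_image by blast

text \<open>Let \<open>N A\<close> be the meager one of the two sets. A generic \<open>g\<close> has
  both \<open>g\<close> and \<open>g \<otimes> h\<close> outside all of them, so the points
  \<open>a g x\<close> and \<open>a (g \<otimes> h) x\<close> lie in the same separating sets and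
  coincide; cancelling \<open>g\<close> gives the claim.\<close>

lemma fixed_by_zero_one:
  assumes \<B>: "countable \<B>"
      "separates_points \<B> (space M)"
    and zo: "\<And>A. A \<in> \<B> \<Longrightarrow> meager T (visits A x) \<or> meager T (carrier G - visits A x)"
    and x: "x \<in> space M" and h: "h \<in> carrier G"
  shows "a h x = x"
proof -
  define N where "N A = (if meager T (visits A x) then visits A x else carrier G - visits A x)" for A
  have "meager T (N A)" if "A \<in> \<B>" for A
    unfolding N_def using zo[OF that] by auto
  then have N: "meager T (\<Union>A\<in>\<B>. N A)" by (rule meager_UN[OF \<B>(1)])
  let ?N' = "(\<lambda>g. g \<otimes> inv h) ` (\<Union>A\<in>\<B>. N A)"
  have small: "meager T ((\<Union>A\<in>\<B>. N A) \<union> ?N')"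
    using N meager_translate[OF inv_closed[OF h] N] by (rule meager_Un)
  have big: "\<not> meager T (carrier G)"
    by (rule not_meager_open[OF completely_metrizable]) (use openin_topspace[of T] one_closed in auto)
  have "\<not> carrier G \<subseteq> (\<Union>A\<in>\<B>. N A) \<union> ?N'"
    using big by (rule contrapos_nn) (rule meager_subset[OF small])
  then obtain g where g: "g \<in> carrier G" "g \<notin> (\<Union>A\<in>\<B>. N A)" "g \<notin> ?N'" by blast
  have gh: "g \<otimes> h \<notin> (\<Union>A\<in>\<B>. N A)"
  proof
    assume "g \<otimes> h \<in> (\<Union>A\<in>\<B>. N A)"
    then have "(g \<otimes> h) \<otimes> inv h \<in> ?N'" by (rule imageI)
    then show False using g h by (simp add: m_assoc)
  qed
  have "a g x \<in> A \<longleftrightarrow> a (g \<otimes> h) x \<in> A" if A: "A \<in> \<B>" for A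
  proof -
    have "a k x \<in> A \<longleftrightarrow> \<not> meager T (visits A x)" if "k \<in> carrier G" "k \<notin> (\<Union>A\<in>\<B>. N A)" for k
    proof -
      have "k \<notin> N A" using that(2) A by blast
      then show ?thesis using that(1) unfolding N_def visits_def by (auto split: if_splits)
    qed
    then show ?thesis using g(1,2) gh h by simp
  qed
  moreover have "a g x \<in> space M" "a (g \<otimes> h) x \<in> space M" using act_space x g(1) h by simp_all
  ultimately have "a g x = a (g \<otimes> h) x" using \<B>(2) unfolding separates_points_def by blast
  then have "a g x = a g (a h x)" using act_mult[OF g(1) h x] by simp
  then show ?thesis using act_inv[OF g(1)] act_space[OF h x] x by metis
qed

text \<open>The third hypothesis is a form of ergodicity: a set of visits is meager or nonmeager in
  every nonempty open set. If the open set \<open>U\<close> that approximates the visits to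
  \<open>A\<close> is nonempty, the visits to the complement are meager in \<open>U\<close>, hence
  meager.\<close>

lemma zero_one:
  assumes A: "A \<in> sets M" and x: "x \<in> space M"
    and "\<And>B U. B \<in> {A, space M - A} \<Longrightarrow> \<not> meager T (visits B x) \<Longrightarrow> openin T U \<Longrightarrow> U \<noteq> {} \<Longrightarrow>
      \<not> meager T (visits B x \<inter> U)"
  shows "meager T (visits A x) \<or> meager T (carrier G - visits A x)"
proof -
  obtain U where U: "openin T U" "meager T (visits A x - U)" "meager T (U - visits A x)"
    by (rule baire_propertyE[OF visits_baire_property[OF A x]])
  show ?thesis
  proof (cases "U = {}")
    case True
    then show ?thesis using U(2) by simp
  next
    case False
    have "visits (space M - A) x \<inter> U \<subseteq> U - visits A x"
      unfolding visits_Compl[OF x] by blast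
    then have "meager T (visits (space M - A) x \<inter> U)" by (rule meager_subset[OF U(3)])
    then have "meager T (visits (space M - A) x)" using assms(3)[of "space M - A" U] U(1) False by blast
    then show ?thesis unfolding visits_Compl[OF x] by simp
  qed
qed

text \<open>A special case of Miller's theorem that stabilizers of Borel actions are closed. The
  visits to a set are invariant under right translation by the stabilizer; countably many such
  translates of their part inside any nonempty open \<open>U\<close> cover them, so they are meager
  as soon as this part is meager.\<close>

lemma dense_stabilizer_imp_fixed:
  assumes x: "x \<in> space M" and S: "S \<subseteq> carrier G" "T closure_of S = carrier G"
    and fix_S: "\<And>s. s \<in> S \<Longrightarrow> a s x = x" and h: "h \<in> carrier G"
  shows "a h x = x"
proof -
  obtain \<B> where \<B>: "countable \<B>" "\<B> \<subseteq> sets M" "sets M = sigma_sets (space M) \<B>"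
    "separates_points \<B> (space M)"
    by (rule standard_borel_separating[OF std]) (rule that)
  have "S \<subseteq> topspace T" using S(1) by simp
  then obtain D where D: "countable D" "D \<subseteq> S" "S \<subseteq> T closure_of D"
    by (rule dense_countable_subset[OF second_countable])
  have D_dense: "T closure_of D = carrier G"
  proof
    show "T closure_of D \<subseteq> carrier G" using closure_of_subset_topspace[of T D] by simp
    show "carrier G \<subseteq> T closure_of D"
      using S(2) closure_of_mono[OF D(3), of T] by simp
  qed
  have D_carrier: "s \<in> carrier G" if "s \<in> D" for s using that D(2) S(1) by blast
  have dich: "\<not> meager T (visits B x \<inter> U)"
    if "\<not> meager T (visits B x)" and U: "openin T U" "U \<noteq> {}" for B U
  proof
    assume mU: "meager T (visits B x \<inter> U)"
    have UG: "U \<subseteq> carrier G" using openin_subset[OF U(1)] by simp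
    have "visits B x \<subseteq> (\<Union>s\<in>D. (\<lambda>g. g \<otimes> s) ` (visits B x \<inter> U))"
    proof
      fix g assume g: "g \<in> visits B x"
      then have gG: "g \<in> carrier G" unfolding visits_def by simp
      obtain u where u: "u \<in> U" using U(2) by blast
      then have uG: "u \<in> carrier G" using UG by blast
      \<comment> \<open>An \<open>s\<close> in \<open>D\<close> with
        \<open>g \<otimes> inv s\<close> in \<open>U\<close> is sought. The point
        \<open>inv u \<otimes> g\<close> solves this in \<open>G\<close>, the condition on
        \<open>s\<close> is open, and \<open>D\<close> is dense.\<close>
      have "continuous_map T T (\<lambda>s. g \<otimes> inv s)"
      proof -
        have "continuous_map T (prod_topology T T) (\<lambda>s. (g, inv s))"
          using gG top_group unfolding topological_group_def
          by (simp add: continuous_map_pairwise comp_def)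
        then show ?thesis
          using top_group continuous_map_compose[of T "prod_topology T T" _ T "\<lambda>(x, y). x \<otimes> y"]
          unfolding topological_group_def comp_def by fastforce
      qed
      then have op: "openin T {s \<in> topspace T. g \<otimes> inv s \<in> U}"
        using U(1) by (rule openin_continuous_map_preimage)
      have mem: "inv u \<otimes> g \<in> {s \<in> topspace T. g \<otimes> inv s \<in> U}"
        using gG uG u by (simp add: inv_mult_group m_assoc[symmetric])
      have "inv u \<otimes> g \<in> T closure_of D" unfolding D_dense using gG uG by simp
      then obtain s where s: "s \<in> D" "s \<in> {s \<in> topspace T. g \<otimes> inv s \<in> U}"
        using op mem by (rule closure_of_meetsE)
      have sG: "s \<in> carrier G" using s(1) by (rule D_carrier)
      have sU: "g \<otimes> inv s \<in> U" using s(2) by simp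
      have "a (inv s) x = x" using act_inv[OF sG x] fix_S s(1) D(2) by auto
      then have "a (g \<otimes> inv s) x = a g x" using act_mult[of g "inv s" x] gG sG x by simp
      then have "g \<otimes> inv s \<in> visits B x \<inter> U" using g sU gG sG unfolding visits_def by simp
      moreover have "g = (g \<otimes> inv s) \<otimes> s" using gG sG by (simp add: m_assoc)
      ultimately show "g \<in> (\<Union>s\<in>D. (\<lambda>g. g \<otimes> s) ` (visits B x \<inter> U))" using s(1) by blast
    qed
    moreover have "meager T (\<Union>s\<in>D. (\<lambda>g. g \<otimes> s) ` (visits B x \<inter> U))"
      by (rule meager_UN[OF D(1)]) (use meager_translate mU D_carrier in blast)
    ultimately show False using that(1) meager_subset by blast
  qed
  have "meager T (visits A x) \<or> meager T (carrier G - visits A x)" if "A \<in> \<B>" for A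
    by (rule zero_one[OF _ x]) (use dich that \<B>(2) in auto)
  then show ?thesis using fixed_by_zero_one[OF \<B>(1,4) _ x h] by blast
qed

end

section \<open>Functions that are Lipschitz along orbits\<close>

locale polish_metric_action = polish_action +
  fixes d
  assumes metric: "Metric_space (carrier G) d" and topology: "Metric_space.mtopology (carrier G) d = T"
    and right_inv: "right_invariant G d"
begin

sublocale Metric_space "carrier G" d by (rule metric)

lemma dist_translate: "x \<in> carrier G \<Longrightarrow> y \<in> carrier G \<Longrightarrow> g \<in> carrier G \<Longrightarrow> d (x \<otimes> g) (y \<otimes> g) = d x y"
  using right_inv unfolding right_invariant_def by blast

text \<open>
  The essential distance, in the sense of category, from the identity to the set of group elements
  that move \<open>x\<close> into \<open>A\<close>. Right invariance makes it Lipschitz along orbits.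
\<close>

definition ess_dist :: "'b set \<Rightarrow> 'b \<Rightarrow> real" where
  "ess_dist A x = Inf (insert 1 {r. 0 < r \<and> \<not> meager T {g \<in> visits A x. d \<one> g < r}})"

lemma ess_dist_bdd: "bdd_below (insert 1 {r. 0 < r \<and> \<not> meager T {g \<in> visits A x. d \<one> g < r}})"
  by (rule bdd_belowI[of _ 0]) auto

lemma ess_dist_nonneg: "0 \<le> ess_dist A x"
  unfolding ess_dist_def by (rule cInf_greatest) auto

lemma ess_dist_le_1: "ess_dist A x \<le> 1"
  unfolding ess_dist_def by (rule cInf_lower[OF _ ess_dist_bdd]) simp

lemma ess_dist_le: "0 < r \<Longrightarrow> \<not> meager T {g \<in> visits A x. d \<one> g < r} \<Longrightarrow> ess_dist A x \<le> r"
  unfolding ess_dist_def by (rule cInf_lower[OF _ ess_dist_bdd]) simp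

text \<open>The ball of radius \<open>c\<close> is the countable union of the balls of radius
  \<open>c - 1 / Suc n\<close>, so a nonmeager set of visits in it is nonmeager already at a smaller
  radius. The bound on \<open>c\<close> excludes the value \<open>1\<close>, which the infimum
  contains by default in order to be bounded. In this form sublevel sets are accessible to category
  quantifiers.\<close>

lemma ess_dist_less_iff:
  assumes "c \<le> 1"
  shows "ess_dist A x < c \<longleftrightarrow> \<not> meager T {g \<in> visits A x. d \<one> g < c}"
proof
  assume "ess_dist A x < c"
  then obtain r where r: "r \<in> insert 1 {r. 0 < r \<and> \<not> meager T {g \<in> visits A x. d \<one> g < r}}" "r < c"
    unfolding ess_dist_def by (auto simp: cInf_less_iff[OF _ ess_dist_bdd])
  then have "\<not> meager T {g \<in> visits A x. d \<one> g < r}" using assms by auto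
  then show "\<not> meager T {g \<in> visits A x. d \<one> g < c}"
    by (rule not_meager_mono) (use r(2) in auto)
next
  assume nm: "\<not> meager T {g \<in> visits A x. d \<one> g < c}"
  have "{g \<in> visits A x. d \<one> g < c} \<subseteq> (\<Union>n::nat. {g \<in> visits A x. d \<one> g < c - 1 / Suc n})"
  proof
    fix g assume g: "g \<in> {g \<in> visits A x. d \<one> g < c}"
    then have "0 < c - d \<one> g" by simp
    then obtain n :: nat where "1 / Suc n < c - d \<one> g" by (metis nat_approx_posE)
    then show "g \<in> (\<Union>n::nat. {g \<in> visits A x. d \<one> g < c - 1 / Suc n})" using g by (intro UN_I[of n]) auto
  qed
  then have "\<not> meager T (\<Union>n::nat. {g \<in> visits A x. d \<one> g < c - 1 / Suc n})"
    by (rule not_meager_mono[OF nm])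
  then obtain n :: nat where n: "\<not> meager T {g \<in> visits A x. d \<one> g < c - 1 / Suc n}"
    by (rule not_meager_UNE) auto
  then have "{g \<in> visits A x. d \<one> g < c - 1 / Suc n} \<noteq> {}" by (metis meager_empty)
  \<comment> \<open>The infimum admits positive radii only; here positivity holds because a ball of
    radius at most 0 in the strict sense is empty, hence meager.\<close>
  then have "0 < c - 1 / Suc n" using nonneg by (smt (verit) Collect_empty_eq)
  then have "ess_dist A x \<le> c - 1 / Suc n" using n by (rule ess_dist_le)
  also have "\<dots> < c" by simp
  finally show "ess_dist A x < c" .
qed

lemma ess_dist_measurable:
  assumes A: "A \<in> sets M"
  shows "ess_dist A \<in> borel_measurable M"
proof (rule borel_measurableI_less)
  fix c :: real
  let ?B = "(\<lambda>(g, x). a g x) -` A \<inter> space (borel_of T \<Otimes>\<^sub>M M)"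
  have B: "?B \<in> sets (borel_of T \<Otimes>\<^sub>M M)" using act_measurable A by (rule measurable_sets)
  show "{x \<in> space M. ess_dist A x < c} \<in> sets M"
  proof (cases "c \<le> 1")
    case True
    have "{g \<in> mball \<one> c. (g, x) \<in> ?B} = {g \<in> visits A x. d \<one> g < c}" if "x \<in> space M" for x
      using that unfolding visits_def mball_def by (auto simp: space_pair_measure)
    then have "{x \<in> space M. ess_dist A x < c} = {x \<in> space M. \<not> meager T {g \<in> mball \<one> c. (g, x) \<in> ?B}}"
      using ess_dist_less_iff[OF True] by auto
    also have "\<dots> \<in> sets M"
      by (rule nonmeager_section_measurable[OF completely_metrizable second_countable B])
        (use openin_mball topology in simp)
    finally show ?thesis .
  next
    case False
    then have "{x \<in> space M. ess_dist A x < c} = space M"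
      using le_less_trans[OF ess_dist_le_1, of c] by auto
    then show ?thesis by simp
  qed
qed

text \<open>Right translation by \<open>inv h\<close> is an isometry that takes \<open>h\<close> to
  the identity, and it changes the base point from \<open>x\<close> to \<open>a h x\<close>.\<close>

lemma visits_translate_ball:
  assumes x: "x \<in> space M" and h: "h \<in> carrier G"
  shows "(\<lambda>g. g \<otimes> inv h) ` {g \<in> visits A x. d h g < r} = {g \<in> visits A (a h x). d \<one> g < r}"
proof (intro equalityI subsetI)
  fix g assume "g \<in> (\<lambda>g. g \<otimes> inv h) ` {g \<in> visits A x. d h g < r}"
  then obtain k where k: "g = k \<otimes> inv h" "k \<in> carrier G" "a k x \<in> A" "d h k < r"
    unfolding visits_def by auto
  have "d \<one> g = d h k" using dist_translate[of h k "inv h"] h k by simp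
  moreover have "a g (a h x) = a k x"
    using act_mult[of g h x] h k(1,2) x by (simp add: m_assoc)
  ultimately show "g \<in> {g \<in> visits A (a h x). d \<one> g < r}"
    using k h unfolding visits_def by simp
next
  fix g assume g: "g \<in> {g \<in> visits A (a h x). d \<one> g < r}"
  then have gG: "g \<in> carrier G" unfolding visits_def by simp
  have "d h (g \<otimes> h) = d \<one> g" using dist_translate[of \<one> g h] h gG by simp
  then have "g \<otimes> h \<in> {g \<in> visits A x. d h g < r}"
    using g act_mult[OF gG h x] h unfolding visits_def by simp
  moreover have "g = (g \<otimes> h) \<otimes> inv h" using gG h by (simp add: m_assoc)
  ultimately show "g \<in> (\<lambda>g. g \<otimes> inv h) ` {g \<in> visits A x. d h g < r}" by (rule rev_image_eqI)
qed

lemma nonmeager_ball_act: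
  assumes "x \<in> space M" "h \<in> carrier G" "\<not> meager T {g \<in> visits A x. d h g < r}"
  shows "\<not> meager T {g \<in> visits A (a h x). d \<one> g < r}"
proof
  assume "meager T {g \<in> visits A (a h x). d \<one> g < r}"
  then have "meager T ((\<lambda>g. g \<otimes> h) ` {g \<in> visits A (a h x). d \<one> g < r})"
    by (rule meager_translate[OF assms(2)])
  moreover have "(\<lambda>g. g \<otimes> h) ` (\<lambda>g. g \<otimes> inv h) ` {g \<in> visits A x. d h g < r} = {g \<in> visits A x. d h g < r}"
    using assms(2) unfolding visits_def by (force simp: image_image m_assoc)
  ultimately show False using assms(3) visits_translate_ball[OF assms(1,2)] by simp
qed

text \<open>The ball of radius \<open>r\<close> about the identity lies in the ball of radius
  \<open>r + d \<one> h\<close> about \<open>h\<close>, which translation moves back to the identity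
  at the cost of replacing \<open>x\<close> by \<open>a h x\<close>. If the radius exceeds
  \<open>1\<close>, truncation makes the bound trivial.\<close>

lemma ess_dist_act_le:
  assumes x: "x \<in> space M" and h: "h \<in> carrier G"
  shows "ess_dist A (a h x) \<le> ess_dist A x + d \<one> h"
proof (rule field_le_epsilon)
  fix e :: real assume e: "0 < e"
  show "ess_dist A (a h x) \<le> ess_dist A x + d \<one> h + e"
  proof (cases "ess_dist A x + e \<le> 1")
    case True
    let ?r = "ess_dist A x + e"
    have nm: "\<not> meager T {g \<in> visits A x. d \<one> g < ?r}"
      using ess_dist_less_iff[OF True, of A x] e by simp
    have "{g \<in> visits A x. d \<one> g < ?r} \<subseteq> {g \<in> visits A x. d h g < ?r + d \<one> h}"
      using triangle[of h \<one>] commute[of h \<one>] h visits_subset by (smt (verit) Collect_mono_iff one_closed subsetD)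
    then have "\<not> meager T {g \<in> visits A x. d h g < ?r + d \<one> h}" by (rule not_meager_mono[OF nm])
    then have "\<not> meager T {g \<in> visits A (a h x). d \<one> g < ?r + d \<one> h}"
      by (rule nonmeager_ball_act[OF x h])
    then have "ess_dist A (a h x) \<le> ?r + d \<one> h"
      using e ess_dist_nonneg[of A x] nonneg[of \<one> h] by (intro ess_dist_le) linarith
    then show ?thesis by simp
  next
    case False
    then show ?thesis using ess_dist_le_1[of A "a h x"] nonneg[of \<one> h] by linarith
  qed
qed

lemma dist_inv: "h \<in> carrier G \<Longrightarrow> d \<one> (inv h) = d \<one> h"
  using dist_translate[of \<one> "inv h" h] commute[of h \<one>] by simp

lemma ess_dist_lipschitz:
  assumes x: "x \<in> space M" and h: "h \<in> carrier G"
  shows "\<bar>ess_dist A (a h x) - ess_dist A x\<bar> \<le> d \<one> h"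
  using ess_dist_act_le[OF x h, of A] ess_dist_act_le[OF act_space[OF h x] inv_closed[OF h], of A]
    act_inv[OF h x] dist_inv[OF h] by simp

text \<open>Balls of any fixed radius about the points of \<open>D\<close> cover \<open>G\<close>,
  so a nonmeager set of visits is nonmeager in one of them and the essential distance is small at
  the corresponding \<open>a k x\<close>. By invariance it vanishes along the whole
  \<open>D\<close>-orbit, so the visits are nonmeager near every point of \<open>D\<close>, hence in
  every nonempty open set. Complements are included because \<open>zero_one\<close> asks this of
  both sets.\<close>

lemma fixed_by_ess_dist_invariant:
  assumes \<B>: "countable \<B>" "\<B> \<subseteq> sets M"
      "separates_points \<B> (space M)"
    and D: "countable D" "D \<subseteq> carrier G" "T closure_of D = carrier G"
    and x: "x \<in> space M" and h: "h \<in> carrier G"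
    and invar: "\<And>A k. A \<in> \<B> \<Longrightarrow> k \<in> D \<Longrightarrow> ess_dist A (a k x) = ess_dist A x \<and>
      ess_dist (space M - A) (a k x) = ess_dist (space M - A) x"
  shows "a h x = x"
proof -
  have dense: "\<exists>k\<in>D. d k g < r" if "g \<in> carrier G" "0 < r" for g r
  proof -
    have "g \<in> T closure_of D" using D(3) that(1) by simp
    moreover have "openin T (mball g r)" using openin_mball topology by simp
    moreover have "g \<in> mball g r" using that by simp
    ultimately obtain k where "k \<in> D" "k \<in> mball g r" by (rule closure_of_meetsE)
    then show ?thesis using commute by auto
  qed
  have dich: "\<not> meager T (visits B x \<inter> U)"
    if nm: "\<not> meager T (visits B x)" and U: "openin T U" "U \<noteq> {}"
      and inv: "\<And>k. k \<in> D \<Longrightarrow> ess_dist B (a k x) = ess_dist B x" for B U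
  proof -
    have small: "ess_dist B x \<le> r" if r: "0 < r" for r
    proof -
      have "visits B x \<subseteq> (\<Union>k\<in>D. {g \<in> visits B x. d k g < r})"
        using dense[OF _ r] visits_subset by blast
      then have "\<not> meager T (\<Union>k\<in>D. {g \<in> visits B x. d k g < r})" by (rule not_meager_mono[OF nm])
      then obtain k where k: "k \<in> D" "\<not> meager T {g \<in> visits B x. d k g < r}"
        using D(1) by (rule not_meager_UNE)
      then have "\<not> meager T {g \<in> visits B (a k x). d \<one> g < r}"
        using nonmeager_ball_act[OF x] D(2) by blast
      then have "ess_dist B (a k x) \<le> r" by (rule ess_dist_le[OF r])
      then show ?thesis using inv[OF k(1)] by simp
    qed
    obtain u where u: "u \<in> U" using U(2) by blast
    then obtain r where r: "0 < r" "mball u r \<subseteq> U" and uG: "u \<in> carrier G"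
      using U(1) openin_mtopology openin_subset[OF U(1)] unfolding topology[symmetric] by (metis subsetD topspace_mtopology)
    obtain k where k: "k \<in> D" "d k u < min 1 (r / 2)" using dense[OF uG, of "min 1 (r/2)"] r(1) by auto
    have kG: "k \<in> carrier G" using k(1) D(2) by blast
    \<comment> \<open>The bound \<open>1\<close> is what \<open>ess_dist_less_iff\<close> requires;
      with \<open>r / 2\<close> the ball of radius \<open>s\<close> about \<open>k\<close> stays in
      the ball of radius \<open>r\<close> about \<open>u\<close>.\<close>
    define s where "s = min 1 (r / 2)"
    have s: "0 < s" "s \<le> 1" using r(1) unfolding s_def by auto
    have "ess_dist B (a k x) < s" using small[of "s / 2"] inv[OF k(1)] s(1) by simp
    then have nm': "\<not> meager T {g \<in> visits B (a k x). d \<one> g < s}" using ess_dist_less_iff[OF s(2)] by simp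
    have "\<not> meager T {g \<in> visits B x. d k g < s}"
    proof
      assume "meager T {g \<in> visits B x. d k g < s}"
      then have "meager T ((\<lambda>g. g \<otimes> inv k) ` {g \<in> visits B x. d k g < s})"
        by (rule meager_translate[OF inv_closed[OF kG]])
      then show False using nm' unfolding visits_translate_ball[OF x kG] by simp
    qed
    moreover have "{g \<in> visits B x. d k g < s} \<subseteq> visits B x \<inter> U"
    proof (intro subsetI IntI)
      fix g assume g: "g \<in> {g \<in> visits B x. d k g < s}"
      then show "g \<in> visits B x" by simp
      have gG: "g \<in> carrier G" using g visits_subset by blast
      have "d u g \<le> d u k + d k g" by (rule triangle[OF uG kG gG])
      also have "\<dots> < r" using k(2) g commute[of u k] unfolding s_def by simp
      finally have "g \<in> mball u r" using uG gG by simp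
      then show "g \<in> U" using r(2) by blast
    qed
    ultimately show ?thesis using meager_subset by blast
  qed
  have "meager T (visits A x) \<or> meager T (carrier G - visits A x)" if A: "A \<in> \<B>" for A
  proof (rule zero_one[OF _ x])
    show "A \<in> sets M" using A \<B>(2) by blast
    fix B U assume "B \<in> {A, space M - A}" "\<not> meager T (visits B x)" "openin T U" "U \<noteq> {}"
    then show "\<not> meager T (visits B x \<inter> U)" using invar[OF A] by (intro dich) auto
  qed
  then show ?thesis using fixed_by_zero_one[OF \<B>(1,3) _ x h] by blast
qed

end


section \<open>Approximation by countable algebras, and Haar measure\<close>

primrec generated_stage :: "'a set \<Rightarrow> 'a set set \<Rightarrow> nat \<Rightarrow> 'a set set" where
  "generated_stage \<Omega> \<B> 0 = insert {} \<B>"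
| "generated_stage \<Omega> \<B> (Suc n) = generated_stage \<Omega> \<B> n \<union> (\<lambda>A. \<Omega> - A) ` generated_stage \<Omega> \<B> n \<union>
     (\<lambda>(A, B). A \<union> B) ` (generated_stage \<Omega> \<B> n \<times> generated_stage \<Omega> \<B> n)"

text \<open>Countability is the point: it makes the rational step functions over the algebra a
  countable family and turns conditions tested on the algebra into countable intersections.\<close>

lemma countable_generated_algebra:
  assumes "countable \<B>" "\<B> \<subseteq> Pow \<Omega>"
  obtains \<A> where "countable \<A>" "\<B> \<subseteq> \<A>" "algebra \<Omega> \<A>" "\<A> \<subseteq> sigma_sets \<Omega> \<B>"
proof -
  let ?g = "generated_stage \<Omega> \<B>"
  have count: "countable (?g n)" for n by (induction n) (use assms(1) in auto)
  have Suc: "?g n \<subseteq> ?g (Suc n)" for n by auto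
  have mono: "?g n \<subseteq> ?g k" if "n \<le> k" for n k
    using lift_Suc_mono_le[of ?g, OF Suc that] .
  have sig: "?g n \<subseteq> sigma_sets \<Omega> \<B>" for n
  proof (induction n)
    case 0 show ?case by (auto intro: sigma_sets.intros)
  next
    case (Suc n)
    show ?case
    proof
      fix C assume "C \<in> ?g (Suc n)"
      then consider "C \<in> ?g n" | A where "A \<in> ?g n" "C = \<Omega> - A" | A B where "A \<in> ?g n" "B \<in> ?g n" "C = A \<union> B"
        by auto
      then show "C \<in> sigma_sets \<Omega> \<B>"
        using Suc by cases (auto intro: sigma_sets.Compl sigma_sets_Un)
    qed
  qed
  have "sigma_sets \<Omega> \<B> \<subseteq> Pow \<Omega>" using sigma_sets_into_sp[OF assms(2)] by blast
  then have "(\<Union>n. ?g n) \<subseteq> Pow \<Omega>" using sig by blast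
  moreover have "{} \<in> (\<Union>n. ?g n)" by (rule UN_I[of 0]) auto
  moreover have "\<Omega> - A \<in> (\<Union>n. ?g n)" if A: "A \<in> (\<Union>n. ?g n)" for A
  proof -
    obtain n where "A \<in> ?g n" using A by blast
    then show ?thesis by (intro UN_I[of "Suc n"]) auto
  qed
  moreover have "A \<union> B \<in> (\<Union>n. ?g n)" if AB: "A \<in> (\<Union>n. ?g n)" "B \<in> (\<Union>n. ?g n)" for A B
  proof -
    obtain n k where "A \<in> ?g n" "B \<in> ?g k" using AB by blast
    then have "A \<in> ?g (max n k)" "B \<in> ?g (max n k)"
      using mono[of n "max n k"] mono[of k "max n k"] by auto
    then show ?thesis by (intro UN_I[of "Suc (max n k)"]) auto
  qed
  ultimately have alg: "algebra \<Omega> (\<Union>n. ?g n)" unfolding algebra_iff_Un by (intro conjI ballI)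
  have sup: "\<B> \<subseteq> (\<Union>n. ?g n)" by (rule order_trans[OF _ UN_upper[of 0 UNIV ?g]]) auto
  have "countable (\<Union>n. ?g n)" using count by (intro countable_UN) auto
  moreover note sup alg
  moreover have "(\<Union>n. ?g n) \<subseteq> sigma_sets \<Omega> \<B>" using sig by (intro UN_least)
  ultimately show thesis by (rule that)
qed

text \<open>One set \<open>A\<close> is good for both measures at once, so that two measures close
  to each other on the algebra can be compared on all measurable sets.\<close>

lemma approx_by_algebra:
  assumes fin: "finite_measure M" "finite_measure N" and sets: "sets M = sigma_sets \<Omega> \<A>" "sets N = sigma_sets \<Omega> \<A>"
    and alg: "algebra \<Omega> \<A>" and B: "B \<in> sigma_sets \<Omega> \<A>" and e: "0 < e"
  shows "\<exists>A\<in>\<A>. measure M (sym_diff A B) < e \<and> measure N (sym_diff A B) < e"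
  using B e
proof (induction B arbitrary: e rule: sigma_sets.induct)
  case (Basic B)
  then show ?case by (intro bexI[of _ B]) auto
next
  case Empty
  interpret algebra \<Omega> \<A> by (rule alg)
  show ?case using Empty by (intro bexI[of _ "{}"]) auto
next
  case (Compl B)
  interpret algebra \<Omega> \<A> by (rule alg)
  obtain A where A: "A \<in> \<A>" "measure M (sym_diff A B) < e \<and> measure N (sym_diff A B) < e"
    using Compl.IH[OF Compl.prems] by blast
  have "A \<subseteq> \<Omega>" "B \<subseteq> \<Omega>" using A(1) space_closed sigma_sets_into_sp[OF space_closed Compl.hyps] by auto
  then have "sym_diff (\<Omega> - A) (\<Omega> - B) = sym_diff A B" by blast
  then show ?case using A by (intro bexI[of _ "\<Omega> - A"]) auto
next
  case (Union B)
  interpret algebra \<Omega> \<A> by (rule alg)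
  interpret M: finite_measure M by (rule fin)
  interpret N: finite_measure N by (rule fin)
  let ?U = "\<lambda>n. \<Union>i<n. B i"
  have BM: "B i \<in> sets M" "B i \<in> sets N" for i using Union.hyps sets by auto
  have UM: "?U n \<in> sets M" "?U n \<in> sets N" "(\<Union>i. B i) \<in> sets M" "(\<Union>i. B i) \<in> sets N" for n
    using BM by auto
  have inc: "incseq ?U" by (intro incseq_SucI) (auto simp: lessThan_Suc)
  have eqU: "(\<Union>n. ?U n) = (\<Union>i. B i)" by blast
  have "(\<lambda>n. measure M (?U n)) \<longlonglongrightarrow> measure M (\<Union>i. B i)"
    using M.finite_Lim_measure_incseq[of ?U] UM inc unfolding eqU by blast
  moreover have "(\<lambda>n. measure N (?U n)) \<longlonglongrightarrow> measure N (\<Union>i. B i)"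
    using N.finite_Lim_measure_incseq[of ?U] UM inc unfolding eqU by blast
  ultimately have "\<forall>\<^sub>F n in sequentially. measure M (?U n) > measure M (\<Union>i. B i) - e / 2 \<and>
      measure N (?U n) > measure N (\<Union>i. B i) - e / 2"
    using Union.prems by (intro eventually_conj order_tendstoD(1)) auto
  then obtain n where n: "measure M (?U n) > measure M (\<Union>i. B i) - e / 2"
      "measure N (?U n) > measure N (\<Union>i. B i) - e / 2"
    unfolding eventually_sequentially by blast
  \<comment> \<open>The \<open>n\<close> pieces contribute at most \<open>e / 2\<close> together;
    the added \<open>1\<close> covers \<open>n = 0\<close>.\<close>
  let ?d = "e / (2 * (real n + 1))"
  have "0 < ?d" using Union.prems by simp
  then have "\<forall>i. \<exists>A\<in>\<A>. measure M (sym_diff A (B i)) < ?d \<and> measure N (sym_diff A (B i)) < ?d"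
    using Union.IH by blast
  then have "\<forall>i. \<exists>A. A \<in> \<A> \<and> measure M (sym_diff A (B i)) < ?d \<and> measure N (sym_diff A (B i)) < ?d"
    by blast
  from choice[OF this] obtain A where A: "A i \<in> \<A>" "measure M (sym_diff (A i) (B i)) < ?d"
      "measure N (sym_diff (A i) (B i)) < ?d" for i by blast
  let ?A = "\<Union>i<n. A i"
  have "?A \<in> \<A>" using A(1) by (intro finite_UN) auto
  have AM: "A i \<in> sets M" "A i \<in> sets N" for i using A(1) sets by (auto intro: sigma_sets.Basic)
  have sub: "sym_diff ?A (\<Union>i. B i) \<subseteq> ((\<Union>i. B i) - ?U n) \<union> (\<Union>i<n. sym_diff (A i) (B i))" by blast
  have bound: "measure L (sym_diff ?A (\<Union>i. B i)) < e"
    if L: "finite_measure L" "\<And>i. A i \<in> sets L" "\<And>i. B i \<in> sets L" "measure L (?U n) > measure L (\<Union>i. B i) - e / 2"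
      "\<And>i. measure L (sym_diff (A i) (B i)) < ?d" for L
  proof -
    interpret L: finite_measure L by (rule L)
    have BL: "(\<Union>i. B i) \<in> sets L" "?U n \<in> sets L" "\<And>i. sym_diff (A i) (B i) \<in> sets L" using L(2,3) by auto
    have "measure L (sym_diff ?A (\<Union>i. B i)) \<le> measure L (((\<Union>i. B i) - ?U n) \<union> (\<Union>i<n. sym_diff (A i) (B i)))"
      by (rule L.finite_measure_mono[OF sub]) (use BL in auto)
    also have "\<dots> \<le> measure L ((\<Union>i. B i) - ?U n) + measure L (\<Union>i<n. sym_diff (A i) (B i))"
      by (rule measure_Un_le) (use BL in auto)
    also have "measure L (\<Union>i<n. sym_diff (A i) (B i)) \<le> (\<Sum>i<n. measure L (sym_diff (A i) (B i)))"
      by (rule measure_UNION_le) (use BL in auto)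
    also have "\<dots> \<le> (\<Sum>i<n. ?d)" by (intro sum_mono less_imp_le L)
    also have "\<dots> = real n * ?d" by simp
    also have "\<dots> \<le> e / 2" using Union.prems by (simp add: field_simps)
    also have "measure L ((\<Union>i. B i) - ?U n) = measure L (\<Union>i. B i) - measure L (?U n)"
      by (rule L.finite_measure_Diff) (use BL in auto)
    finally show ?thesis using L(4) by simp
  qed
  show ?case
    using \<open>?A \<in> \<A>\<close> bound[OF fin(1) AM(1) BM(1) n(1) A(2)] bound[OF fin(2) AM(2) BM(2) n(2) A(3)] by blast
qed

text \<open>Coded by lists, so that rational coefficients and a countable algebra visibly give
  countably many functions.\<close>

definition step_fun :: "(real \<times> 'a set) list \<Rightarrow> 'a \<Rightarrow> real" where
  "step_fun l x = (\<Sum>(c, A)\<leftarrow>l. c * indicator A x)"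

lemma step_fun_append: "step_fun (l @ l') x = step_fun l x + step_fun l' x"
  unfolding step_fun_def by simp

lemma integrable_step_fun:
  assumes "finite_measure M" "\<A> \<subseteq> sets M" "l \<in> lists (R \<times> \<A>)"
  shows "integrable M (step_fun l)"
  using assms(3)
proof (induction l)
  case Nil
  then show ?case unfolding step_fun_def by simp
next
  case (Cons p l)
  interpret finite_measure M by (rule assms)
  obtain c A where p: "p = (c, A)" "A \<in> \<A>" using Cons.hyps by auto
  have "integrable M (\<lambda>x. c * indicator A x + step_fun l x)"
    using Cons.IH p(2) assms(2) by (intro Bochner_Integration.integrable_add integrable_mult_right integrable_real_indicator) (auto simp: less_top[symmetric])
  then show ?case unfolding step_fun_def p(1) by simp
qed

lemma L1_separable:
  fixes f :: "'a \<Rightarrow> real"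
  assumes fin: "finite_measure M" and sets: "sets M = sigma_sets (space M) \<A>" and alg: "algebra (space M) \<A>"
    and f: "integrable M f" and e: "0 < e"
  shows "\<exists>l\<in>lists (\<rat> \<times> \<A>). (LINT x|M. \<bar>f x - step_fun l x\<bar>) < e"
  using f e
proof (induction f arbitrary: e rule: integrable_induct)
  case (base B c)
  interpret finite_measure M by (rule fin)
  interpret algebra "space M" \<A> by (rule alg)
  \<comment> \<open>Half of the error goes to replacing \<open>B\<close> by \<open>A\<close>, half
    to replacing the coefficient \<open>c\<close> by a rational \<open>q\<close>. The added
    \<open>1\<close>, here and below, avoids division by 0.\<close>
  have "0 < e / (2 * (\<bar>c\<bar> + 1))" using base(3) by simp
  then obtain A where A: "A \<in> \<A>" "measure M (sym_diff A B) < e / (2 * (\<bar>c\<bar> + 1))"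
    using approx_by_algebra[OF fin fin sets sets alg] base(1) sets by blast
  have Am: "A \<in> sets M" using A(1) unfolding sets by (rule sigma_sets.Basic)
  have "c < c + e / (2 * (measure M (space M) + 1))"
    using base(3) by (simp add: add_nonneg_pos)
  then obtain q where q: "q \<in> \<rat>" "c < q" "q < c + e / (2 * (measure M (space M) + 1))"
    using Rats_dense_in_real by blast
  have int1: "integrable M (\<lambda>x. \<bar>c\<bar> * indicator (sym_diff A B) x + (q - c))"
    using Am base(1) by (intro Bochner_Integration.integrable_add integrable_mult_right integrable_real_indicator) (auto simp: less_top[symmetric])
  have int2: "integrable M (\<lambda>x. \<bar>indicator B x *\<^sub>R c - step_fun [(q, A)] x\<bar>)"
    using integrable_step_fun[OF fin, of \<A> "[(q, A)]" UNIV] A(1) sets base(1)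
    by (intro integrable_abs Bochner_Integration.integrable_diff integrable_scaleR_left integrable_real_indicator) (auto simp: less_top[symmetric])
  have "(LINT x|M. \<bar>indicator B x *\<^sub>R c - step_fun [(q, A)] x\<bar>)
      \<le> (LINT x|M. \<bar>c\<bar> * indicator (sym_diff A B) x + (q - c))"
    by (rule integral_mono[OF int2 int1]) (use q in \<open>auto simp: step_fun_def indicator_def\<close>)
  also have "\<dots> = \<bar>c\<bar> * measure M (sym_diff A B) + (q - c) * measure M (space M)"
    using Am base(1) by (subst Bochner_Integration.integral_add) (auto simp: less_top[symmetric])
  also have "\<dots> < e"
  proof -
    have "\<bar>c\<bar> * measure M (sym_diff A B) \<le> (\<bar>c\<bar> + 1) * measure M (sym_diff A B)"
      by (intro mult_right_mono) auto
    also have "\<dots> < e / 2" using A(2) by (simp add: field_simps)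
    finally have 1: "\<bar>c\<bar> * measure M (sym_diff A B) < e / 2" .
    have "(q - c) * measure M (space M) \<le> (q - c) * (measure M (space M) + 1)"
      using q by (intro mult_left_mono) auto
    also have "\<dots> < e / (2 * (measure M (space M) + 1)) * (measure M (space M) + 1)"
      using q by (intro mult_strict_right_mono) (auto simp: add_nonneg_pos)
    also have "\<dots> = e / 2"
      using measure_nonneg[of M "space M"] by (simp add: field_simps add_nonneg_eq_0_iff)
    finally show ?thesis using 1 by simp
  qed
  finally show ?case using q A(1) by (intro bexI[of _ "[(q, A)]"]) auto
next
  case (add f g)
  obtain l where l: "l \<in> lists (\<rat> \<times> \<A>)" "(LINT x|M. \<bar>f x - step_fun l x\<bar>) < e / 2"
    using add.IH(1)[of "e / 2"] add.prems by auto
  obtain l' where l': "l' \<in> lists (\<rat> \<times> \<A>)" "(LINT x|M. \<bar>g x - step_fun l' x\<bar>) < e / 2"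
    using add.IH(2)[of "e / 2"] add.prems by auto
  have sub: "\<A> \<subseteq> sets M" unfolding sets by (auto intro: sigma_sets.Basic)
  have i: "integrable M (\<lambda>x. \<bar>f x - step_fun l x\<bar>)" "integrable M (\<lambda>x. \<bar>g x - step_fun l' x\<bar>)"
      "integrable M (\<lambda>x. \<bar>(f x + g x) - step_fun (l @ l') x\<bar>)"
    using integrable_step_fun[OF fin sub] l(1) l'(1) add.hyps by (auto simp: step_fun_append)
  have "(LINT x|M. \<bar>(f x + g x) - step_fun (l @ l') x\<bar>)
      \<le> (LINT x|M. \<bar>f x - step_fun l x\<bar> + \<bar>g x - step_fun l' x\<bar>)"
    using i by (intro integral_mono) (auto simp: step_fun_append)
  also have "\<dots> < e" using i l(2) l'(2) by simp
  finally show ?case using l(1) l'(1) by (intro bexI[of _ "l @ l'"]) auto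
next
  case (lim f s)
  have sub: "\<A> \<subseteq> sets M" unfolding sets by (auto intro: sigma_sets.Basic)
  have "(\<lambda>i. LINT x|M. \<bar>f x - s i x\<bar>) \<longlonglongrightarrow> (LINT x|M. 0)"
  proof (rule integral_dominated_convergence[where w = "\<lambda>x. 3 * \<bar>f x\<bar>"])
    show "(\<lambda>x. \<bar>f x - s i x\<bar>) \<in> borel_measurable M" for i using lim.hyps by measurable
    show "integrable M (\<lambda>x. 3 * \<bar>f x\<bar>)" using lim.hyps by simp
    show "AE x in M. (\<lambda>i. \<bar>f x - s i x\<bar>) \<longlonglongrightarrow> 0"
      using lim.hyps(2) by (intro AE_I2) (auto intro!: tendsto_rabs_zero LIM_zero_iff[THEN iffD2] tendsto_eq_intros)
    show "AE x in M. norm \<bar>f x - s i x\<bar> \<le> 3 * \<bar>f x\<bar>" for i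
      using lim.hyps(3)[of _ i] by (intro AE_I2) fastforce
  qed simp
  then have "\<forall>\<^sub>F i in sequentially. (LINT x|M. \<bar>f x - s i x\<bar>) < e / 2"
    using lim.prems by (intro order_tendstoD(2)) auto
  then obtain i where i: "(LINT x|M. \<bar>f x - s i x\<bar>) < e / 2" unfolding eventually_sequentially by blast
  obtain l where l: "l \<in> lists (\<rat> \<times> \<A>)" "(LINT x|M. \<bar>s i x - step_fun l x\<bar>) < e / 2"
    using lim.IH[of "e / 2"] lim.prems by auto
  have int: "integrable M (\<lambda>x. \<bar>f x - step_fun l x\<bar>)" "integrable M (\<lambda>x. \<bar>f x - s i x\<bar>)"
      "integrable M (\<lambda>x. \<bar>s i x - step_fun l x\<bar>)"
    using integrable_step_fun[OF fin sub l(1)] lim.hyps by auto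
  have "(LINT x|M. \<bar>f x - step_fun l x\<bar>) \<le> (LINT x|M. \<bar>f x - s i x\<bar> + \<bar>s i x - step_fun l x\<bar>)"
    using int by (intro integral_mono) auto
  also have "\<dots> < e" using int i l(2) by simp
  finally show ?case using l(1) by blast
qed

text \<open>Integrate \<open>f (inv x \<otimes> y)\<close> over both variables. In \<open>y\<close>
  first, left invariance gives the integral of \<open>f\<close>; in \<open>x\<close> first,
  \<open>inv x \<otimes> y\<close> is the inverse of \<open>inv y \<otimes> x\<close>, and left
  invariance gives the integral of \<open>f (inv x)\<close>. Right invariance is left invariance
  conjugated by the inverse.\<close>

lemma haar_inverse_right_invariant:
  fixes K (structure)
  assumes "group K" and sp: "space m = carrier K" and "prob_space m"
    and mult: "(\<lambda>(x, y). x \<otimes> y) \<in> m \<Otimes>\<^sub>M m \<rightarrow>\<^sub>M m" and inv: "(\<lambda>x. inv x) \<in> m \<rightarrow>\<^sub>M m"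
    and left: "\<And>g. g \<in> carrier K \<Longrightarrow> distr m m (\<lambda>x. g \<otimes> x) = m"
    and f: "f \<in> borel_measurable m"
  shows "(\<integral>\<^sup>+x. f (inv x) \<partial>m) = (\<integral>\<^sup>+x. f x \<partial>m)"
    and "g \<in> carrier K \<Longrightarrow> (\<integral>\<^sup>+x. f (x \<otimes> g) \<partial>m) = (\<integral>\<^sup>+x. f x \<partial>m)"
proof -
  interpret group K by fact
  interpret prob_space m by fact
  interpret P: pair_sigma_finite m m by unfold_locales
  have lm: "(\<lambda>x. g \<otimes> x) \<in> m \<rightarrow>\<^sub>M m" if "g \<in> carrier K" for g
    using measurable_Pair2[OF mult, of g] that sp by simp
  have L: "(\<integral>\<^sup>+x. F (g \<otimes> x) \<partial>m) = (\<integral>\<^sup>+x. F x \<partial>m)" if "F \<in> borel_measurable m" "g \<in> carrier K" for F g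
    using nn_integral_distr[OF lm[OF that(2)], of F] that(1) left[OF that(2)] by simp
  have I: "(\<integral>\<^sup>+x. f (inv x) \<partial>m) = (\<integral>\<^sup>+x. f x \<partial>m)" if f: "f \<in> borel_measurable m" for f
  proof -
    have fi: "(\<lambda>x. f (inv x)) \<in> borel_measurable m" using measurable_compose[OF inv f] .
    have "(\<lambda>(x, y). inv x \<otimes> y) \<in> m \<Otimes>\<^sub>M m \<rightarrow>\<^sub>M m"
    proof -
      have "(\<lambda>p. (inv (fst p), snd p)) \<in> m \<Otimes>\<^sub>M m \<rightarrow>\<^sub>M m \<Otimes>\<^sub>M m"
        using inv by measurable
      from measurable_compose[OF this mult] show ?thesis by (simp add: case_prod_beta')
    qed
    from measurable_compose[OF this f]
    have meas: "(\<lambda>(x, y). f (inv x \<otimes> y)) \<in> borel_measurable (m \<Otimes>\<^sub>M m)" by (simp add: case_prod_beta')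
    have "(\<integral>\<^sup>+x. \<integral>\<^sup>+y. f (inv x \<otimes> y) \<partial>m \<partial>m) = (\<integral>\<^sup>+x. (\<integral>\<^sup>+y. f y \<partial>m) \<partial>m)"
      by (rule nn_integral_cong) (use L[OF f] sp in simp)
    then have "(\<integral>\<^sup>+x. f x \<partial>m) = (\<integral>\<^sup>+x. \<integral>\<^sup>+y. f (inv x \<otimes> y) \<partial>m \<partial>m)"
      using emeasure_space_1 by simp
    also have "\<dots> = (\<integral>\<^sup>+y. \<integral>\<^sup>+x. f (inv x \<otimes> y) \<partial>m \<partial>m)"
      using P.Fubini'[OF meas] by simp
    also have "\<dots> = (\<integral>\<^sup>+y. \<integral>\<^sup>+x. f (inv x) \<partial>m \<partial>m)"
    proof (rule nn_integral_cong)
      fix y assume "y \<in> space m"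
      then have y: "y \<in> carrier K" using sp by simp
      have "(\<integral>\<^sup>+x. f (inv x \<otimes> y) \<partial>m) = (\<integral>\<^sup>+x. f (inv (inv y \<otimes> x)) \<partial>m)"
        using y sp by (intro nn_integral_cong) (simp add: inv_mult_group)
      then show "(\<integral>\<^sup>+x. f (inv x \<otimes> y) \<partial>m) = (\<integral>\<^sup>+x. f (inv x) \<partial>m)"
        using L[OF fi inv_closed[OF y]] by simp
    qed
    finally show ?thesis using emeasure_space_1 by simp
  qed
  show "(\<integral>\<^sup>+x. f (inv x) \<partial>m) = (\<integral>\<^sup>+x. f x \<partial>m)" using f by (rule I)
  show "(\<integral>\<^sup>+x. f (x \<otimes> g) \<partial>m) = (\<integral>\<^sup>+x. f x \<partial>m)" if g: "g \<in> carrier K"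
  proof -
    have fi: "(\<lambda>x. f (inv x)) \<in> borel_measurable m" using measurable_compose[OF inv f] .
    have "(\<lambda>x. x \<otimes> g) \<in> m \<rightarrow>\<^sub>M m" using measurable_Pair1[OF mult, of g] g sp by simp
    then have "(\<lambda>x. f (x \<otimes> g)) \<in> borel_measurable m" using f by (rule measurable_compose)
    then have "(\<integral>\<^sup>+x. f (x \<otimes> g) \<partial>m) = (\<integral>\<^sup>+x. f (inv x \<otimes> g) \<partial>m)" by (rule I[symmetric])
    also have "\<dots> = (\<integral>\<^sup>+x. f (inv (inv g \<otimes> x)) \<partial>m)"
      using g sp by (intro nn_integral_cong) (simp add: inv_mult_group)
    also have "\<dots> = (\<integral>\<^sup>+x. f x \<partial>m)" using L[OF fi inv_closed[OF g]] I[OF f] by simp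
    finally show ?thesis .
  qed
qed


section \<open>Continuity of translation in total variation\<close>

lemma real_density:
  assumes "finite_measure M" "finite_measure N" "absolutely_continuous M N" "sets N = sets M"
  obtains f :: "'a \<Rightarrow> real" where "f \<in> borel_measurable M" "\<And>x. 0 \<le> f x" "N = density M (\<lambda>x. ennreal (f x))"
    "integrable M f" "\<And>A. A \<in> sets M \<Longrightarrow> measure N A = (LINT x|M. indicator A x * f x)"
proof -
  interpret M: finite_measure M by fact
  interpret N: finite_measure N by fact
  define f where "f x = enn2real (RN_deriv M N x)" for x
  have f: "f \<in> borel_measurable M" "0 \<le> f x" for x unfolding f_def by auto
  have "AE x in M. RN_deriv M N x \<noteq> \<infinity>"
    by (rule M.RN_deriv_finite) (use assms N.sigma_finite_measure_axioms in auto)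
  then have "AE x in M. RN_deriv M N x = ennreal (f x)"
    unfolding f_def by eventually_elim (simp add: ennreal_enn2real_if)
  then have "density M (RN_deriv M N) = density M (\<lambda>x. ennreal (f x))"
    by (intro density_cong) (use f in auto)
  then have N: "N = density M (\<lambda>x. ennreal (f x))"
    using M.density_RN_deriv[OF assms(3,4)] by simp
  have "(\<integral>\<^sup>+x. ennreal (f x) \<partial>M) = emeasure N (space M)"
    unfolding N using f(1) by (subst emeasure_density) (auto intro!: nn_integral_cong)
  also have "\<dots> < \<infinity>" by (simp add: less_top[symmetric])
  finally have int: "integrable M f" using f by (intro integrableI_nonneg) auto
  have "measure N A = (LINT x|M. indicator A x * f x)" if A: "A \<in> sets M" for A
  proof -
    have "measure N A = (LINT x|N. indicator A x)"
      using sets.sets_into_space[of A N] A assms(4) by (simp add: Int_absorb2)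
    also have "\<dots> = (LINT x|M. f x *\<^sub>R indicator A x)"
      unfolding N by (rule integral_density) (use f A in auto)
    finally show ?thesis by (simp add: mult.commute)
  qed
  with f N int show thesis by (intro that)
qed

context polish_metric_action
begin

text \<open>By Radon-Nikodym and separability of \<open>L\<^sup>1\<close> the countably many sets
  \<open>E l\<close>, on which the translate of \<open>\<mu>\<close> is within \<open>e / 4\<close>
  of the step density \<open>l\<close>, cover \<open>G\<close>; one of them is comeager in a
  nonempty open \<open>U\<close>. For \<open>h\<close> near the identity some \<open>g\<close> has
  both \<open>g\<close> and \<open>g \<otimes> h\<close> in this set, so the two translates are
  within \<open>e / 2\<close> of each other on the algebra, and \<open>g\<close> can be
  cancelled.\<close>

lemma translates_locally_close:
  fixes \<mu> :: "'b measure"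
  assumes prob: "prob_space \<mu>" and sets: "sets \<mu> = sets M"
    and null: "\<And>h N. h \<in> carrier G \<Longrightarrow> N \<in> sets M \<Longrightarrow> emeasure \<mu> N = 0 \<Longrightarrow> emeasure \<mu> (a h -` N \<inter> space M) = 0"
    and e: "0 < e"
  obtains r where "0 < r" "\<And>h A. h \<in> carrier G \<Longrightarrow> d \<one> h < r \<Longrightarrow> A \<in> sets M \<Longrightarrow>
    \<bar>measure \<mu> (a h -` A \<inter> space M) - measure \<mu> A\<bar> \<le> e"
proof -
  interpret P: prob_space \<mu> by fact
  have space: "space \<mu> = space M" using sets by (rule sets_eq_imp_space_eq)
  have am: "a h \<in> \<mu> \<rightarrow>\<^sub>M M" if "h \<in> carrier G" for h
    using act_measurable'[OF that] by (simp add: measurable_cong_sets[OF sets refl])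
  obtain \<B> where \<B>: "countable \<B>" "\<B> \<subseteq> sets M" "sets M = sigma_sets (space M) \<B>"
    "separates_points \<B> (space M)"
    by (rule standard_borel_separating[OF std])
  have "\<B> \<subseteq> Pow (space M)" using \<B>(2) sets.space_closed by blast
  from countable_generated_algebra[OF \<B>(1) this] obtain \<A> where
    \<A>: "countable \<A>" "\<B> \<subseteq> \<A>" "algebra (space M) \<A>" "\<A> \<subseteq> sigma_sets (space M) \<B>" .
  have gen: "sets M = sigma_sets (space M) \<A>"
  proof
    show "sets M \<subseteq> sigma_sets (space M) \<A>" unfolding \<B>(3) using \<A>(2) by (rule sigma_sets_mono')
    show "sigma_sets (space M) \<A> \<subseteq> sets M"
      using \<A>(4) \<B>(3) by (intro sets.sigma_sets_subset) simp
  qed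
  have AM: "A \<in> sets M" if "A \<in> \<A>" for A using that gen by auto
  \<comment> \<open>Testing on the countable algebra only keeps \<open>E l\<close> Borel, which
    provides the Baire property.\<close>
  define E where "E l = {h \<in> carrier G. \<forall>A\<in>\<A>.
    \<bar>measure \<mu> (a h -` A \<inter> space M) - (LINT x|\<mu>. indicator A x * step_fun l x)\<bar> \<le> e / 4}" for l
  have meas: "(\<lambda>h. measure \<mu> (a h -` A \<inter> space M)) \<in> borel_measurable (borel_of T)" if A: "A \<in> sets M" for A
  proof -
    let ?Q = "(\<lambda>(h, x). a h x) -` A \<inter> space (borel_of T \<Otimes>\<^sub>M \<mu>)"
    have "(\<lambda>(h, x). a h x) \<in> borel_of T \<Otimes>\<^sub>M \<mu> \<rightarrow>\<^sub>M M"
      using act_measurable measurable_cong_sets[OF sets_pair_measure_cong[OF refl sets] refl] by blast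
    then have Q: "?Q \<in> sets (borel_of T \<Otimes>\<^sub>M \<mu>)" using A by (rule measurable_sets)
    have m: "(\<lambda>h. enn2real (emeasure \<mu> (Pair h -` ?Q))) \<in> borel_measurable (borel_of T)"
      using P.measurable_emeasure_Pair[OF Q] by measurable
    have eq: "enn2real (emeasure \<mu> (Pair h -` ?Q)) = measure \<mu> (a h -` A \<inter> space M)"
      if "h \<in> space (borel_of T)" for h
      unfolding measure_def using that
      by (intro arg_cong[where f = "\<lambda>S. enn2real (emeasure \<mu> S)"]) (auto simp: space_pair_measure space)
    show ?thesis by (rule measurable_cong[THEN iffD1, OF eq m])
  qed
  have E_borel: "E l \<in> sets (borel_of T)" for l
  proof -
    let ?F = "\<lambda>A. {h \<in> space (borel_of T). e / 4 < \<bar>measure \<mu> (a h -` A \<inter> space M) -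
      (LINT x|\<mu>. indicator A x * step_fun l x)\<bar>}"
    have "?F A \<in> sets (borel_of T)" if "A \<in> \<A>" for A
    proof -
      have [measurable]: "(\<lambda>h. measure \<mu> (a h -` A \<inter> space M)) \<in> borel_measurable (borel_of T)"
        using that by (intro meas AM)
      show ?thesis by measurable
    qed
    then have "space (borel_of T) - (\<Union>A\<in>\<A>. ?F A) \<in> sets (borel_of T)"
      by (intro sets.compl_sets sets.countable_UN'' \<A>(1))
    moreover have "E l = space (borel_of T) - (\<Union>A\<in>\<A>. ?F A)"
      unfolding E_def by (auto simp: not_less)
    ultimately show ?thesis by simp
  qed
  have cover: "carrier G \<subseteq> (\<Union>l\<in>lists (\<rat> \<times> \<A>). E l)"
  proof
    fix h assume h: "h \<in> carrier G"
    let ?N = "distr \<mu> \<mu> (a h)"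
    have am': "a h \<in> \<mu> \<rightarrow>\<^sub>M \<mu>" using am[OF h] by (simp add: measurable_cong_sets[OF refl sets])
    have ac: "absolutely_continuous \<mu> ?N"
      unfolding absolutely_continuous_def
    proof
      fix N assume "N \<in> null_sets \<mu>"
      then have "N \<in> sets M" "emeasure \<mu> N = 0" using sets by auto
      then have "emeasure \<mu> (a h -` N \<inter> space M) = 0" using null[OF h] by blast
      then have "emeasure ?N N = 0"
        using emeasure_distr[OF am', of N] \<open>N \<in> null_sets \<mu>\<close> by (simp add: space null_setsD2)
      then show "N \<in> null_sets ?N"
        using \<open>N \<in> sets M\<close> sets by (intro null_setsI) simp_all
    qed
    have fN: "finite_measure ?N" using P.prob_space_distr[OF am'] prob_space_def by blast
    obtain f :: "'b \<Rightarrow> real" where f: "f \<in> borel_measurable \<mu>" "\<And>x. 0 \<le> f x"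
      "?N = density \<mu> (\<lambda>x. ennreal (f x))" "integrable \<mu> f"
      "\<And>A. A \<in> sets \<mu> \<Longrightarrow> measure ?N A = (LINT x|\<mu>. indicator A x * f x)"
      by (rule real_density[OF P.finite_measure_axioms fN ac sets_distr]) (rule that)
    obtain l where l: "l \<in> lists (\<rat> \<times> \<A>)" "(LINT x|\<mu>. \<bar>f x - step_fun l x\<bar>) < e / 4"
      using L1_separable[OF P.finite_measure_axioms _ _ f(4), of \<A> "e / 4"] e gen sets space \<A>(3) by auto
    have li: "integrable \<mu> (step_fun l)"
      by (rule integrable_step_fun[OF P.finite_measure_axioms _ l(1)]) (use AM sets in auto)
    have "\<bar>measure \<mu> (a h -` A \<inter> space M) - (LINT x|\<mu>. indicator A x * step_fun l x)\<bar> \<le> e / 4"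
      if A: "A \<in> \<A>" for A
    proof -
      have As: "A \<in> sets \<mu>" using AM[OF A] sets by simp
      have i: "integrable \<mu> (\<lambda>x. indicator A x * f x)" "integrable \<mu> (\<lambda>x. indicator A x * step_fun l x)"
        using integrable_mult_indicator[OF As f(4)] integrable_mult_indicator[OF As li] by simp_all
      have "measure \<mu> (a h -` A \<inter> space M) = (LINT x|\<mu>. indicator A x * f x)"
        using f(5)[OF As] measure_distr[OF am' As] space by simp
      then have "\<bar>measure \<mu> (a h -` A \<inter> space M) - (LINT x|\<mu>. indicator A x * step_fun l x)\<bar>
          = \<bar>LINT x|\<mu>. indicator A x * f x - indicator A x * step_fun l x\<bar>"
        using i by simp
      also have "\<dots> \<le> (LINT x|\<mu>. \<bar>indicator A x * f x - indicator A x * step_fun l x\<bar>)"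
        by (rule integral_abs_bound)
      also have "\<dots> \<le> (LINT x|\<mu>. \<bar>f x - step_fun l x\<bar>)"
        using i f(4) li by (intro integral_mono) (auto simp: indicator_def)
      finally show ?thesis using l(2) by simp
    qed
    then show "h \<in> (\<Union>l\<in>lists (\<rat> \<times> \<A>). E l)" using h l(1) unfolding E_def by blast
  qed
  have "\<not> meager T (carrier G)"
    by (rule not_meager_open[OF completely_metrizable]) (use openin_topspace[of T] one_closed in auto)
  from not_meager_mono[OF this cover]
  obtain l where l: "\<not> meager T (E l)"
    by (rule not_meager_UNE) (use \<A>(1) in \<open>auto intro!: countable_lists countable_SIGMA countable_rat\<close>)
  obtain U where U: "openin T U" "meager T (E l - U)" "meager T (U - E l)"
    by (rule baire_propertyE[OF baire_property_borel[OF E_borel]])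
  have "U \<noteq> {}" using U(2) l by auto
  then obtain u where u: "u \<in> U" by blast
  have UG: "U \<subseteq> carrier G" using openin_subset[OF U(1)] by simp
  then have uG: "u \<in> carrier G" using u by blast
  have mult_cont: "continuous_map (prod_topology T T) T (\<lambda>(x, y). x \<otimes> y)"
    using top_group unfolding topological_group_def by simp
  have "continuous_map T (prod_topology T T) (\<lambda>h. (u, h))"
    using uG by (simp add: continuous_map_pairwise comp_def)
  from continuous_map_compose[OF this mult_cont]
  have "openin T {h \<in> topspace T. u \<otimes> h \<in> U}"
    using U(1) openin_continuous_map_preimage by (fastforce simp: comp_def)
  moreover have "\<one> \<in> {h \<in> topspace T. u \<otimes> h \<in> U}" using u uG by simp
  ultimately obtain r where r: "0 < r" "mball \<one> r \<subseteq> {h \<in> topspace T. u \<otimes> h \<in> U}"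
    unfolding topology[symmetric] openin_mtopology by blast
  show thesis
  proof (rule that[OF r(1)])
    fix h A assume h: "h \<in> carrier G" "d \<one> h < r" and A: "A \<in> sets M"
    have uh: "u \<otimes> h \<in> U" using r(2) h by auto
    have "openin T {g \<in> topspace T. g \<otimes> h \<in> U}"
      using homeomorphic_imp_continuous_map[OF homeomorphic_map_right_translation[OF top_group h(1)]] U(1)
      by (rule openin_continuous_map_preimage)
    then have W: "openin T (U \<inter> {g \<in> topspace T. g \<otimes> h \<in> U})" (is "openin T ?W") using U(1) by blast
    have "u \<in> ?W" using u uh uG by simp
    \<comment> \<open>\<open>?W\<close> contains \<open>u\<close>, since \<open>r\<close> was chosen
      with \<open>u \<otimes> h\<close> in \<open>U\<close>. The points to be avoided form two
      meager sets: where \<open>g\<close> leaves \<open>E l\<close>, and where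
      \<open>g \<otimes> h\<close> does.\<close>
    then have nm: "\<not> meager T ?W" using not_meager_open[OF completely_metrizable W] by blast
    have m2: "meager T ((U - E l) \<union> (\<lambda>g. g \<otimes> inv h) ` (U - E l))"
      using U(3) meager_translate[OF inv_closed[OF h(1)] U(3)] by (rule meager_Un)
    have "\<not> ?W \<subseteq> (U - E l) \<union> (\<lambda>g. g \<otimes> inv h) ` (U - E l)"
      using nm by (rule contrapos_nn) (rule meager_subset[OF m2])
    then obtain g where g: "g \<in> ?W" "g \<notin> U - E l" "g \<notin> (\<lambda>g. g \<otimes> inv h) ` (U - E l)" by blast
    have gE: "g \<in> E l" using g(1,2) by blast
    then have gG: "g \<in> carrier G" unfolding E_def by blast
    have ghE: "g \<otimes> h \<in> E l"
    proof (rule ccontr)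
      assume "g \<otimes> h \<notin> E l"
      then have "g \<otimes> h \<in> U - E l" using g(1) by simp
      moreover have "g = (g \<otimes> h) \<otimes> inv h" using gG h(1) by (simp add: m_assoc)
      ultimately show False using g(3) by (metis rev_image_eqI)
    qed
    let ?N1 = "distr \<mu> M (a (g \<otimes> h))" and ?N2 = "distr \<mu> M (a g)"
    have N: "measure ?N1 B = measure \<mu> (a (g \<otimes> h) -` B \<inter> space M)" "measure ?N2 B = measure \<mu> (a g -` B \<inter> space M)"
      if "B \<in> sets M" for B
      using measure_distr[OF am that] gG h(1) space by simp_all
    have close: "\<bar>measure ?N1 B - measure ?N2 B\<bar> \<le> e / 2" if B: "B \<in> \<A>" for B
    proof -
      have "\<bar>measure \<mu> (a (g \<otimes> h) -` B \<inter> space M) - (LINT x|\<mu>. indicator B x * step_fun l x)\<bar> \<le> e / 4"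
          "\<bar>measure \<mu> (a g -` B \<inter> space M) - (LINT x|\<mu>. indicator B x * step_fun l x)\<bar> \<le> e / 4"
        using gE ghE B unfolding E_def by blast+
      then show ?thesis unfolding N[OF AM[OF B]] by linarith
    qed
    have fin: "finite_measure ?N1" "finite_measure ?N2"
      using P.prob_space_distr[OF am] gG h(1) prob_space_def by blast+
    interpret N1: finite_measure ?N1 by (rule fin)
    interpret N2: finite_measure ?N2 by (rule fin)
    \<comment> \<open>Passing from the algebra to an arbitrary set costs \<open>e / 4\<close> for
      each of the two measures, on top of the \<open>e / 2\<close> on the algebra.\<close>
    have close': "\<bar>measure ?N1 B - measure ?N2 B\<bar> \<le> e" if B: "B \<in> sets M" for B
    proof -
      have "\<exists>C\<in>\<A>. measure ?N1 (sym_diff C B) < e / 4 \<and> measure ?N2 (sym_diff C B) < e / 4"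
        by (rule approx_by_algebra[OF fin _ _ \<A>(3)]) (use gen B e in auto)
      then obtain C where C: "C \<in> \<A>" "measure ?N1 (sym_diff C B) < e / 4" "measure ?N2 (sym_diff C B) < e / 4"
        by blast
      have "\<bar>measure L C - measure L B\<bar> \<le> measure L (sym_diff C B)" if "finite_measure L" "sets L = sets M" for L
      proof -
        interpret L: finite_measure L by fact
        have s: "C \<in> sets L" "B \<in> sets L" using AM[OF C(1)] B that(2) by auto
        have "measure L C \<le> measure L (B \<union> sym_diff C B)" "measure L B \<le> measure L (C \<union> sym_diff C B)"
          using s by (auto intro!: L.finite_measure_mono)
        moreover have "measure L (B \<union> sym_diff C B) \<le> measure L B + measure L (sym_diff C B)"
          "measure L (C \<union> sym_diff C B) \<le> measure L C + measure L (sym_diff C B)"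
          using s by (auto intro!: measure_Un_le)
        ultimately show ?thesis by linarith
      qed
      from this[OF fin(1)] this[OF fin(2)]
      have "\<bar>measure ?N1 C - measure ?N1 B\<bar> \<le> measure ?N1 (sym_diff C B)"
        "\<bar>measure ?N2 C - measure ?N2 B\<bar> \<le> measure ?N2 (sym_diff C B)" by simp_all
      then show ?thesis using close[OF C(1)] C(2,3) by linarith
    qed
    \<comment> \<open>Chosen to cancel \<open>g\<close>: its preimage under \<open>g\<close> is
      \<open>A\<close>, and its preimage under \<open>g \<otimes> h\<close> is the preimage of
      \<open>A\<close> under \<open>h\<close>.\<close>
    let ?B = "a (inv g) -` A \<inter> space M"
    have B: "?B \<in> sets M" using act_measurable'[OF inv_closed[OF gG]] A by (rule measurable_sets)
    have "a g -` ?B \<inter> space M = A"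
      using act_inv[OF gG] act_space[OF gG] sets.sets_into_space[OF A] by auto
    moreover have "a (inv g) (a (g \<otimes> h) x) = a h x" if "x \<in> space M" for x
      using act_mult[OF gG h(1) that] act_inv[OF gG act_space[OF h(1) that]] by simp
    then have "a (g \<otimes> h) -` ?B \<inter> space M = a h -` A \<inter> space M"
      using act_space[of "g \<otimes> h"] gG h(1) by auto
    ultimately show "\<bar>measure \<mu> (a h -` A \<inter> space M) - measure \<mu> A\<bar> \<le> e"
      using close'[OF B] N[OF B] by simp
  qed
qed

end


section \<open>Averaging over a compact group\<close>

text \<open>The measure is part of \<open>M\<close>, so a translate \<open>distr M M (a h)\<close>
  is another instance of the same locale and the two averages can be compared.\<close>

locale compact_action = prob_space M for M :: "'x measure" +
  fixes K :: "'g monoid" (structure) and d :: "'g \<Rightarrow> 'g \<Rightarrow> real" and m :: "'g measure" and a :: "'g \<Rightarrow> 'x \<Rightarrow> 'x"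
  assumes mmg: "measure_metric_group K d m"
    and mult_measurable: "(\<lambda>(x, y). x \<otimes> y) \<in> m \<Otimes>\<^sub>M m \<rightarrow>\<^sub>M m"
    and inv_measurable: "(\<lambda>x. inv x) \<in> m \<rightarrow>\<^sub>M m"
    and act_measurable: "(\<lambda>(g, x). a g x) \<in> m \<Otimes>\<^sub>M M \<rightarrow>\<^sub>M M"
    and act_one: "x \<in> space M \<Longrightarrow> a \<one> x = x"
    and act_mult: "g \<in> carrier K \<Longrightarrow> h \<in> carrier K \<Longrightarrow> x \<in> space M \<Longrightarrow> a (g \<otimes> h) x = a g (a h x)"
    and null: "k \<in> carrier K \<Longrightarrow> N \<in> sets M \<Longrightarrow> emeasure M (a k -` N \<inter> space M) = 0 \<Longrightarrow> emeasure M N = 0"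
begin

sublocale K: group K
  using mmg unfolding measure_metric_group_def topological_group_def by simp

sublocale d: Metric_space "carrier K" d
  using mmg unfolding measure_metric_group_def by simp

sublocale m: prob_space m
  using mmg unfolding measure_metric_group_def haar_probability_def by simp

sublocale P: pair_sigma_finite m M by unfold_locales

lemma space_m [simp]: "space m = carrier K"
proof -
  have "space m = space (borel_of d.mtopology)"
    using mmg unfolding measure_metric_group_def haar_probability_def by (intro sets_eq_imp_space_eq) simp
  then show ?thesis by simp
qed

lemma left_invariant: "g \<in> carrier K \<Longrightarrow> distr m m (\<lambda>x. g \<otimes> x) = m"
  using mmg unfolding measure_metric_group_def haar_probability_def by simp

lemma act_measurable_raw [measurable (raw)]:
  "g \<in> N \<rightarrow>\<^sub>M m \<Longrightarrow> h \<in> N \<rightarrow>\<^sub>M M \<Longrightarrow> (\<lambda>w. a (g w) (h w)) \<in> N \<rightarrow>\<^sub>M M"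
  using measurable_compose[OF measurable_Pair act_measurable, of g N h] by simp

lemma mult_measurable_raw [measurable (raw)]:
  "g \<in> N \<rightarrow>\<^sub>M m \<Longrightarrow> h \<in> N \<rightarrow>\<^sub>M m \<Longrightarrow> (\<lambda>w. g w \<otimes> h w) \<in> N \<rightarrow>\<^sub>M m"
  using measurable_compose[OF measurable_Pair mult_measurable, of g N h] by simp

lemma act_measurable': "g \<in> carrier K \<Longrightarrow> a g \<in> M \<rightarrow>\<^sub>M M"
  using measurable_Pair2[OF act_measurable, of g] by simp

lemma act_space: "g \<in> carrier K \<Longrightarrow> x \<in> space M \<Longrightarrow> a g x \<in> space M"
  using measurable_space[OF act_measurable'] .

lemma act_inv: "g \<in> carrier K \<Longrightarrow> x \<in> space M \<Longrightarrow> a (inv g) (a g x) = x"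
  "g \<in> carrier K \<Longrightarrow> x \<in> space M \<Longrightarrow> a g (a (inv g) x) = x"
  using act_mult[of "inv g" g x] act_mult[of g "inv g" x] act_one by simp_all

lemma haar_left: "F \<in> borel_measurable m \<Longrightarrow> g \<in> carrier K \<Longrightarrow> (\<integral>\<^sup>+x. F (g \<otimes> x) \<partial>m) = (\<integral>\<^sup>+x. F x \<partial>m)"
  using nn_integral_distr[of "\<lambda>x. g \<otimes> x" m m F] left_invariant[of g] by simp

lemmas haar_inv = haar_inverse_right_invariant(1)[OF K.group_axioms space_m m.prob_space_axioms
    mult_measurable inv_measurable left_invariant]
lemmas haar_right = haar_inverse_right_invariant(2)[OF K.group_axioms space_m m.prob_space_axioms
    mult_measurable inv_measurable left_invariant]

definition avg :: "'x measure" where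
  "avg = distr (m \<Otimes>\<^sub>M M) M (\<lambda>(k, x). a k x)"

lemma sets_avg [simp, measurable_cong]: "sets avg = sets M"
  and space_avg [simp]: "space avg = space M"
  unfolding avg_def by simp_all

sublocale avg: prob_space avg
proof -
  interpret Q: pair_prob_space m M by unfold_locales
  show "prob_space avg" unfolding avg_def by (rule Q.prob_space_distr[OF act_measurable])
qed

sublocale Pa: pair_sigma_finite m avg by unfold_locales

lemma nn_integral_avg:
  assumes [measurable]: "F \<in> borel_measurable M"
  shows "(\<integral>\<^sup>+x. F x \<partial>avg) = (\<integral>\<^sup>+k. \<integral>\<^sup>+x. F (a k x) \<partial>M \<partial>m)"
    and "(\<integral>\<^sup>+x. F x \<partial>avg) = (\<integral>\<^sup>+x. \<integral>\<^sup>+k. F (a k x) \<partial>m \<partial>M)"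
proof -
  have meas: "(\<lambda>(k, x). F (a k x)) \<in> borel_measurable (m \<Otimes>\<^sub>M M)" by measurable
  have "(\<integral>\<^sup>+x. F x \<partial>avg) = (\<integral>\<^sup>+p. F (case p of (k, x) \<Rightarrow> a k x) \<partial>(m \<Otimes>\<^sub>M M))"
    unfolding avg_def by (rule nn_integral_distr[OF act_measurable]) simp
  also have "\<dots> = (\<integral>\<^sup>+p. (case p of (k, x) \<Rightarrow> F (a k x)) \<partial>(m \<Otimes>\<^sub>M M))"
    by (simp add: case_prod_beta')
  finally have eq: "(\<integral>\<^sup>+x. F x \<partial>avg) = \<dots>" .
  show "(\<integral>\<^sup>+x. F x \<partial>avg) = (\<integral>\<^sup>+k. \<integral>\<^sup>+x. F (a k x) \<partial>M \<partial>m)"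
    unfolding eq using nn_integral_fst[OF meas] by simp
  show "(\<integral>\<^sup>+x. F x \<partial>avg) = (\<integral>\<^sup>+x. \<integral>\<^sup>+k. F (a k x) \<partial>m \<partial>M)"
    unfolding eq using P.nn_integral_snd[OF meas] by simp
qed

lemma avg_invariant:
  assumes k: "k \<in> carrier K" and F [measurable]: "F \<in> borel_measurable M"
  shows "(\<integral>\<^sup>+x. F (a k x) \<partial>avg) = (\<integral>\<^sup>+x. F x \<partial>avg)"
proof -
  have Fk: "(\<lambda>x. F (a k x)) \<in> borel_measurable M"
    using measurable_compose[OF act_measurable'[OF k] F] .
  have "(\<integral>\<^sup>+x. F (a k x) \<partial>avg) = (\<integral>\<^sup>+x. \<integral>\<^sup>+l. F (a k (a l x)) \<partial>m \<partial>M)"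
    by (rule nn_integral_avg(2)[OF Fk])
  also have "\<dots> = (\<integral>\<^sup>+x. \<integral>\<^sup>+l. F (a l x) \<partial>m \<partial>M)"
  proof (rule nn_integral_cong)
    fix x assume x: "x \<in> space M"
    have Fx: "(\<lambda>l. F (a l x)) \<in> borel_measurable m" using x by measurable
    have "(\<integral>\<^sup>+l. F (a k (a l x)) \<partial>m) = (\<integral>\<^sup>+l. F (a (k \<otimes> l) x) \<partial>m)"
      by (rule nn_integral_cong) (use act_mult k x in simp)
    also have "\<dots> = (\<integral>\<^sup>+l. F (a l x) \<partial>m)" by (rule haar_left[OF Fx k])
    finally show "(\<integral>\<^sup>+l. F (a k (a l x)) \<partial>m) = (\<integral>\<^sup>+l. F (a l x) \<partial>m)" .
  qed
  also have "\<dots> = (\<integral>\<^sup>+x. F x \<partial>avg)" by (rule nn_integral_avg(2)[symmetric]) fact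
  finally show ?thesis .
qed

lemma distr_avg: 
  assumes k: "k \<in> carrier K" shows "distr avg avg (a k) = avg"
proof (rule measure_eqI)
  fix A assume "A \<in> sets (distr avg avg (a k))"
  then have A: "A \<in> sets M" by simp
  have "emeasure (distr avg avg (a k)) A = (\<integral>\<^sup>+x. indicator A (a k x) \<partial>avg)"
    using A act_measurable'[OF k] by (subst nn_integral_distr[of _ _ avg, symmetric]) auto
  also have "\<dots> = emeasure avg A"
    using A by (subst avg_invariant[OF k]) auto
  finally show "emeasure (distr avg avg (a k)) A = emeasure avg A" .
qed simp

lemma distr_pair_avg: "distr (m \<Otimes>\<^sub>M avg) avg (\<lambda>(k, x). a k x) = avg"
proof (rule measure_eqI)
  fix A assume "A \<in> sets (distr (m \<Otimes>\<^sub>M avg) avg (\<lambda>(k, x). a k x))"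
  then have A [measurable]: "A \<in> sets M" by simp
  have "emeasure (distr (m \<Otimes>\<^sub>M avg) avg (\<lambda>(k, x). a k x)) A
      = (\<integral>\<^sup>+y. indicator A y \<partial>(distr (m \<Otimes>\<^sub>M avg) avg (\<lambda>(k, x). a k x)))"
    by simp
  also have "\<dots> = (\<integral>\<^sup>+p. indicator A (case p of (k, x) \<Rightarrow> a k x) \<partial>(m \<Otimes>\<^sub>M avg))"
    by (rule nn_integral_distr) measurable
  also have "\<dots> = (\<integral>\<^sup>+k. \<integral>\<^sup>+x. indicator A (a k x) \<partial>avg \<partial>m)"
    by (subst avg.nn_integral_fst[symmetric]) simp_all
  also have "\<dots> = (\<integral>\<^sup>+k. emeasure avg A \<partial>m)"
    by (rule nn_integral_cong) (subst avg_invariant, simp_all)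
  also have "\<dots> = emeasure avg A" using m.emeasure_space_1 by simp
  finally show "emeasure (distr (m \<Otimes>\<^sub>M avg) avg (\<lambda>(k, x). a k x)) A = emeasure avg A" .
qed simp

text \<open>\<open>avg\<close> is invariant, so replacing a function by its Haar averages along
  orbits does not change its integral.\<close>

lemma integral_avg_orbits:
  fixes F :: "'x \<Rightarrow> real"
  assumes "integrable avg F"
  shows "integrable avg (\<lambda>x. LINT k|m. F (a k x))"
    and "(LINT x|avg. (LINT k|m. F (a k x))) = (LINT x|avg. F x)"
proof -
  have am: "(\<lambda>(k, x). a k x) \<in> m \<Otimes>\<^sub>M avg \<rightarrow>\<^sub>M avg" by measurable
  have F: "F \<in> borel_measurable avg" using assms by simp
  have "integrable (distr (m \<Otimes>\<^sub>M avg) avg (\<lambda>(k, x). a k x)) F" unfolding distr_pair_avg by fact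
  then have int: "integrable (m \<Otimes>\<^sub>M avg) (\<lambda>(k, x). F (a k x))"
    using integrable_distr_eq[OF am F] by (simp add: case_prod_beta')
  show "integrable avg (\<lambda>x. LINT k|m. F (a k x))" by (rule Pa.integrable_snd[OF int])
  have "(LINT x|avg. (LINT k|m. F (a k x))) = (LINT p|(m \<Otimes>\<^sub>M avg). (case p of (k, x) \<Rightarrow> F (a k x)))"
    by (rule Pa.integral_snd[OF int])
  also have "\<dots> = (LINT p|(m \<Otimes>\<^sub>M avg). F (case p of (k, x) \<Rightarrow> a k x))"
    by (simp add: case_prod_beta')
  also have "\<dots> = (LINT x|distr (m \<Otimes>\<^sub>M avg) avg (\<lambda>(k, x). a k x). F x)"
    by (rule integral_distr[OF am F, symmetric])
  finally show "(LINT x|avg. (LINT k|m. F (a k x))) = (LINT x|avg. F x)" unfolding distr_pair_avg .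
qed

text \<open>If the average gives \<open>N\<close> measure 0, almost every \<open>k\<close>, hence
  some \<open>k\<close>, has a null preimage of \<open>N\<close>, and quasi-invariance transfers
  this to \<open>N\<close>.\<close>

lemma absolutely_continuous_avg: "absolutely_continuous avg M"
  unfolding absolutely_continuous_def
proof
  fix N assume "N \<in> null_sets avg"
  then have N [measurable]: "N \<in> sets M" and z: "emeasure avg N = 0" by auto
  have "(\<integral>\<^sup>+k. \<integral>\<^sup>+x. indicator N (a k x) \<partial>M \<partial>m) = 0"
    using nn_integral_avg(1)[of "indicator N"] z by simp
  then have ae: "AE k in m. (\<integral>\<^sup>+x. indicator N (a k x) \<partial>M) = 0"
    by (subst (asm) nn_integral_0_iff_AE) auto
  have "\<exists>k. (\<integral>\<^sup>+x. indicator N (a k x) \<partial>M) = 0 \<and> k \<in> space m"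
    by (rule eventually_happens'[OF m.ae_filter_bot eventually_conj[OF ae AE_space]])
  then obtain k where k: "k \<in> carrier K" "(\<integral>\<^sup>+x. indicator N (a k x) \<partial>M) = 0"
    by (elim exE conjE) simp
  have "emeasure M (a k -` N \<inter> space M) = (\<integral>\<^sup>+x. indicator N (a k x) \<partial>M)"
  proof -
    have "a k -` N \<inter> space M \<in> sets M" using act_measurable'[OF k(1)] N by (rule measurable_sets)
    then have "emeasure M (a k -` N \<inter> space M) = (\<integral>\<^sup>+x. indicator (a k -` N \<inter> space M) x \<partial>M)" by simp
    also have "\<dots> = (\<integral>\<^sup>+x. indicator N (a k x) \<partial>M)"
      by (rule nn_integral_cong) (simp add: indicator_def)
    finally show ?thesis .
  qed
  then have "emeasure M N = 0" using null[OF k(1) N] k(2) by simp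
  then show "N \<in> null_sets M" using N by (intro null_setsI)
qed

end

section \<open>Densities along orbits and the bound by the Wasserstein modulus\<close>

context compact_action
begin

text \<open>A single version of the derivative of \<open>M\<close> with respect to
  \<open>avg\<close>, real and nonnegative at every point, so that its restriction to each
  individual orbit makes sense.\<close>

definition dens :: "'x \<Rightarrow> real" where
  "dens = (SOME f. f \<in> borel_measurable avg \<and> (\<forall>x. 0 \<le> f x) \<and> density avg (\<lambda>x. ennreal (f x)) = M \<and>
    integrable avg f \<and> (\<forall>A\<in>sets avg. measure M A = (LINT x|avg. indicator A x * f x)))"

lemma dens_props:
  "dens \<in> borel_measurable avg \<and> (\<forall>x. 0 \<le> dens x) \<and> density avg (\<lambda>x. ennreal (dens x)) = M \<and>
    integrable avg dens \<and> (\<forall>A\<in>sets avg. measure M A = (LINT x|avg. indicator A x * dens x))"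
proof -
  obtain f :: "'x \<Rightarrow> real" where f: "f \<in> borel_measurable avg" "\<And>x. 0 \<le> f x" "M = density avg (\<lambda>x. ennreal (f x))"
    "integrable avg f" "\<And>A. A \<in> sets avg \<Longrightarrow> measure M A = (LINT x|avg. indicator A x * f x)"
    by (rule real_density[OF avg.finite_measure_axioms finite_measure_axioms absolutely_continuous_avg sets_avg[symmetric]])
      (rule that)
  have "\<exists>f. f \<in> borel_measurable avg \<and> (\<forall>x. 0 \<le> f x) \<and> density avg (\<lambda>x. ennreal (f x)) = M \<and>
      integrable avg f \<and> (\<forall>A\<in>sets avg. measure M A = (LINT x|avg. indicator A x * f x))"
    by (intro exI[of _ f] conjI allI ballI f f(3)[symmetric])
  then show ?thesis unfolding dens_def by (rule someI_ex)
qed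

lemma dens_measurable [measurable]: "dens \<in> borel_measurable M"
  and dens_nonneg: "0 \<le> dens x"
  and density_dens: "density avg (\<lambda>x. ennreal (dens x)) = M"
  and dens_integrable: "integrable avg dens"
  and measure_dens: "A \<in> sets M \<Longrightarrow> measure M A = (LINT x|avg. indicator A x * dens x)"
  using dens_props measurable_cong_sets[OF sets_avg refl] by auto

definition orbit_mass :: "'x \<Rightarrow> ennreal" where
  "orbit_mass x = (\<integral>\<^sup>+k. ennreal (dens (a k x)) \<partial>m)"

lemma orbit_mass_measurable [measurable]: "orbit_mass \<in> borel_measurable M"
  unfolding orbit_mass_def by measurable

text \<open>\<open>orbit_mass\<close> is a density of \<open>avg\<close> with respect to itself.
  Integrated over \<open>B\<close>, the substitution of \<open>a (inv k) x\<close> for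
  \<open>x\<close> moves the group element from \<open>dens\<close> to \<open>B\<close> and turns
  \<open>avg\<close> into \<open>M\<close>; inversion invariance of Haar measure then gives the
  average measure of \<open>B\<close>.\<close>

lemma orbit_mass_AE: "AE x in avg. orbit_mass x = 1"
proof -
  have "density avg orbit_mass = density avg (\<lambda>_. 1)"
  proof (rule measure_eqI)
    fix B assume "B \<in> sets (density avg orbit_mass)"
    then have B [measurable]: "B \<in> sets M" by simp
    have "emeasure (density avg orbit_mass) B = (\<integral>\<^sup>+x. orbit_mass x * indicator B x \<partial>avg)"
      by (subst emeasure_density) auto
    also have "\<dots> = (\<integral>\<^sup>+x. \<integral>\<^sup>+k. ennreal (dens (a k x)) * indicator B x \<partial>m \<partial>avg)"
      unfolding orbit_mass_def by (intro nn_integral_cong nn_integral_multc[symmetric]) simp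
    also have "\<dots> = (\<integral>\<^sup>+k. \<integral>\<^sup>+x. ennreal (dens (a k x)) * indicator B x \<partial>avg \<partial>m)"
      by (rule Pa.Fubini') measurable
    also have "\<dots> = (\<integral>\<^sup>+k. \<integral>\<^sup>+x. indicator B (a (inv k) x) \<partial>M \<partial>m)"
    proof (rule nn_integral_cong)
      fix k assume "k \<in> space m"
      then have k: "k \<in> carrier K" by simp
      note act_measurable'[OF k, measurable] act_measurable'[OF K.inv_closed[OF k], measurable]
      have "(\<integral>\<^sup>+x. ennreal (dens (a k x)) * indicator B x \<partial>avg)
          = (\<integral>\<^sup>+x. ennreal (dens (a k x)) * indicator B (a (inv k) (a k x)) \<partial>avg)"
        by (rule nn_integral_cong) (simp add: act_inv(1) k)
      also have "\<dots> = (\<integral>\<^sup>+x. ennreal (dens x) * indicator B (a (inv k) x) \<partial>avg)"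
        by (rule avg_invariant[OF k]) measurable
      also have "\<dots> = (\<integral>\<^sup>+x. indicator B (a (inv k) x) \<partial>density avg (\<lambda>x. ennreal (dens x)))"
        by (rule nn_integral_density[symmetric]) measurable
      finally show "(\<integral>\<^sup>+x. ennreal (dens (a k x)) * indicator B x \<partial>avg)
          = (\<integral>\<^sup>+x. indicator B (a (inv k) x) \<partial>M)" unfolding density_dens .
    qed
    also have "\<dots> = (\<integral>\<^sup>+k. \<integral>\<^sup>+x. indicator B (a k x) \<partial>M \<partial>m)"
      by (rule haar_inv) measurable
    also have "\<dots> = emeasure avg B"
      using nn_integral_avg(1)[of "indicator B"] by simp
    also have "\<dots> = emeasure (density avg (\<lambda>_. 1)) B"
      by (simp add: density_1)
    finally show "emeasure (density avg orbit_mass) B = emeasure (density avg (\<lambda>_. 1)) B" .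
  qed simp
  then show ?thesis
    by (intro avg.density_unique) simp_all
qed

text \<open>On the null set where the orbit function has mass other than 1 it is replaced by the
  density of Haar measure, since a kernel must consist of densities at every point.\<close>

definition orbit_density :: "'x \<Rightarrow> 'g \<Rightarrow> real" where
  "orbit_density x k = (if orbit_mass x = 1 then dens (a k x) else 1)"

lemma orbit_density_measurable [measurable]:
  "(\<lambda>(x, k). orbit_density x k) \<in> borel_measurable (M \<Otimes>\<^sub>M m)"
  unfolding orbit_density_def by measurable

lemma orbit_density_nonneg: "0 \<le> orbit_density x k"
  unfolding orbit_density_def by (simp add: dens_nonneg)

lemma orbit_density_measurable' [measurable]: "x \<in> space M \<Longrightarrow> orbit_density x \<in> borel_measurable m"
  using measurable_Pair2[OF orbit_density_measurable, of x] by simp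

lemma orbit_density_densities: "x \<in> space M \<Longrightarrow> orbit_density x \<in> densities m"
proof -
  assume x: "x \<in> space M"
  have [measurable]: "orbit_density x \<in> borel_measurable m" using x by (rule orbit_density_measurable')
  have nn: "(\<integral>\<^sup>+k. ennreal (orbit_density x k) \<partial>m) = 1"
    unfolding orbit_density_def orbit_mass_def using m.emeasure_space_1
    by (cases "(\<integral>\<^sup>+k. ennreal (dens (a k x)) \<partial>m) = 1") simp_all
  have "integrable m (orbit_density x)"
    by (rule integrableI_nonneg) (use nn orbit_density_nonneg in auto)
  moreover have "(LINT k|m. orbit_density x k) = 1"
    using nn orbit_density_nonneg by (subst integral_eq_nn_integral) auto
  ultimately show ?thesis unfolding densities_def using orbit_density_nonneg by simp
qed

text \<open>\<open>dens (a (inv h) x)\<close> is the density with respect to \<open>avg\<close> of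
  the translate of \<open>M\<close> by \<open>h\<close>. The \<open>L\<^sup>1\<close> distance of
  two densities is computed on the set \<open>A\<close> where one dominates the other and on its
  complement; each contributes at most \<open>\<epsilon>\<close>.\<close>

lemma dens_variation:
  assumes h: "h \<in> carrier K"
    and close: "\<And>A. A \<in> sets M \<Longrightarrow> \<bar>measure M (a h -` A \<inter> space M) - measure M A\<bar> \<le> \<epsilon>"
  shows "(\<integral>\<^sup>+x. ennreal \<bar>dens (a (inv h) x) - dens x\<bar> \<partial>avg) \<le> ennreal (2 * \<epsilon>)"
proof -
  let ?p = "\<lambda>x. dens (a (inv h) x)"
  note ah [measurable] = act_measurable'[OF h] and aih [measurable] = act_measurable'[OF K.inv_closed[OF h]]
  have pi: "integrable avg ?p"
  proof -
    have "integrable (distr avg avg (a (inv h))) dens"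
      unfolding distr_avg[OF K.inv_closed[OF h]] by (rule dens_integrable)
    then show ?thesis by (subst (asm) integrable_distr_eq) simp_all
  qed
  have translate: "(LINT x|avg. indicator A x * ?p x) = measure M (a h -` A \<inter> space M)" if A [measurable]: "A \<in> sets M" for A
  proof -
    have "(LINT x|avg. indicator A x * ?p x) = (LINT x|distr avg avg (a h). indicator A x * ?p x)"
      unfolding distr_avg[OF h] ..
    also have "\<dots> = (LINT x|avg. indicator A (a h x) * ?p (a h x))"
      by (rule integral_distr) measurable
    also have "\<dots> = (LINT x|avg. indicator (a h -` A \<inter> space M) x * dens x)"
      by (rule Bochner_Integration.integral_cong) (simp_all add: act_inv(1) h indicator_def)
    also have "\<dots> = measure M (a h -` A \<inter> space M)"
      by (rule measure_dens[symmetric]) measurable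
    finally show ?thesis .
  qed
  define A where "A = {x \<in> space M. dens x \<le> ?p x}"
  define A' where "A' = space M - A"
  have [measurable]: "A \<in> sets M" unfolding A_def by measurable
  have [measurable]: "A' \<in> sets M" unfolding A'_def by measurable
  have i: "integrable avg (\<lambda>x. indicator B x * ?p x)" "integrable avg (\<lambda>x. indicator B x * dens x)"
    if "B \<in> sets M" for B
    using integrable_mult_indicator[of B avg ?p] integrable_mult_indicator[of B avg dens] that pi dens_integrable
    by simp_all
  have "(LINT x|avg. \<bar>?p x - dens x\<bar>) = (LINT x|avg. (indicator A x * ?p x - indicator A x * dens x) +
      (indicator A' x * dens x - indicator A' x * ?p x))"
    by (rule Bochner_Integration.integral_cong) (auto simp: A_def A'_def indicator_def)
  also have "\<dots> = (measure M (a h -` A \<inter> space M) - measure M A) + (measure M A' - measure M (a h -` A' \<inter> space M))"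
    using i[of A] i[of A'] translate[of A] translate[of A'] measure_dens[of A] measure_dens[of A'] by simp
  also have "\<dots> \<le> 2 * \<epsilon>"
    using close[of A] close[of A'] by simp
  finally have "(LINT x|avg. \<bar>?p x - dens x\<bar>) \<le> 2 * \<epsilon>" .
  moreover have "(\<integral>\<^sup>+x. ennreal \<bar>?p x - dens x\<bar> \<partial>avg) = ennreal (LINT x|avg. \<bar>?p x - dens x\<bar>)"
    using pi dens_integrable by (intro nn_integral_eq_integral) auto
  ultimately show ?thesis by (simp add: ennreal_leI)
qed

lemma orbit_density_variation_measurable [measurable]:
  assumes "h \<in> carrier K"
  shows "(\<lambda>x. variation_dist m (translate K h (orbit_density x)) (orbit_density x)) \<in> borel_measurable M"
proof -
  have [measurable]: "(\<lambda>k. inv h \<otimes> k) \<in> m \<rightarrow>\<^sub>M m"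
    using measurable_Pair2[OF mult_measurable, of "inv h"] assms by simp
  show ?thesis unfolding variation_dist_def translate_def by measurable
qed

text \<open>Translating the orbit density by \<open>h\<close> evaluates \<open>dens\<close> at
  \<open>a (inv h) (a k x)\<close>, so the integrand depends on \<open>a k x\<close> only. Fubini
  and invariance of \<open>avg\<close> then remove the integral over \<open>k\<close>, and the half
  in \<open>variation_dist\<close> cancels the factor 2 of \<open>dens_variation\<close>.\<close>

lemma orbit_density_variation:
  assumes h: "h \<in> carrier K"
    and close: "\<And>A. A \<in> sets M \<Longrightarrow> \<bar>measure M (a h -` A \<inter> space M) - measure M A\<bar> \<le> \<epsilon>"
  shows "(\<integral>\<^sup>+x. variation_dist m (translate K h (orbit_density x)) (orbit_density x) \<partial>avg) \<le> ennreal \<epsilon>"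
proof -
  let ?D = "\<lambda>x. ennreal \<bar>dens (a (inv h) x) - dens x\<bar>"
  have ih: "inv h \<in> carrier K" using h by simp
  note aih [measurable] = act_measurable'[OF ih]
  have eps: "0 \<le> \<epsilon>" using close[of "{}"] by simp
  have pt: "variation_dist m (translate K h (orbit_density x)) (orbit_density x) = (\<integral>\<^sup>+k. ?D (a k x) \<partial>m) / 2"
    if "x \<in> space M" "orbit_mass x = 1" for x
    unfolding variation_dist_def translate_def orbit_density_def using that ih
    by (intro arg_cong[where f = "\<lambda>t. t / 2"] nn_integral_cong) (simp add: act_mult)
  have "(\<integral>\<^sup>+x. variation_dist m (translate K h (orbit_density x)) (orbit_density x) \<partial>avg)
      = (\<integral>\<^sup>+x. (\<integral>\<^sup>+k. ?D (a k x) \<partial>m) / 2 \<partial>avg)"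
  proof (rule nn_integral_cong_AE)
    show "AE x in avg. variation_dist m (translate K h (orbit_density x)) (orbit_density x)
        = (\<integral>\<^sup>+k. ?D (a k x) \<partial>m) / 2"
      using orbit_mass_AE AE_space[of avg] by eventually_elim (use pt in simp)
  qed
  also have "\<dots> = (\<integral>\<^sup>+x. \<integral>\<^sup>+k. ?D (a k x) \<partial>m \<partial>avg) / 2"
    by (rule nn_integral_divide) measurable
  also have "(\<integral>\<^sup>+x. \<integral>\<^sup>+k. ?D (a k x) \<partial>m \<partial>avg) = (\<integral>\<^sup>+k. \<integral>\<^sup>+x. ?D (a k x) \<partial>avg \<partial>m)"
    by (rule Pa.Fubini') measurable
  also have "\<dots> = (\<integral>\<^sup>+k. \<integral>\<^sup>+x. ?D x \<partial>avg \<partial>m)"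
    by (rule nn_integral_cong) (subst avg_invariant[where F = "?D"], simp_all)
  also have "\<dots> = (\<integral>\<^sup>+x. ?D x \<partial>avg)" using m.emeasure_space_1 by simp
  also have "\<dots> / 2 \<le> ennreal (2 * \<epsilon>) / 2"
    by (rule divide_right_mono_ennreal) (rule dens_variation[OF h close])
  also have "\<dots> = ennreal \<epsilon>" using eps by (simp add: divide_ennreal[symmetric] ennreal_divide_numeral)
  finally show ?thesis .
qed

text \<open>\<open>k \<mapsto> u (a k x)\<close> is a test function of the Wasserstein distance:
  moving from \<open>a l x\<close> to \<open>a k x\<close> takes the element
  \<open>k \<otimes> inv l\<close>, whose distance from the identity is \<open>d l k\<close> by
  right invariance.\<close>

lemma orbit_discrepancy:
  assumes u [measurable]: "u \<in> borel_measurable M" and bnd: "\<And>x. x \<in> space M \<Longrightarrow> \<bar>u x\<bar> \<le> 1"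
    and lip: "\<And>k x. k \<in> carrier K \<Longrightarrow> x \<in> space M \<Longrightarrow> \<bar>u (a k x) - u x\<bar> \<le> d \<one> k"
    and x: "x \<in> space M"
  shows "ennreal \<bar>(LINT k|m. orbit_density x k * u (a k x)) - (LINT k|m. u (a k x))\<bar>
    \<le> wasserstein_dist (carrier K) d (density m (\<lambda>k. ennreal (orbit_density x k))) m"
proof -
  let ?f = "\<lambda>k. u (a k x)"
  have right_inv: "\<forall>x\<in>carrier K. \<forall>y\<in>carrier K. \<forall>g\<in>carrier K. d (x \<otimes> g) (y \<otimes> g) = d x y"
    using mmg unfolding measure_metric_group_def right_invariant_def by (elim conjE)
  have "\<bar>?f k - ?f l\<bar> \<le> d k l" if kl: "k \<in> carrier K" "l \<in> carrier K" for k l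
  proof -
    have "a (k \<otimes> inv l) (a l x) = a k x"
      using kl x act_mult[of "k \<otimes> inv l" l x] by (simp add: K.m_assoc)
    then have "\<bar>?f k - ?f l\<bar> \<le> d \<one> (k \<otimes> inv l)"
      using lip[of "k \<otimes> inv l" "a l x"] kl act_space[OF kl(2) x] by simp
    also have "\<dots> = d l k"
      using right_inv[rule_format, of l k "inv l"] kl by simp
    finally show ?thesis by (simp add: d.commute)
  qed
  then have "ennreal \<bar>(LINT k|density m (\<lambda>k. ennreal (orbit_density x k)). ?f k) - (LINT k|m. ?f k)\<bar>
    \<le> wasserstein_dist (carrier K) d (density m (\<lambda>k. ennreal (orbit_density x k))) m"
    unfolding wasserstein_dist_def by (intro SUP_upper) simp
  moreover have "(LINT k|density m (\<lambda>k. ennreal (orbit_density x k)). ?f k) = (LINT k|m. orbit_density x k *\<^sub>R ?f k)"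
    using x orbit_density_nonneg by (intro integral_density) auto
  ultimately show ?thesis by simp
qed

text \<open>
  The modulus only sees kernels indexed by real numbers. The injection \<open>e\<close> carries the kernel there; it
  need not be measurable, since the \<open>\<sigma>\<close>-algebra is carried along with it.
\<close>

theorem wasserstein_modulus_bound:
  fixes e :: "'x \<Rightarrow> real"
  assumes u [measurable]: "u \<in> borel_measurable M" and bnd: "\<And>x. x \<in> space M \<Longrightarrow> \<bar>u x\<bar> \<le> 1"
    and lip: "\<And>k x. k \<in> carrier K \<Longrightarrow> x \<in> space M \<Longrightarrow> \<bar>u (a k x) - u x\<bar> \<le> d \<one> k"
    and close: "\<And>h A. h \<in> group_ball K d r \<Longrightarrow> A \<in> sets M \<Longrightarrow>
      \<bar>measure M (a h -` A \<inter> space M) - measure M A\<bar> \<le> \<epsilon>"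
    and inj: "inj_on e (space M)"
  shows "ennreal \<bar>(LINT x|M. u x) - (LINT x|avg. u x)\<bar> \<le> wasserstein_modulus K d m r \<epsilon>"
proof -
  have inj': "inj_on e (space avg)" using inj by simp
  define \<zeta> where "\<zeta> = embed_measure avg e"
  define e' where "e' = the_inv_into (space M) e"
  define \<Phi> where "\<Phi> z = orbit_density (e' z)" for z
  have e'e: "e' (e x) = x" if "x \<in> space M" for x
    unfolding e'_def using inj that by (rule the_inv_into_f_f)
  have e_meas: "e \<in> avg \<rightarrow>\<^sub>M \<zeta>" unfolding \<zeta>_def by (rule measurable_embed_measure2'[OF inj'])
  have e'_meas [measurable]: "e' \<in> \<zeta> \<rightarrow>\<^sub>M M"
    unfolding \<zeta>_def
  proof (rule measurable_embed_measure1)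
    have "(\<lambda>x. x) \<in> avg \<rightarrow>\<^sub>M M" by (simp add: measurable_ident_sets)
    then show "(\<lambda>x. e' (e x)) \<in> avg \<rightarrow>\<^sub>M M"
      by (rule measurable_cong[THEN iffD1, rotated]) (simp add: e'e)
  qed
  have \<zeta>: "\<zeta> = distr avg \<zeta> e" unfolding \<zeta>_def by (rule embed_measure_eq_distr'[OF inj'])
  interpret Z: prob_space \<zeta>
    by (subst \<zeta>) (rule avg.prob_space_distr[OF e_meas])
  have nn_\<zeta>: "(\<integral>\<^sup>+z. H (e' z) \<partial>\<zeta>) = (\<integral>\<^sup>+x. H x \<partial>avg)" if H [measurable]: "H \<in> borel_measurable M" for H :: "'x \<Rightarrow> ennreal"
  proof -
    have "(\<integral>\<^sup>+z. H (e' z) \<partial>\<zeta>) = (\<integral>\<^sup>+x. H (e' (e x)) \<partial>avg)"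
      by (subst \<zeta>, rule nn_integral_distr[OF e_meas]) measurable
    also have "\<dots> = (\<integral>\<^sup>+x. H x \<partial>avg)" by (rule nn_integral_cong) (simp add: e'e)
    finally show ?thesis .
  qed
  have e'_space: "e' z \<in> space M" if "z \<in> space \<zeta>" for z using measurable_space[OF e'_meas that] .
  have kernel: "density_kernel m \<zeta> \<Phi>"
    unfolding density_kernel_def
  proof (intro conjI ballI)
    show "prob_space \<zeta>" by (rule Z.prob_space_axioms)
    have "(\<lambda>p. (e' (fst p), snd p)) \<in> \<zeta> \<Otimes>\<^sub>M m \<rightarrow>\<^sub>M M \<Otimes>\<^sub>M m" by measurable
    from measurable_compose[OF this orbit_density_measurable]
    show "(\<lambda>(z, g). \<Phi> z g) \<in> borel_measurable (\<zeta> \<Otimes>\<^sub>M m)"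
      unfolding \<Phi>_def by (simp add: case_prod_beta')
    show "\<Phi> z \<in> densities m" if "z \<in> space \<zeta>" for z
      unfolding \<Phi>_def by (rule orbit_density_densities[OF e'_space[OF that]])
  qed
  have var: "kernel_variation K d m \<zeta> \<Phi> r \<le> ennreal \<epsilon>"
    unfolding kernel_variation_def
  proof (rule SUP_least)
    fix h assume h: "h \<in> group_ball K d r"
    then have hK: "h \<in> carrier K" unfolding group_ball_def by simp
    have "(\<integral>\<^sup>+z. variation_dist m (translate K h (\<Phi> z)) (\<Phi> z) \<partial>\<zeta>)
        = (\<integral>\<^sup>+x. variation_dist m (translate K h (orbit_density x)) (orbit_density x) \<partial>avg)"
      unfolding \<Phi>_def by (rule nn_\<zeta>) (rule orbit_density_variation_measurable[OF hK])
    also have "\<dots> \<le> ennreal \<epsilon>"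
      using close[OF h] by (rule orbit_density_variation[OF hK])
    finally show "(\<integral>\<^sup>+z. variation_dist m (translate K h (\<Phi> z)) (\<Phi> z) \<partial>\<zeta>) \<le> ennreal \<epsilon>" .
  qed
  have "kernel_wasserstein K d m \<zeta> \<Phi> \<le> wasserstein_modulus K d m r \<epsilon>"
    unfolding wasserstein_modulus_def by (rule SUP_upper2[of "(\<zeta>, \<Phi>)"]) (use kernel var in auto)
  moreover
  define I where "I x = (LINT k|m. orbit_density x k * u (a k x)) - (LINT k|m. u (a k x))" for x
  have I_meas [measurable]: "I \<in> borel_measurable M" unfolding I_def by measurable
  have "(\<integral>\<^sup>+x. ennreal \<bar>I x\<bar> \<partial>avg) \<le> kernel_wasserstein K d m \<zeta> \<Phi>"
  proof -
    have "(\<integral>\<^sup>+x. ennreal \<bar>I x\<bar> \<partial>avg) = (\<integral>\<^sup>+z. ennreal \<bar>I (e' z)\<bar> \<partial>\<zeta>)"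
      by (rule nn_\<zeta>[symmetric]) measurable
    also have "\<dots> \<le> kernel_wasserstein K d m \<zeta> \<Phi>"
      unfolding kernel_wasserstein_def \<Phi>_def I_def
      by (rule nn_integral_mono) (rule orbit_discrepancy[OF u bnd lip e'_space])
    finally show ?thesis .
  qed
  moreover have "ennreal \<bar>(LINT x|M. u x) - (LINT x|avg. u x)\<bar> \<le> (\<integral>\<^sup>+x. ennreal \<bar>I x\<bar> \<partial>avg)"
  proof -
    have ui: "integrable avg u"
      by (rule avg.integrable_const_bound[of _ 1]) (use bnd in auto)
    have ufi: "integrable avg (\<lambda>x. dens x * u x)"
    proof (rule Bochner_Integration.integrable_bound[OF dens_integrable])
      show "AE x in avg. norm (dens x * u x) \<le> norm (dens x)"
        using bnd by (intro AE_I2) (auto simp: abs_mult intro: mult_left_le)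
    qed measurable
    \<comment> \<open>Both integrals are averaged along orbits: that of \<open>u\<close> against
      \<open>M\<close> is the \<open>avg\<close>-integral of \<open>dens x * u x\<close>. The
      difference of the two orbit averages is \<open>I\<close>, up to the null set on which
      \<open>orbit_density\<close> has its default value.\<close>
    note o1 = integral_avg_orbits[OF ui] and o2 = integral_avg_orbits[OF ufi]
    have AE_I: "AE x in avg. (LINT k|m. dens (a k x) * u (a k x)) - (LINT k|m. u (a k x)) = I x"
      using orbit_mass_AE by eventually_elim (simp add: I_def orbit_density_def)
    have "(LINT x|M. u x) = (LINT x|density avg (\<lambda>x. ennreal (dens x)). u x)" unfolding density_dens ..
    also have "\<dots> = (LINT x|avg. dens x * u x)"
      using dens_nonneg by (subst integral_density) auto
    finally have "(LINT x|M. u x) - (LINT x|avg. u x)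
        = (LINT x|avg. (LINT k|m. dens (a k x) * u (a k x)) - (LINT k|m. u (a k x)))"
      using o1 o2 by simp
    also have "\<dots> = (LINT x|avg. I x)"
      by (rule integral_cong_AE[OF _ _ AE_I]) measurable
    finally have eq: "(LINT x|M. u x) - (LINT x|avg. u x) = (LINT x|avg. I x)" .
    have Ii: "integrable avg I"
      by (rule integrable_cong_AE_imp[OF Bochner_Integration.integrable_diff[OF o2(1) o1(1)]])
        (use AE_I in \<open>auto elim: eventually_mono\<close>)
    have "ennreal \<bar>LINT x|avg. I x\<bar> \<le> ennreal (LINT x|avg. \<bar>I x\<bar>)"
      by (intro ennreal_leI integral_abs_bound)
    also have "\<dots> = (\<integral>\<^sup>+x. ennreal \<bar>I x\<bar> \<partial>avg)"
      using Ii by (intro nn_integral_eq_integral[symmetric]) auto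
    finally show ?thesis unfolding eq .
  qed
  ultimately show ?thesis by (meson order_trans)
qed

end


section \<open>Wasserstein groups\<close>

lemma topological_group_measurable:
  fixes K (structure)
  assumes "topological_group K T" "second_countable T"
  shows "(\<lambda>(x, y). x \<otimes> y) \<in> borel_of T \<Otimes>\<^sub>M borel_of T \<rightarrow>\<^sub>M borel_of T"
    and "(\<lambda>x. inv x) \<in> borel_of T \<rightarrow>\<^sub>M borel_of T"
proof -
  have cont: "continuous_map (prod_topology T T) T (\<lambda>(x, y). x \<otimes> y)" "continuous_map T T (\<lambda>x. inv x)"
    using assms(1) unfolding topological_group_def by simp_all
  note m = measurable_borel_of_continuous[OF cont(1)]
  show "(\<lambda>(x, y). x \<otimes> y) \<in> borel_of T \<Otimes>\<^sub>M borel_of T \<rightarrow>\<^sub>M borel_of T"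
  proof (rule measurableI)
    fix z assume "z \<in> space (borel_of T \<Otimes>\<^sub>M borel_of T)"
    then show "(case z of (x, y) \<Rightarrow> x \<otimes> y) \<in> space (borel_of T)"
      using measurable_space[OF m, of z] by (simp add: space_pair_measure)
  next
    fix A assume "A \<in> sets (borel_of T)"
    then have "(\<lambda>(x, y). x \<otimes> y) -` A \<inter> space (borel_of (prod_topology T T)) \<in> sets (borel_of (prod_topology T T))"
      by (rule measurable_sets[OF m])
    then show "(\<lambda>(x, y). x \<otimes> y) -` A \<inter> space (borel_of T \<Otimes>\<^sub>M borel_of T) \<in> sets (borel_of T \<Otimes>\<^sub>M borel_of T)"
      using sets_borel_of_pair[OF assms(2,2)] by (auto simp: space_pair_measure)
  qed
  show "(\<lambda>x. inv x) \<in> borel_of T \<rightarrow>\<^sub>M borel_of T"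
    by (rule measurable_borel_of_continuous[OF cont(2)])
qed

text \<open>A point is coded by the set of numbers of the separating sets that contain it, and sets
  of naturals are coded by reals. Only cardinality enters, not a Borel isomorphism.\<close>

lemma standard_borel_inj_real:
  assumes "standard_borel M"
  obtains e :: "'x \<Rightarrow> real" where "inj_on e (space M)"
proof -
  obtain \<B> where \<B>: "countable \<B>" "\<B> \<subseteq> sets M" "sets M = sigma_sets (space M) \<B>"
    "separates_points \<B> (space M)"
    by (rule standard_borel_separating[OF assms])
  define c where "c x = {n. \<exists>A\<in>\<B>. to_nat_on \<B> A = n \<and> x \<in> A}" for x
  have c: "to_nat_on \<B> A \<in> c x \<longleftrightarrow> x \<in> A" if "A \<in> \<B>" for A x
    unfolding c_def using that inj_on_to_nat_on[OF \<B>(1)] by (auto dest: inj_onD)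
  have "inj_on c (space M)"
  proof (rule inj_onI)
    fix x y assume xy: "x \<in> space M" "y \<in> space M" "c x = c y"
    have "\<forall>A\<in>\<B>. x \<in> A \<longleftrightarrow> y \<in> A" using c[of _ x] c[of _ y] xy(3) by simp
    then show "x = y" using \<B>(4) xy(1,2) unfolding separates_points_def by simp
  qed
  moreover obtain e :: "nat set \<Rightarrow> real" where e: "bij_betw e UNIV UNIV"
    using nat_sets_eqpoll_reals unfolding eqpoll_def by (elim exE)
  have "inj_on e (c ` space M)" using e unfolding bij_betw_def by (auto intro: inj_on_subset)
  ultimately have "inj_on (e \<circ> c) (space M)" by (rule comp_inj_on)
  then show thesis by (rule that)
qed

text \<open>Averaging over \<open>k\<close> absorbs \<open>h\<close>: \<open>a k (a h x)\<close> is
  \<open>a (k \<otimes> h) x\<close>, and Haar measure is right invariant.\<close>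

lemma (in compact_action) avg_translate:
  assumes h: "h \<in> carrier K" and M': "compact_action (distr M M (a h)) K d m a"
  shows "compact_action.avg (distr M M (a h)) m a = avg"
proof -
  interpret T: compact_action "distr M M (a h)" K d m a by (rule M')
  note ah [measurable] = act_measurable'[OF h]
  show ?thesis
  proof (rule measure_eqI)
    fix A assume "A \<in> sets T.avg"
    then have A [measurable]: "A \<in> sets M" by simp
    have "emeasure T.avg A = (\<integral>\<^sup>+x. indicator A x \<partial>T.avg)" by simp
    also have "\<dots> = (\<integral>\<^sup>+x. \<integral>\<^sup>+k. indicator A (a k x) \<partial>m \<partial>distr M M (a h))"
      by (rule T.nn_integral_avg(2)) simp
    also have "\<dots> = (\<integral>\<^sup>+x. \<integral>\<^sup>+k. indicator A (a k (a h x)) \<partial>m \<partial>M)"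
      by (rule nn_integral_distr) measurable
    also have "\<dots> = (\<integral>\<^sup>+x. \<integral>\<^sup>+k. indicator A (a k x) \<partial>m \<partial>M)"
    proof (rule nn_integral_cong)
      fix x assume x: "x \<in> space M"
      have "(\<integral>\<^sup>+k. indicator A (a k (a h x)) \<partial>m) = (\<integral>\<^sup>+k. indicator A (a (k \<otimes> h) x) \<partial>m)"
        by (rule nn_integral_cong) (use act_mult h x in simp)
      also have "\<dots> = (\<integral>\<^sup>+k. indicator A (a k x) \<partial>m)"
        by (rule haar_right[OF _ _ h]) (use x in measurable)
      finally show "(\<integral>\<^sup>+k. indicator A (a k (a h x)) \<partial>m) = (\<integral>\<^sup>+k. indicator A (a k x) \<partial>m)" .
    qed
    also have "\<dots> = (\<integral>\<^sup>+x. indicator A x \<partial>avg)" by (rule nn_integral_avg(2)[symmetric]) simp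
    finally show "emeasure T.avg A = emeasure avg A" by simp
  qed simp
qed

context polish_action
begin

definition quasi_invariant_prob :: "'x measure \<Rightarrow> bool" where
  "quasi_invariant_prob \<mu> \<longleftrightarrow> prob_space \<mu> \<and> sets \<mu> = sets M \<and>
     (\<forall>h\<in>carrier G. \<forall>N\<in>sets M. emeasure \<mu> (a h -` N \<inter> space M) = 0 \<longleftrightarrow> emeasure \<mu> N = 0)"

text \<open>A countable dense set of group elements suffices by
  \<open>dense_stabilizer_imp_fixed\<close>, and each of the equations \<open>a h x = x\<close> is
  tested by countably many Borel sets.\<close>

lemma fixed_points_measurable: "{x \<in> space M. \<forall>h\<in>carrier G. a h x = x} \<in> sets M"
proof -
  obtain \<B> where \<B>: "countable \<B>" "\<B> \<subseteq> sets M" "sets M = sigma_sets (space M) \<B>"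
    "separates_points \<B> (space M)"
    by (rule standard_borel_separating[OF std])
  obtain D where D: "countable D" "D \<subseteq> topspace T" "topspace T \<subseteq> T closure_of D"
    by (rule dense_countable_subset[OF second_countable order_refl])
  have D_dense: "T closure_of D = carrier G"
    using D(3) closure_of_subset_topspace[of T D] by simp
  have DG: "D \<subseteq> carrier G" using D(2) by simp
  define S where "S h A = sym_diff (a h -` A \<inter> space M) A" for h A
  have eq: "a h x = x \<longleftrightarrow> (\<forall>A\<in>\<B>. a h x \<in> A \<longleftrightarrow> x \<in> A)" if "h \<in> carrier G" "x \<in> space M" for h x
    using \<B>(4) act_space[OF that] that(2) unfolding separates_points_def by auto
  have "{x \<in> space M. \<forall>h\<in>carrier G. a h x = x} = {x \<in> space M. \<forall>h\<in>D. a h x = x}"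
  proof (intro equalityI subsetI)
    fix x assume "x \<in> {x \<in> space M. \<forall>h\<in>D. a h x = x}"
    then have x: "x \<in> space M" "\<And>s. s \<in> D \<Longrightarrow> a s x = x" by auto
    show "x \<in> {x \<in> space M. \<forall>h\<in>carrier G. a h x = x}"
      using dense_stabilizer_imp_fixed[OF x(1) DG D_dense x(2)] x(1) by simp
  qed (use DG in auto)
  also have "\<dots> = space M - (\<Union>h\<in>D. \<Union>A\<in>\<B>. S h A)"
  proof -
    have "a h x = x \<longleftrightarrow> (\<forall>A\<in>\<B>. x \<notin> S h A)" if "h \<in> D" and x: "x \<in> space M" for h x
    proof -
      have "h \<in> carrier G" using that(1) DG by blast
      then show ?thesis unfolding eq[OF \<open>h \<in> carrier G\<close> x] S_def by (intro ball_cong refl) (use x in auto)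
    qed
    then show ?thesis by auto
  qed
  also have "\<dots> \<in> sets M"
  proof (intro sets.compl_sets sets.countable_UN'' D(1) \<B>(1))
    fix h A assume "h \<in> D" "A \<in> \<B>"
    then have "h \<in> carrier G" and A: "A \<in> sets M" using DG \<B>(2) by auto
    then have "a h -` A \<inter> space M \<in> sets M" by (intro measurable_sets[OF act_measurable'])
    then show "S h A \<in> sets M" unfolding S_def using A by (intro sets.Un sets.Diff)
  qed
  finally show ?thesis .
qed

end

context polish_metric_action
begin

text \<open>Haar measure of \<open>K\<close> lives on the Borel sets of the metric topology of
  \<open>K\<close>. This is the subspace topology, so the inclusion into \<open>G\<close> is Borel
  and the joint measurability of the action restricts.\<close>

lemma compact_action_subgroup:
  assumes K: "subgroup K G" and fam: "measure_metric_group (G\<lparr>carrier := K\<rparr>) d m"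
    and \<mu>: "quasi_invariant_prob \<mu>"
  shows "compact_action \<mu> (G\<lparr>carrier := K\<rparr>) d m a"
proof -
  have KG: "K \<subseteq> carrier G" using K by (rule subgroup.subset)
  interpret S: Submetric "carrier G" d K by unfold_locales (rule KG)
  let ?T = "Metric_space.mtopology K d"
  have T: "?T = subtopology T K" using S.mtopology_submetric topology by simp
  have sc: "second_countable ?T" unfolding T by (rule second_countable_subtopology[OF second_countable])
  have tg: "topological_group (G\<lparr>carrier := K\<rparr>) ?T" and m: "sets m = sets (borel_of ?T)"
    using fam unfolding measure_metric_group_def haar_probability_def by simp_all
  have \<mu>': "prob_space \<mu>" "sets \<mu> = sets M"
    "\<And>h N. h \<in> carrier G \<Longrightarrow> N \<in> sets M \<Longrightarrow> emeasure \<mu> (a h -` N \<inter> space M) = 0 \<Longrightarrow> emeasure \<mu> N = 0"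
    using \<mu> unfolding quasi_invariant_prob_def by auto
  have sp: "space \<mu> = space M" using \<mu>'(2) by (rule sets_eq_imp_space_eq)
  have mm: "sets (m \<Otimes>\<^sub>M m) = sets (borel_of ?T \<Otimes>\<^sub>M borel_of ?T)"
    using m m by (rule sets_pair_measure_cong)
  interpret prob_space \<mu> by (rule \<mu>'(1))
  show ?thesis
  proof
    show "measure_metric_group (G\<lparr>carrier := K\<rparr>) d m" by (rule fam)
    show "(\<lambda>(x, y). x \<otimes>\<^bsub>G\<lparr>carrier := K\<rparr>\<^esub> y) \<in> m \<Otimes>\<^sub>M m \<rightarrow>\<^sub>M m"
      using topological_group_measurable(1)[OF tg sc] unfolding measurable_cong_sets[OF mm m] .
    show "(\<lambda>x. inv\<^bsub>G\<lparr>carrier := K\<rparr>\<^esub> x) \<in> m \<rightarrow>\<^sub>M m"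
      using topological_group_measurable(2)[OF tg sc] unfolding measurable_cong_sets[OF m m] .
    have "continuous_map ?T T (\<lambda>x. x)" unfolding T by (simp add: continuous_map_from_subtopology)
    then have "(\<lambda>x. x) \<in> borel_of ?T \<rightarrow>\<^sub>M borel_of T" by (rule measurable_borel_of_continuous)
    then have id: "(\<lambda>x. x) \<in> m \<rightarrow>\<^sub>M borel_of T" unfolding measurable_cong_sets[OF m refl] .
    have id': "(\<lambda>x. x) \<in> \<mu> \<rightarrow>\<^sub>M M" using \<mu>'(2) by (rule measurable_ident_sets)
    have "(\<lambda>p. (fst p, snd p)) \<in> m \<Otimes>\<^sub>M \<mu> \<rightarrow>\<^sub>M borel_of T \<Otimes>\<^sub>M M"
      by (intro measurable_Pair measurable_compose[OF measurable_fst id] measurable_compose[OF measurable_snd id'])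
    from measurable_compose[OF this act_measurable]
    show "(\<lambda>(g, x). a g x) \<in> m \<Otimes>\<^sub>M \<mu> \<rightarrow>\<^sub>M \<mu>"
      unfolding measurable_cong_sets[OF refl \<mu>'(2)] by (simp add: case_prod_beta')
    show "a \<one>\<^bsub>G\<lparr>carrier := K\<rparr>\<^esub> x = x" if "x \<in> space \<mu>" for x
      using act_one that sp by simp
    show "a (g \<otimes>\<^bsub>G\<lparr>carrier := K\<rparr>\<^esub> h) x = a g (a h x)"
      if "g \<in> carrier (G\<lparr>carrier := K\<rparr>)" "h \<in> carrier (G\<lparr>carrier := K\<rparr>)" "x \<in> space \<mu>" for g h x
      using act_mult[of g h x] that KG sp by auto
    show "emeasure \<mu> N = 0"
      if "k \<in> carrier (G\<lparr>carrier := K\<rparr>)" "N \<in> sets \<mu>" "emeasure \<mu> (a k -` N \<inter> space \<mu>) = 0" for k N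
      using \<mu>'(3)[of k N] that KG sp \<mu>'(2) by auto
  qed
qed

lemma quasi_invariant_prob_translate:
  assumes \<mu>: "quasi_invariant_prob \<mu>" and h: "h \<in> carrier G"
  shows "quasi_invariant_prob (distr \<mu> \<mu> (a h))"
proof -
  have \<mu>': "prob_space \<mu>" "sets \<mu> = sets M"
    "\<And>h N. h \<in> carrier G \<Longrightarrow> N \<in> sets M \<Longrightarrow> emeasure \<mu> (a h -` N \<inter> space M) = 0 \<longleftrightarrow> emeasure \<mu> N = 0"
    using \<mu> unfolding quasi_invariant_prob_def by auto
  have sp: "space \<mu> = space M" using \<mu>'(2) by (rule sets_eq_imp_space_eq)
  have ah: "a h \<in> \<mu> \<rightarrow>\<^sub>M \<mu>" using act_measurable'[OF h] by (simp add: measurable_cong_sets[OF \<mu>'(2) \<mu>'(2)])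
  have e: "emeasure (distr \<mu> \<mu> (a h)) N = 0 \<longleftrightarrow> emeasure \<mu> N = 0" if "N \<in> sets M" for N
    using emeasure_distr[OF ah, of N] that \<mu>'(2) \<mu>'(3)[OF h that] by (simp add: sp)
  have "emeasure (distr \<mu> \<mu> (a h)) (a k -` N \<inter> space M) = 0 \<longleftrightarrow> emeasure (distr \<mu> \<mu> (a h)) N = 0"
    if "k \<in> carrier G" "N \<in> sets M" for k N
    using e[OF that(2)] e[OF measurable_sets[OF act_measurable'[OF that(1)] that(2)]] \<mu>'(3)[OF that] by simp
  then show ?thesis
    unfolding quasi_invariant_prob_def using prob_space.prob_space_distr[OF \<mu>'(1) ah] \<mu>'(2) by simp
qed

end

section \<open>Almost everywhere invariance for Wasserstein groups\<close>

locale wasserstein_action = polish_metric_action +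
  fixes K :: "nat \<Rightarrow> 'a set" and m :: "nat \<Rightarrow> 'a measure"
  assumes subgroups: "subgroup (K n) G" and incseq: "incseq K"
    and dense: "T closure_of (\<Union>n. K n) = carrier G"
    and family: "wasserstein_family (\<lambda>n. G\<lparr>carrier := K n\<rparr>) (\<lambda>n. d) m"
begin

lemma mmg: "measure_metric_group (G\<lparr>carrier := K n\<rparr>) d (m n)"
  using family unfolding wasserstein_family_def by simp

text \<open>With the radii \<open>r n\<close> given by the family, \<open>s n\<close> is the largest
  change of the measure of a set under an element of the ball of radius \<open>r n\<close> in
  \<open>K n\<close>. Since \<open>r n\<close> tends to 0, \<open>translates_locally_close\<close>
  makes \<open>s n\<close> tend to 0, and the modulus at this variation bounds the
  difference.\<close>

lemma averages_converge:
  assumes \<mu>: "quasi_invariant_prob \<mu>" and u: "u \<in> borel_measurable M"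
    and bnd: "\<And>x. x \<in> space M \<Longrightarrow> \<bar>u x\<bar> \<le> 1"
    and lip: "\<And>k x. k \<in> carrier G \<Longrightarrow> x \<in> space M \<Longrightarrow> \<bar>u (a k x) - u x\<bar> \<le> d \<one> k"
  shows "(\<lambda>n. (LINT x|\<mu>. u x) - (LINT x|compact_action.avg \<mu> (m n) a. u x)) \<longlonglongrightarrow> 0"
proof -
  have \<mu>': "prob_space \<mu>" "sets \<mu> = sets M"
    "\<And>h N. h \<in> carrier G \<Longrightarrow> N \<in> sets M \<Longrightarrow> emeasure \<mu> N = 0 \<Longrightarrow> emeasure \<mu> (a h -` N \<inter> space M) = 0"
    using \<mu> unfolding quasi_invariant_prob_def by auto
  interpret P: prob_space \<mu> by (rule \<mu>'(1))
  have sp: "space \<mu> = space M" using \<mu>'(2) by (rule sets_eq_imp_space_eq)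
  have KG: "K n \<subseteq> carrier G" for n using subgroups by (rule subgroup.subset)
  obtain r :: "nat \<Rightarrow> real" where r: "\<And>n. 0 < r n" "r \<longlonglongrightarrow> 0"
    "\<And>\<epsilon> :: nat \<Rightarrow> real. (\<And>n. 0 < \<epsilon> n) \<Longrightarrow> \<epsilon> \<longlonglongrightarrow> 0 \<Longrightarrow>
      (\<lambda>n. wasserstein_modulus (G\<lparr>carrier := K n\<rparr>) d (m n) (r n) (\<epsilon> n)) \<longlonglongrightarrow> 0"
    using family unfolding wasserstein_family_def by auto
  let ?v = "\<lambda>(h, A). \<bar>measure \<mu> (a h -` A \<inter> space M) - measure \<mu> A\<bar>"
  define I where "I n = group_ball (G\<lparr>carrier := K n\<rparr>) d (r n) \<times> sets M" for n
  define s where "s n = (SUP p\<in>I n. ?v p)" for n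
  have v1: "?v p \<le> 1" for p
  proof (cases p)
    case (Pair h A)
    have "0 \<le> measure \<mu> B" "measure \<mu> B \<le> 1" for B using P.prob_le_1 by simp_all
    from this[of A] this[of "a h -` A \<inter> space M"] show ?thesis unfolding Pair by (simp only: case_prod_conv abs_le_iff) linarith
  qed
  have bdd: "bdd_above (?v ` I n)" for n by (rule bdd_aboveI[of _ 1]) (use v1 in auto)
  have ne: "(\<one>, {}) \<in> I n" for n
    unfolding I_def group_ball_def using r(1)[of n] subgroup.one_closed[OF subgroups] by (simp add: less_imp_le)
  have v_s: "?v p \<le> s n" if "p \<in> I n" for p n
    unfolding s_def by (rule cSUP_upper[OF that bdd])
  have s0: "0 \<le> s n" for n using v_s[OF ne] by simp
  have s_lim: "s \<longlonglongrightarrow> 0"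
  proof (rule LIMSEQ_I)
    fix e :: real assume e: "0 < e"
    obtain \<rho> where \<rho>: "0 < \<rho>" "\<And>h A. h \<in> carrier G \<Longrightarrow> d \<one> h < \<rho> \<Longrightarrow> A \<in> sets M \<Longrightarrow>
      \<bar>measure \<mu> (a h -` A \<inter> space M) - measure \<mu> A\<bar> \<le> e / 2"
      by (rule translates_locally_close[OF \<mu>', of "e / 2"]) (use e that in auto)
    have "\<forall>\<^sub>F n in sequentially. r n < \<rho>" using r(2) \<rho>(1) by (rule order_tendstoD(2))
    then obtain N where N: "\<And>n. n \<ge> N \<Longrightarrow> r n < \<rho>" unfolding eventually_sequentially by auto
    have "norm (s n - 0) < e" if "n \<ge> N" for n
    proof -
      have "s n \<le> e / 2"
        unfolding s_def
      proof (rule cSUP_least)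
        show "I n \<noteq> {}" using ne by blast
        fix p assume "p \<in> I n"
        then show "?v p \<le> e / 2"
          using \<rho>(2) N[OF that] KG[of n] unfolding I_def group_ball_def by (cases p) force
      qed
      then show ?thesis using s0[of n] e by simp
    qed
    then show "\<exists>N. \<forall>n\<ge>N. norm (s n - 0) < e" by blast
  qed
  \<comment> \<open>The family is tested with strictly positive numbers only, while
    \<open>s n\<close> may be 0.\<close>
  define \<epsilon> where "\<epsilon> n = s n + 1 / real (Suc n)" for n
  have "\<epsilon> \<longlonglongrightarrow> 0 + 0" unfolding \<epsilon>_def by (intro tendsto_add s_lim LIMSEQ_Suc[OF lim_1_over_n])
  moreover have "0 < \<epsilon> n" for n unfolding \<epsilon>_def using s0[of n] by (simp add: add_nonneg_pos)
  ultimately have lim: "(\<lambda>n. wasserstein_modulus (G\<lparr>carrier := K n\<rparr>) d (m n) (r n) (\<epsilon> n)) \<longlonglongrightarrow> 0"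
    using r(3) by simp
  obtain e :: "'b \<Rightarrow> real" where e: "inj_on e (space M)" by (rule standard_borel_inj_real[OF std])
  let ?\<delta> = "\<lambda>n. (LINT x|\<mu>. u x) - (LINT x|compact_action.avg \<mu> (m n) a. u x)"
  have bound: "ennreal \<bar>?\<delta> n\<bar> \<le> wasserstein_modulus (G\<lparr>carrier := K n\<rparr>) d (m n) (r n) (\<epsilon> n)" for n
  proof -
    interpret C: compact_action \<mu> "G\<lparr>carrier := K n\<rparr>" d "m n" a
      by (rule compact_action_subgroup[OF subgroups mmg \<mu>])
    show ?thesis
    proof (rule C.wasserstein_modulus_bound)
      show "u \<in> borel_measurable \<mu>" using u by (simp add: measurable_cong_sets[OF \<mu>'(2) refl])
      show "\<bar>u x\<bar> \<le> 1" if "x \<in> space \<mu>" for x using bnd that sp by simp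
      show "\<bar>u (a k x) - u x\<bar> \<le> d \<one>\<^bsub>G\<lparr>carrier := K n\<rparr>\<^esub> k"
        if "k \<in> carrier (G\<lparr>carrier := K n\<rparr>)" "x \<in> space \<mu>" for k x
        using lip[of k x] that KG sp by auto
      show "\<bar>measure \<mu> (a h -` A \<inter> space \<mu>) - measure \<mu> A\<bar> \<le> \<epsilon> n"
        if "h \<in> group_ball (G\<lparr>carrier := K n\<rparr>) d (r n)" "A \<in> sets \<mu>" for h A
      proof -
        have "(h, A) \<in> I n" using that \<mu>'(2) unfolding I_def by simp
        then have "\<bar>measure \<mu> (a h -` A \<inter> space M) - measure \<mu> A\<bar> \<le> s n" using v_s by fastforce
        also have "\<dots> \<le> \<epsilon> n" unfolding \<epsilon>_def by simp
        finally show ?thesis unfolding sp .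
      qed
      show "inj_on e (space \<mu>)" using e sp by simp
    qed
  qed
  show ?thesis
  proof (rule LIMSEQ_I)
    fix c :: real assume c: "0 < c"
    then have "\<forall>\<^sub>F n in sequentially. wasserstein_modulus (G\<lparr>carrier := K n\<rparr>) d (m n) (r n) (\<epsilon> n) < ennreal c"
      using lim by (intro order_tendstoD(2)) auto
    then have "\<forall>\<^sub>F n in sequentially. norm (?\<delta> n - 0) < c"
    proof eventually_elim
      case (elim n)
      with bound[of n] have "ennreal \<bar>?\<delta> n\<bar> < ennreal c" by (rule le_less_trans)
      then show ?case using c by (simp add: ennreal_less_iff)
    qed
    then show "\<exists>N. \<forall>n\<ge>N. norm (?\<delta> n - 0) < c" unfolding eventually_sequentially .
  qed
qed

lemma integral_invariant:
  assumes \<mu>: "quasi_invariant_prob \<mu>" and u: "u \<in> borel_measurable M"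
    and bnd: "\<And>x. x \<in> space M \<Longrightarrow> \<bar>u x\<bar> \<le> 1"
    and lip: "\<And>k x. k \<in> carrier G \<Longrightarrow> x \<in> space M \<Longrightarrow> \<bar>u (a k x) - u x\<bar> \<le> d \<one> k"
    and h: "h \<in> (\<Union>n. K n)"
  shows "(LINT x|\<mu>. u (a h x)) = (LINT x|\<mu>. u x)"
proof -
  obtain N where N: "h \<in> K N" using h by blast
  have hK: "h \<in> K n" if "n \<ge> N" for n using incseqD[OF incseq that] N by blast
  have hG: "h \<in> carrier G" using subgroup.subset[OF subgroups] N by blast
  have s: "sets \<mu> = sets M" using \<mu> unfolding quasi_invariant_prob_def by simp
  have ah: "a h \<in> \<mu> \<rightarrow>\<^sub>M \<mu>" using act_measurable'[OF hG] by (simp add: measurable_cong_sets[OF s s])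
  let ?\<mu> = "distr \<mu> \<mu> (a h)"
  have \<mu>': "quasi_invariant_prob ?\<mu>" by (rule quasi_invariant_prob_translate[OF \<mu> hG])
  have eq: "compact_action.avg ?\<mu> (m n) a = compact_action.avg \<mu> (m n) a" if "n \<ge> N" for n
  proof -
    interpret C: compact_action \<mu> "G\<lparr>carrier := K n\<rparr>" d "m n" a
      by (rule compact_action_subgroup[OF subgroups mmg \<mu>])
    show ?thesis
      by (rule C.avg_translate) (use hK[OF that] compact_action_subgroup[OF subgroups mmg \<mu>'] in simp_all)
  qed
  let ?A = "\<lambda>\<mu> n. LINT x|compact_action.avg \<mu> (m n) a. u x"
  have "(\<lambda>n. ((LINT x|?\<mu>. u x) - ?A ?\<mu> n) - ((LINT x|\<mu>. u x) - ?A \<mu> n)) \<longlonglongrightarrow> 0 - 0"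
    by (intro tendsto_diff averages_converge \<mu> \<mu>' u bnd lip)
  \<comment> \<open>\<open>h\<close> belongs to \<open>K n\<close> from \<open>N\<close> on; there
    the averages cancel and the sequence is constant.\<close>
  moreover have "\<forall>\<^sub>F n in sequentially. ((LINT x|?\<mu>. u x) - ?A ?\<mu> n) - ((LINT x|\<mu>. u x) - ?A \<mu> n)
      = (LINT x|?\<mu>. u x) - (LINT x|\<mu>. u x)"
    using eventually_ge_at_top[of N] by eventually_elim (simp add: eq)
  ultimately have "(\<lambda>n. (LINT x|?\<mu>. u x) - (LINT x|\<mu>. u x)) \<longlonglongrightarrow> 0"
    using Lim_transform_eventually by fastforce
  then have "(LINT x|?\<mu>. u x) = (LINT x|\<mu>. u x)" by (simp add: tendsto_const_iff)
  moreover have "(LINT x|?\<mu>. u x) = (LINT x|\<mu>. u (a h x))"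
    by (rule integral_distr[OF ah]) (use u in \<open>simp add: measurable_cong_sets[OF s refl]\<close>)
  ultimately show ?thesis by simp
qed

text \<open>Let \<open>w\<close> be the difference and \<open>B\<close> the set where it is
  positive. Its integral vanishes against \<open>\<mu>\<close> and, as
  \<open>1 + indicator B\<close> is bounded and positive, also against the equivalent measure with
  this density. Hence \<open>w\<close> has integral 0 over \<open>B\<close>, so
  \<open>w \<le> 0\<close> almost everywhere, and having integral 0 it vanishes.\<close>

lemma AE_invariant:
  assumes \<mu>: "quasi_invariant_prob \<mu>" and u: "u \<in> borel_measurable M"
    and bnd: "\<And>x. x \<in> space M \<Longrightarrow> \<bar>u x\<bar> \<le> 1"
    and lip: "\<And>k x. k \<in> carrier G \<Longrightarrow> x \<in> space M \<Longrightarrow> \<bar>u (a k x) - u x\<bar> \<le> d \<one> k"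
    and h: "h \<in> (\<Union>n. K n)"
  shows "AE x in \<mu>. u (a h x) = u x"
proof -
  have \<mu>': "prob_space \<mu>" "sets \<mu> = sets M"
    "\<And>h N. h \<in> carrier G \<Longrightarrow> N \<in> sets M \<Longrightarrow> emeasure \<mu> (a h -` N \<inter> space M) = 0 \<longleftrightarrow> emeasure \<mu> N = 0"
    using \<mu> unfolding quasi_invariant_prob_def by auto
  interpret P: prob_space \<mu> by (rule \<mu>'(1))
  have sp: "space \<mu> = space M" using \<mu>'(2) by (rule sets_eq_imp_space_eq)
  have hG: "h \<in> carrier G" using subgroup.subset[OF subgroups] h by blast
  have ah [measurable]: "a h \<in> \<mu> \<rightarrow>\<^sub>M \<mu>"
    using act_measurable'[OF hG] by (simp add: measurable_cong_sets[OF \<mu>'(2) \<mu>'(2)])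
  have um [measurable]: "u \<in> borel_measurable \<mu>" using u by (simp add: measurable_cong_sets[OF \<mu>'(2) refl])
  define w where "w x = u (a h x) - u x" for x
  have wm [measurable]: "w \<in> borel_measurable \<mu>" unfolding w_def by measurable
  have ui: "integrable \<mu> u" "integrable \<mu> (\<lambda>x. u (a h x))"
    using bnd act_space[OF hG] by (auto intro!: P.integrable_const_bound[of _ 1] simp: sp)
  have wi: "integrable \<mu> w" unfolding w_def using ui by simp
  have w0: "(LINT x|\<mu>. w x) = 0"
    unfolding w_def using ui integral_invariant[OF \<mu> u bnd lip h] by simp
  define B where "B = {x \<in> space \<mu>. 0 < w x}"
  have B [measurable]: "B \<in> sets \<mu>" unfolding B_def by measurable
  \<comment> \<open>The integral of \<open>1 + indicator B\<close>, used to normalize it.\<close>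
  define c where "c = 1 + measure \<mu> B"
  have c: "0 < c" unfolding c_def by (simp add: add_pos_nonneg)
  define f where "f x = (1 + indicator B x) / c" for x
  have fm [measurable]: "f \<in> borel_measurable \<mu>" unfolding f_def by measurable
  have f: "0 < f x" for x unfolding f_def using c by (simp add: indicator_def)
  have f': "\<not> f x \<le> 0" for x using f[of x] by simp
  have Bi: "integrable \<mu> (indicator B :: _ \<Rightarrow> real)" by (simp add: less_top[symmetric])
  let ?\<nu> = "density \<mu> (\<lambda>x. ennreal (f x))"
  have "quasi_invariant_prob ?\<nu>"
    unfolding quasi_invariant_prob_def
  proof (intro conjI ballI)
    have fi: "integrable \<mu> f" unfolding f_def using Bi by simp
    have "(LINT x|\<mu>. f x) = 1"
      unfolding f_def using Bi c P.prob_space sets.sets_into_space[OF B] by (simp add: c_def Int_absorb2)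
    then have "(\<integral>\<^sup>+x. ennreal (f x) \<partial>\<mu>) = 1"
      using nn_integral_eq_integral[OF fi] f by (simp add: less_imp_le)
    then show "prob_space ?\<nu>"
      by (intro prob_spaceI) (simp add: emeasure_density cong: nn_integral_cong)
    show "sets ?\<nu> = sets M" using \<mu>'(2) by simp
    have z: "emeasure ?\<nu> N = 0 \<longleftrightarrow> emeasure \<mu> N = 0" if "N \<in> sets M" for N
    proof -
      have "N \<in> null_sets ?\<nu> \<longleftrightarrow> N \<in> null_sets \<mu>"
        using that \<mu>'(2) by (subst null_sets_density_iff) (auto simp: AE_iff_null_sets ennreal_eq_0_iff f')
      then show ?thesis using that \<mu>'(2) by (simp add: null_sets_def)
    qed
    fix k N assume kN: "k \<in> carrier G" "N \<in> sets M"
    show "emeasure ?\<nu> (a k -` N \<inter> space M) = 0 \<longleftrightarrow> emeasure ?\<nu> N = 0"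
      using z[OF kN(2)] z[OF measurable_sets[OF act_measurable'[OF kN(1)] kN(2)]] \<mu>'(3)[OF kN] by simp
  qed
  note \<nu> = integral_invariant[OF this u bnd lip h]
  have fw: "integrable \<mu> (\<lambda>x. f x * u (a h x))" "integrable \<mu> (\<lambda>x. f x * u x)"
    "integrable \<mu> (\<lambda>x. indicator B x * w x)"
  proof -
    have "integrable \<mu> (\<lambda>x. indicator B x * v x)" if "integrable \<mu> v" for v :: "_ \<Rightarrow> real"
      using integrable_mult_indicator[OF B that] by simp
    from this[OF ui(1)] this[OF ui(2)] this[OF wi]
    show "integrable \<mu> (\<lambda>x. f x * u (a h x))" "integrable \<mu> (\<lambda>x. f x * u x)"
      "integrable \<mu> (\<lambda>x. indicator B x * w x)"
      unfolding f_def using ui by (simp_all add: distrib_right)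
  qed
  have "0 = (LINT x|?\<nu>. u (a h x)) - (LINT x|?\<nu>. u x)" using \<nu> by simp
  also have "\<dots> = (LINT x|\<mu>. f x * u (a h x)) - (LINT x|\<mu>. f x * u x)"
    using f by (simp add: integral_density less_imp_le)
  also have "\<dots> = (LINT x|\<mu>. f x * w x)"
    using fw unfolding w_def by (simp add: right_diff_distrib)
  also have "\<dots> = (LINT x|\<mu>. (w x + indicator B x * w x) / c)"
    unfolding f_def by (simp add: distrib_right)
  also have "\<dots> = (LINT x|\<mu>. indicator B x * w x) / c"
    using wi fw(3) w0 by simp
  finally have "(LINT x|\<mu>. indicator B x * w x) = 0" using c by simp
  moreover have "AE x in \<mu>. 0 \<le> indicator B x * w x"
    unfolding B_def by (intro AE_I2) (simp add: indicator_def)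
  ultimately have "AE x in \<mu>. indicator B x * w x = 0"
    using integral_nonneg_eq_0_iff_AE[OF fw(3)] by simp
  then have neg: "AE x in \<mu>. 0 \<le> - w x"
    using AE_space by eventually_elim (auto simp: B_def indicator_def split: if_splits)
  have "(LINT x|\<mu>. - w x) = 0" using w0 by simp
  then have "AE x in \<mu>. - w x = 0"
    using integral_nonneg_eq_0_iff_AE[OF integrable_minus[OF wi] neg] by simp
  then show ?thesis unfolding w_def by eventually_elim simp
qed

text \<open>Each set \<open>A\<close> and each group element has its own exceptional null set, so
  both must range over countable families; \<open>D\<close> is taken inside the union of the
  \<open>K n\<close>, the elements for which invariance is known.\<close>

theorem AE_fixed:
  assumes \<mu>: "quasi_invariant_prob \<mu>"
  shows "AE x in \<mu>. \<forall>h\<in>carrier G. a h x = x"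
proof -
  have s: "sets \<mu> = sets M" using \<mu> unfolding quasi_invariant_prob_def by simp
  have sp: "space \<mu> = space M" using s by (rule sets_eq_imp_space_eq)
  obtain \<B> where \<B>: "countable \<B>" "\<B> \<subseteq> sets M" "sets M = sigma_sets (space M) \<B>"
    "separates_points \<B> (space M)"
    by (rule standard_borel_separating[OF std])
  have KG: "(\<Union>n. K n) \<subseteq> carrier G" using subgroup.subset[OF subgroups] by blast
  then have "(\<Union>n. K n) \<subseteq> topspace T" by simp
  then obtain D where D: "countable D" "D \<subseteq> (\<Union>n. K n)" "(\<Union>n. K n) \<subseteq> T closure_of D"
    by (rule dense_countable_subset[OF second_countable])
  have DG: "D \<subseteq> carrier G" using D(2) KG by (rule order_trans)
  have D_dense: "T closure_of D = carrier G"
  proof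
    show "T closure_of D \<subseteq> carrier G" using closure_of_subset_topspace[of T D] by simp
    show "carrier G \<subseteq> T closure_of D" using closure_of_mono[OF D(3), of T] dense by simp
  qed
  have ae: "AE x in \<mu>. ess_dist A (a k x) = ess_dist A x" if "A \<in> sets M" "k \<in> D" for A k
  proof (rule AE_invariant[OF \<mu> ess_dist_measurable[OF that(1)]])
    show "\<bar>ess_dist A x\<bar> \<le> 1" for x using ess_dist_nonneg[of A x] ess_dist_le_1[of A x] by simp
  qed (use ess_dist_lipschitz that(2) D(2) in auto)
  have "AE x in \<mu>. \<forall>A\<in>\<B>. \<forall>k\<in>D. ess_dist A (a k x) = ess_dist A x \<and>
      ess_dist (space M - A) (a k x) = ess_dist (space M - A) x"
    using \<B>(1,2) D(1) by (simp only: AE_ball_countable) (intro ballI AE_conjI ae; auto)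
  then show ?thesis
    using AE_space[of \<mu>]
  proof eventually_elim
    case (elim x)
    then show ?case
      using fixed_by_ess_dist_invariant[OF \<B>(1,2,4) D(1) DG D_dense, of x] sp by auto
  qed
qed

end

section \<open>From Wasserstein groups to locally Wasserstein groups\<close>

lemma equivalent_prob_space:
  assumes "sigma_finite_measure M" "emeasure M (space M) \<noteq> 0"
  obtains N where "prob_space N" "sets N = sets M" "null_sets N = null_sets M"
proof -
  interpret sigma_finite_measure M by fact
  obtain f where f: "f \<in> borel_measurable M" "integral\<^sup>N M f \<noteq> \<infinity>" "\<And>x. x \<in> space M \<Longrightarrow> 0 < f x \<and> f x < \<infinity>"
    using Ex_finite_integrable_function by blast
  note f(1) [measurable]
  define c where "c = integral\<^sup>N M f"
  have c0: "c \<noteq> 0"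
  proof
    assume "c = 0"
    then have "AE x in M. f x = 0" unfolding c_def by (subst (asm) nn_integral_0_iff_AE) simp_all
    then have "AE x in M. False"
      using AE_space
    proof eventually_elim
      case (elim x)
      then show False using f(3)[of x] by simp
    qed
    then show False using assms(2) AE_iff_null[of M "\<lambda>_. False"] by (simp add: null_sets_def)
  qed
  have cinf: "c \<noteq> \<infinity>" using f(2) unfolding c_def .
  let ?N = "density M (\<lambda>x. f x / c)"
  have "emeasure ?N (space ?N) = (\<integral>\<^sup>+x. f x / c \<partial>M)"
    by (simp add: emeasure_density cong: nn_integral_cong)
  also have "\<dots> = c / c" unfolding c_def by (rule nn_integral_divide) measurable
  also have "\<dots> = 1" using c0 cinf by (simp add: ennreal_divide_self less_top)
  finally have "prob_space ?N" by (rule prob_spaceI)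
  moreover have "null_sets ?N = null_sets M"
  proof (rule Set.set_eqI)
    fix A
    have nz: "f x / c \<noteq> 0" if "x \<in> space M" for x
      using f(3)[OF that] cinf by (auto simp: ennreal_divide_eq_0_iff)
    have "(AE x in M. x \<in> A \<longrightarrow> f x / c = 0) \<longleftrightarrow> (AE x in M. x \<notin> A)"
    proof
      assume "AE x in M. x \<in> A \<longrightarrow> f x / c = 0"
      then show "AE x in M. x \<notin> A" using AE_space by eventually_elim (use nz in blast)
    next
      assume "AE x in M. x \<notin> A"
      then show "AE x in M. x \<in> A \<longrightarrow> f x / c = 0" by eventually_elim simp
    qed
    then have "A \<in> null_sets ?N \<longleftrightarrow> A \<in> sets M \<and> (AE x in M. x \<notin> A)"
      by (subst null_sets_density_iff) simp_all
    also have "\<dots> \<longleftrightarrow> A \<in> null_sets M" by (metis AE_iff_null_sets null_setsD2)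
    finally show "A \<in> null_sets ?N \<longleftrightarrow> A \<in> null_sets M" .
  qed
  ultimately show thesis using that[of ?N] by simp
qed

theorem theorem1:
  fixes G :: "'g monoid" and T :: "'g topology"
    and \<mu> :: "'x measure" and act :: "'g \<Rightarrow> 'x \<Rightarrow> 'x"
  assumes "locally_wasserstein TYPE('h) G T"
    and "standard_borel_G_space G T \<mu> act"
    and "sigma_finite_measure \<mu>"
    and "quasi_invariant G act \<mu>"
  shows "space \<mu> - fixed_points G act (space \<mu>) \<in> null_sets \<mu>"
proof -
  have std: "standard_borel \<mu>" and ga: "group_action G (space \<mu>) act"
    and meas: "(\<lambda>(g, x). act g x) \<in> borel_of T \<Otimes>\<^sub>M \<mu> \<rightarrow>\<^sub>M \<mu>"
    using assms(2) unfolding standard_borel_G_space_def by auto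
  obtain H :: "nat \<Rightarrow> 'h monoid" and S \<iota> where
    H: "\<And>n. wasserstein_group (H n) (S n)" "\<And>n. \<iota> n \<in> hom (H n) G" "\<And>n. continuous_map (S n) T (\<iota> n)"
    and dense: "T closure_of (generate G (\<Union>n. \<iota> n ` carrier (H n))) = carrier G"
    and polish: "polish_group G T"
    using assms(1) unfolding locally_wasserstein_def by blast
  interpret ga: group_action G "space \<mu>" act by (rule ga)
  interpret A: polish_action G T \<mu> act
  proof
    show "act \<one>\<^bsub>G\<^esub> x = x" if "x \<in> space \<mu>" for x
      using ga.id_eq_one that by (metis restrict_apply')
    show "act (g \<otimes>\<^bsub>G\<^esub> h) x = act g (act h x)"
      if "g \<in> carrier G" "h \<in> carrier G" "x \<in> space \<mu>" for g h x
      using ga.composition_rule that by metis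
  qed (rule polish std meas)+
  have qi: "emeasure \<mu> (act g -` N \<inter> space \<mu>) = 0 \<longleftrightarrow> emeasure \<mu> N = 0"
    if g: "g \<in> carrier G" and N: "N \<in> sets \<mu>" for g N
  proof -
    have "null_sets (distr \<mu> \<mu> (act g)) = null_sets \<mu>"
      using assms(4) g unfolding quasi_invariant_def absolutely_continuous_def by blast
    then have "N \<in> null_sets (distr \<mu> \<mu> (act g)) \<longleftrightarrow> N \<in> null_sets \<mu>" by simp
    then show ?thesis
      using N by (simp add: null_sets_def emeasure_distr[OF A.act_measurable'[OF g]])
  qed
  have AE_n: "AE x in \<mu>. \<forall>h\<in>carrier (H n). act (\<iota> n h) x = x" for n
  \<comment> \<open>The zero measure has no equivalent probability measure and is treated
    apart.\<close>
  proof (cases "emeasure \<mu> (space \<mu>) = 0")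
    case True
    then have "space \<mu> \<in> null_sets \<mu>" by (intro null_setsI) auto
    then show ?thesis by (rule AE_I') auto
  next
    case False
    \<comment> \<open>Quasi-invariance and the claim depend only on the null sets, so the one passes
      to \<open>\<nu>\<close> and the other back to \<open>\<mu>\<close>.\<close>
    obtain \<nu> where \<nu>: "prob_space \<nu>" "sets \<nu> = sets \<mu>" "null_sets \<nu> = null_sets \<mu>"
      by (rule equivalent_prob_space[OF assms(3) False])
    have null_eq: "emeasure \<nu> N = 0 \<longleftrightarrow> emeasure \<mu> N = 0" if "N \<in> sets \<mu>" for N
    proof -
      have "N \<in> null_sets \<nu> \<longleftrightarrow> N \<in> null_sets \<mu>" using \<nu>(3) by simp
      then show ?thesis using that \<nu>(2) by (simp add: null_sets_def)
    qed
    obtain d K m where d: "Metric_space (carrier (H n)) d" "Metric_space.mtopology (carrier (H n)) d = S n"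
        "right_invariant (H n) d"
      and K: "\<And>i. subgroup (K i) (H n)" "incseq K" "S n closure_of (\<Union>i. K i) = carrier (H n)"
      and fam: "wasserstein_family (\<lambda>i. (H n)\<lparr>carrier := K i\<rparr>) (\<lambda>i. d) m"
      and pH: "polish_group (H n) (S n)"
      using H(1)[of n] unfolding wasserstein_group_def by auto
    have gH: "group (H n)" using pH unfolding polish_group_def topological_group_def by simp
    interpret h: group_hom "H n" G "\<iota> n"
      using gH A.group_axioms H(2)[of n] by (intro group_hom.intro group_hom_axioms.intro)
    have \<iota>: "\<iota> n \<in> borel_of (S n) \<rightarrow>\<^sub>M borel_of T" by (rule measurable_borel_of_continuous[OF H(3)])
    interpret W: wasserstein_action "H n" "S n" \<mu> "\<lambda>h. act (\<iota> n h)" d K m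
    proof (intro wasserstein_action.intro polish_metric_action.intro polish_action.intro
        polish_metric_action_axioms.intro wasserstein_action_axioms.intro)
      have "(\<lambda>p. (\<iota> n (fst p), snd p)) \<in> borel_of (S n) \<Otimes>\<^sub>M \<mu> \<rightarrow>\<^sub>M borel_of T \<Otimes>\<^sub>M \<mu>"
        using \<iota> by measurable
      from measurable_compose[OF this meas]
      show "(\<lambda>(h, x). act (\<iota> n h) x) \<in> borel_of (S n) \<Otimes>\<^sub>M \<mu> \<rightarrow>\<^sub>M \<mu>"
        by (simp add: case_prod_beta')
      show "act (\<iota> n \<one>\<^bsub>H n\<^esub>) x = x" if "x \<in> space \<mu>" for x
        using that A.act_one by simp
      show "act (\<iota> n (g \<otimes>\<^bsub>H n\<^esub> k)) x = act (\<iota> n g) (act (\<iota> n k) x)"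
        if "g \<in> carrier (H n)" "k \<in> carrier (H n)" "x \<in> space \<mu>" for g k x
        using that A.act_mult by simp
    qed (rule pH std d K fam)+
    have "W.quasi_invariant_prob \<nu>"
      unfolding W.quasi_invariant_prob_def
    proof (intro conjI ballI \<nu>(1,2))
      fix k N assume kN: "k \<in> carrier (H n)" "N \<in> sets \<mu>"
      then have k: "\<iota> n k \<in> carrier G" by simp
      show "emeasure \<nu> (act (\<iota> n k) -` N \<inter> space \<mu>) = 0 \<longleftrightarrow> emeasure \<nu> N = 0"
        using null_eq[OF kN(2)] null_eq[OF measurable_sets[OF A.act_measurable'[OF k] kN(2)]] qi[OF k kN(2)]
        by simp
    qed
    then have "AE x in \<nu>. \<forall>h\<in>carrier (H n). act (\<iota> n h) x = x" by (rule W.AE_fixed)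
    then obtain N where N: "{x \<in> space \<nu>. \<not> (\<forall>h\<in>carrier (H n). act (\<iota> n h) x = x)} \<subseteq> N" "N \<in> null_sets \<nu>"
      unfolding eventually_ae_filter by auto
    then show ?thesis
      using \<nu>(3) sets_eq_imp_space_eq[OF \<nu>(2)] by (intro AE_I'[of N]) auto
  qed
  have fixed: "\<forall>g\<in>carrier G. act g x = x"
    if x: "x \<in> space \<mu>" and fx: "\<forall>n. \<forall>h\<in>carrier (H n). act (\<iota> n h) x = x" for x
  proof
    fix g assume g: "g \<in> carrier G"
    have sub: "(\<Union>n. \<iota> n ` carrier (H n)) \<subseteq> carrier G"
      using H(2) unfolding hom_def by blast
    have gen: "generate G (\<Union>n. \<iota> n ` carrier (H n)) \<subseteq> carrier G"
      using A.generate_incl[OF sub] .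
    have "act s x = x" if "s \<in> generate G (\<Union>n. \<iota> n ` carrier (H n))" for s
      using that
    proof (induction s rule: generate.induct)
      case one
      show ?case by (rule A.act_one[OF x])
    next
      case (incl h)
      then show ?case using fx by auto
    next
      case (inv h)
      then have "act h x = x" using fx by auto
      moreover have "h \<in> carrier G" using inv sub by (rule subsetD[rotated])
      ultimately show ?case using A.act_inv[of h x] x by simp
    next
      case (eng h1 h2)
      then have "h1 \<in> carrier G" "h2 \<in> carrier G" using gen by auto
      then show ?case using A.act_mult[of h1 h2 x] x eng.IH by simp
    qed
    then show "act g x = x" by (rule A.dense_stabilizer_imp_fixed[OF x gen dense _ g])
  qed
  have "AE x in \<mu>. \<forall>n. \<forall>h\<in>carrier (H n). act (\<iota> n h) x = x"
    using AE_n by (simp add: AE_all_countable)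
  then have "AE x in \<mu>. x \<in> fixed_points G act (space \<mu>)"
    using AE_space by eventually_elim (use fixed in \<open>simp add: fixed_points_def\<close>)
  \<comment> \<open>Membership in \<open>null_sets\<close> requires a measurable set; the statement
    almost everywhere alone only places the complement inside a null set.\<close>
  moreover have "fixed_points G act (space \<mu>) \<in> sets \<mu>"
    using A.fixed_points_measurable unfolding fixed_points_def .
  ultimately show ?thesis
    by (subst AE_iff_null_sets) (auto elim: eventually_mono)
qed

end
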